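(* Let $(\mathfrak g,\mathcal F_\bullet\mathfrak g,R)$ be a filtered Rota–Baxter Lie algebra over a field $\mathbf k$ of characteristic zero, and let $\widehat{\mathfrak g}$, $\widehat U(\mathfrak g)$, $\mathbb G$, $\exp$, $\log$, $*$ and $\widehat{\mathcal R}$ be as described in the context. Then the map $\mathfrak R:\widehat{\mathfrak g}\to\widehat{\mathfrak g}$ defined by $$\mathfrak R(x)=\log\big(\widehat{\mathcal R}(\exp(x))\big),\qquad x\in\widehat{\mathfrak g},$$ is a Rota–Baxter operator on the group $(\widehat{\mathfrak g},* )$, i.e. $\mathfrak R(x)*\mathfrak R(y)=\mathfrak R\big(x*\mathfrak R(x)*y*\mathfrak R(x)^{-1}\big)$ for all $x,y\in\widehat{\mathfrak g}$ (inverse taken in $(\widehat{\mathfrak g},* )$). In particular, if $(\mathfrak g,\mathcal F_\bullet\mathfrak g,R)$ is a complete Rota–Baxter Lie algebra (so $\mathfrak g\cong\widehat{\mathfrak g}$), then $(\mathfrak g,*,\mathfrak R)$, with $\mathfrak R$ defined by the same formula for all $x\in\mathfrak g$, is a Rota–Baxter group.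
   Context: A filtered Lie algebra $(\mathfrak g,\mathcal F_\bullet\mathfrak g)$ is a Lie algebra $\mathfrak g$ with subspaces $\mathfrak g=\mathcal F_1\mathfrak g\supset\mathcal F_2\mathfrak g\supset\cdots$ such that $[\mathcal F_n\mathfrak g,\mathcal F_m\mathfrak g]\subset\mathcal F_{n+m}\mathfrak g$ for all $n,m\ge1$. A Rota–Baxter operator (of weight 1) on a Lie algebra is a linear map $R$ with $[R(x),R(y)]=R([R(x),y]+[x,R(y)]+[x,y])$. A filtered Rota–Baxter Lie algebra $(\mathfrak g,\mathcal F_\bullet\mathfrak g,R)$ is a filtered Lie algebra with a Rota–Baxter operator $R$ satisfying $R(\mathcal F_n\mathfrak g)\subset\mathcal F_n\mathfrak g$ for all $n\ge1$; it is complete if the natural map $\mathfrak g\to\varprojlim_n\mathfrak g/\mathcal F_{n+1}\mathfrak g$ is bijective. A Rota–Baxter group is a group $G$ with a map $\mathfrak R:G\to G$ satisfying $\mathfrak R(g)\mathfrak R(h)=\mathfrak R(g\mathfrak R(g)h\mathfrak R(g)^{-1})$ for all $g,h\in G$. The filtered universal enveloping algebra: $\mathcal F_0U(\mathfrak g)=U(\mathfrak g)$ and, for $n\ge1$, $\mathcal F_nU(\mathfrak g)$ is the span of products $x_1\cdots x_k$ with $k\ge1$, $x_i\in\mathcal F_{n_i}\mathfrak g$, $\sum_i n_i\ge n$. Let $\mathcal R:U(\mathfrak g)\to U(\mathfrak g)$ be the (well-defined) linear map determined by $\mathcal R(1)=1$, $\mathcal R(x)=R(x)$ and $\mathcal R(xh)=R(x)\mathcal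 R(h)-\mathcal R([R(x),h])$ for $x\in\mathfrak g$, $h\in U(\mathfrak g)$. It satisfies $\mathcal R(\mathcal F_nU(\mathfrak g))\subset\mathcal F_nU(\mathfrak g)$ for all $n$, hence induces a map $\widehat{\mathcal R}$ on the completion $\widehat U(\mathfrak g)=\varprojlim_n U(\mathfrak g)/\mathcal F_{n}U(\mathfrak g)$ (acting componentwise). $\widehat U(\mathfrak g)$ is a complete Hopf algebra whose operations are induced from those of $U(\mathfrak g)$; its coproduct $\widehat\Delta$ takes values in the completion $\widehat U(\mathfrak g)\hat\otimes\widehat U(\mathfrak g)$ of $U(\mathfrak g)\otimes U(\mathfrak g)$ with respect to the filtration $\mathcal F_n(U\otimes U)=\sum_{i+j=n}\mathcal F_iU\otimes\mathcal F_jU$. The completion $\widehat{\mathfrak g}=\varprojlim_n\mathfrak g/\mathcal F_{n+1}\mathfrak g$ is regarded as a subspace of $\mathcal F_1\widehat U(\mathfrak g)=\ker\big(\widehat U(\mathfrak g)\to U(\mathfrak g)/\mathcal F_1U(\mathfrak g)\big)$. For $x\in\mathcal F_1\widehat U(\mathfrak g)$, $\exp(x)=\sum_{n\ge0}x^n/n!$ (convergent). $\mathbb G$ denotes the group of nonzero $g\in\widehat U(\mathfrak g)$ with $\widehat\Delta(g)=g\hat\otimes g$; the map $\exp:\widehat{\mathfrak g}\to\mathbb G$ is a bijection with inverse $\log$, and $x*y=\log(\exp(x)\exp(y))$ (the Baker–Campbell–Hausdorff product) is a group structure on $\widehat{\mathfrak g}$ making $\exp$ a group isomorphism. Moreover $\widehat{\mathcal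 R}(\mathbb G)\subset\mathbb G$. *)

theory Defs
  imports Main "HOL.Vector_Spaces" "HOL-Library.Function_Algebras" "HOL-Algebra.Group"
begin

definition lie_algebra :: "('k::field \<Rightarrow> 'g::ab_group_add \<Rightarrow> 'g) \<Rightarrow> ('g \<Rightarrow> 'g \<Rightarrow> 'g) \<Rightarrow> bool" where
  "lie_algebra scale br \<longleftrightarrow>
     Vector_Spaces.vector_space scale \<and>
     (\<forall>x y z. br (x + y) z = br x z + br y z) \<and>
     (\<forall>x y z. br x (y + z) = br x y + br x z) \<and>
     (\<forall>c x y. br (scale c x) y = scale c (br x y)) \<and>
     (\<forall>c x y. br x (scale c y) = scale c (br x y)) \<and>
     (\<forall>x. br x x = 0) \<and>
     (\<forall>x y z. br x (br y z) + br y (br z x) + br z (br x y) = 0)"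

text \<open>Filtration F 1 = g, F 1 \<supseteq> F 2 \<supseteq> ..., by subspaces, with [F n, F m] \<subseteq> F (n+m).
  (F 0 plays no role.)\<close>
definition filtered_lie_algebra ::
  "('k::field \<Rightarrow> 'g::ab_group_add \<Rightarrow> 'g) \<Rightarrow> ('g \<Rightarrow> 'g \<Rightarrow> 'g) \<Rightarrow> (nat \<Rightarrow> 'g set) \<Rightarrow> bool" where
  "filtered_lie_algebra scale br F \<longleftrightarrow>
     lie_algebra scale br \<and>
     (\<forall>n\<ge>1. Modules.module.subspace scale (F n)) \<and>
     F 1 = UNIV \<and>
     (\<forall>n\<ge>1. F (Suc n) \<subseteq> F n) \<and>
     (\<forall>n m x y. 1 \<le> n \<longrightarrow> 1 \<le> m \<longrightarrow> x \<in> F n \<longrightarrow> y \<in> F m \<longrightarrow> br x y \<in> F (n + m))"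

definition rota_baxter_lie ::
  "('k::field \<Rightarrow> 'g::ab_group_add \<Rightarrow> 'g) \<Rightarrow> ('g \<Rightarrow> 'g \<Rightarrow> 'g) \<Rightarrow> ('g \<Rightarrow> 'g) \<Rightarrow> bool" where
  "rota_baxter_lie scale br R \<longleftrightarrow>
     Vector_Spaces.linear scale scale R \<and>
     (\<forall>x y. br (R x) (R y) = R (br (R x) y + br x (R y) + br x y))"

definition filtered_rb_lie_algebra ::
  "('k::field \<Rightarrow> 'g::ab_group_add \<Rightarrow> 'g) \<Rightarrow> ('g \<Rightarrow> 'g \<Rightarrow> 'g) \<Rightarrow> (nat \<Rightarrow> 'g set) \<Rightarrow> ('g \<Rightarrow> 'g) \<Rightarrow> bool" where
  "filtered_rb_lie_algebra scale br F R \<longleftrightarrow>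
     filtered_lie_algebra scale br F \<and> rota_baxter_lie scale br R \<and>
     (\<forall>n\<ge>1. R ` F n \<subseteq> F n)"

text \<open>Compatible sequences: x n represents an element of g / F (n+1); the family
  (x n) is an element of lim g/F(n+1) iff x (n+1) - x n \<in> F (n+1).\<close>
definition compat_seq :: "(nat \<Rightarrow> 'g::ab_group_add set) \<Rightarrow> (nat \<Rightarrow> 'g) \<Rightarrow> bool" where
  "compat_seq F x \<longleftrightarrow> (\<forall>n. x (Suc n) - x n \<in> F (Suc n))"

text \<open>Completeness: the natural map g \<rightarrow> lim g/F(n+1) is injective and surjective.\<close>
definition complete_filtration :: "(nat \<Rightarrow> 'g::ab_group_add set) \<Rightarrow> bool" where
  "complete_filtration F \<longleftrightarrow>
     (\<forall>x y::'g. (\<forall>n. x - y \<in> F (Suc n)) \<longrightarrow> x = y) \<and>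
     (\<forall>s. compat_seq F s \<longrightarrow> (\<exists>x. \<forall>n. x - s n \<in> F (Suc n)))"

text \<open>Elements: finitely supported functions from words over g to 'k; multiplication is
  concatenation of words. U(g) is the quotient by the two-sided ideal fa_ideal.\<close>
definition fa :: "('g list \<Rightarrow> 'k::field) set" where
  "fa = {f. finite {w. f w \<noteq> 0}}"

definition fa_word :: "'g list \<Rightarrow> 'g list \<Rightarrow> 'k::field" where
  "fa_word u = (\<lambda>w. if w = u then 1 else 0)"

definition fa_one :: "'g list \<Rightarrow> 'k::field" where
  "fa_one = fa_word []"

definition fa_gen :: "'g \<Rightarrow> 'g list \<Rightarrow> 'k::field" where
  "fa_gen x = fa_word [x]"

definition fa_smult :: "'k::field \<Rightarrow> ('g list \<Rightarrow> 'k) \<Rightarrow> 'g list \<Rightarrow> 'k" where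
  "fa_smult c f = (\<lambda>w. c * f w)"

definition fa_mult :: "('g list \<Rightarrow> 'k::field) \<Rightarrow> ('g list \<Rightarrow> 'k) \<Rightarrow> 'g list \<Rightarrow> 'k" where
  "fa_mult f h = (\<lambda>w. \<Sum>i\<le>length w. f (take i w) * h (drop i w))"

primrec fa_pow :: "('g list \<Rightarrow> 'k::field) \<Rightarrow> nat \<Rightarrow> 'g list \<Rightarrow> 'k" where
  "fa_pow f 0 = fa_one"
| "fa_pow f (Suc k) = fa_mult f (fa_pow f k)"

inductive_set fa_ideal :: "('k::field \<Rightarrow> 'g::ab_group_add \<Rightarrow> 'g) \<Rightarrow> ('g \<Rightarrow> 'g \<Rightarrow> 'g) \<Rightarrow> ('g list \<Rightarrow> 'k) set"
  for scale br where
  gen_add: "fa_gen (x + y) - fa_gen x - fa_gen y \<in> fa_ideal scale br"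
| gen_scale: "fa_gen (scale c x) - fa_smult c (fa_gen x) \<in> fa_ideal scale br"
| gen_br: "fa_mult (fa_gen x) (fa_gen y) - fa_mult (fa_gen y) (fa_gen x) - fa_gen (br x y) \<in> fa_ideal scale br"
| zero: "0 \<in> fa_ideal scale br"
| add: "f \<in> fa_ideal scale br \<Longrightarrow> h \<in> fa_ideal scale br \<Longrightarrow> f + h \<in> fa_ideal scale br"
| smult: "f \<in> fa_ideal scale br \<Longrightarrow> fa_smult c f \<in> fa_ideal scale br"
| lmult: "a \<in> fa \<Longrightarrow> f \<in> fa_ideal scale br \<Longrightarrow> fa_mult a f \<in> fa_ideal scale br"
| rmult: "a \<in> fa \<Longrightarrow> f \<in> fa_ideal scale br \<Longrightarrow> fa_mult f a \<in> fa_ideal scale br"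

inductive_set fa_filt :: "(nat \<Rightarrow> 'g set) \<Rightarrow> nat \<Rightarrow> ('g list \<Rightarrow> 'k::field) set"
  for F n where
  word: "xs \<noteq> [] \<Longrightarrow> length ns = length xs \<Longrightarrow>
         (\<forall>i<length xs. 1 \<le> ns ! i \<and> xs ! i \<in> F (ns ! i)) \<Longrightarrow> n \<le> sum_list ns \<Longrightarrow>
         fa_word xs \<in> fa_filt F n"
| zero: "0 \<in> fa_filt F n"
| add: "f \<in> fa_filt F n \<Longrightarrow> h \<in> fa_filt F n \<Longrightarrow> f + h \<in> fa_filt F n"
| smult: "f \<in> fa_filt F n \<Longrightarrow> fa_smult c f \<in> fa_filt F n"

text \<open>Preimage in the free algebra of F_n U(g): F_0 U = U, and for n \<ge> 1 the span above plus the ideal.\<close>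
definition fa_J :: "('k::field \<Rightarrow> 'g::ab_group_add \<Rightarrow> 'g) \<Rightarrow> ('g \<Rightarrow> 'g \<Rightarrow> 'g) \<Rightarrow> (nat \<Rightarrow> 'g set) \<Rightarrow> nat \<Rightarrow> ('g list \<Rightarrow> 'k) set" where
  "fa_J scale br F n =
     (if n = 0 then fa else {f \<in> fa. \<exists>p \<in> fa_filt F n. f - p \<in> fa_ideal scale br})"

text \<open>The operator \<R> on words: \<R>(1) = 1, \<R>(x h) = R(x) \<R>(h) - \<R>([R x, h]), where
  [a, y_1...y_k] = sum_i y_1 ... [a,y_i] ... y_k; extended linearly.\<close>
function rb_word :: "('g \<Rightarrow> 'g) \<Rightarrow> ('g \<Rightarrow> 'g \<Rightarrow> 'g) \<Rightarrow> 'g list \<Rightarrow> 'g list \<Rightarrow> 'k::field" where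
  "rb_word R br [] = fa_one"
| "rb_word R br (x # w) =
     fa_mult (fa_gen (R x)) (rb_word R br w) -
     (\<Sum>i<length w. rb_word R br (w[i := br (R x) (w ! i)]))"
  by pat_completeness auto
termination by (relation "measure (\<lambda>(R, br, w). length w)") auto

definition rb_U :: "('g \<Rightarrow> 'g) \<Rightarrow> ('g \<Rightarrow> 'g \<Rightarrow> 'g) \<Rightarrow> ('g list \<Rightarrow> 'k::field) \<Rightarrow> 'g list \<Rightarrow> 'k" where
  "rb_U R br f = (\<Sum>w\<in>{w. f w \<noteq> 0}. fa_smult (f w) (rb_word R br w))"

text \<open>An element of \<Uhat>(g) = lim U/F_nU is represented by a sequence u with u n in the free
  algebra representing the n-th component (mod fa_J n); two sequences represent the same
  element iff hat_eq holds. Operations are componentwise.\<close>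
definition hat_eq :: "('k::field \<Rightarrow> 'g::ab_group_add \<Rightarrow> 'g) \<Rightarrow> ('g \<Rightarrow> 'g \<Rightarrow> 'g) \<Rightarrow> (nat \<Rightarrow> 'g set) \<Rightarrow>
     (nat \<Rightarrow> 'g list \<Rightarrow> 'k) \<Rightarrow> (nat \<Rightarrow> 'g list \<Rightarrow> 'k) \<Rightarrow> bool" where
  "hat_eq scale br F u v \<longleftrightarrow> (\<forall>n. u n - v n \<in> fa_J scale br F n)"

definition hat_mult :: "(nat \<Rightarrow> 'g list \<Rightarrow> 'k::field) \<Rightarrow> (nat \<Rightarrow> 'g list \<Rightarrow> 'k) \<Rightarrow> nat \<Rightarrow> 'g list \<Rightarrow> 'k" where
  "hat_mult u v = (\<lambda>n. fa_mult (u n) (v n))"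

definition hat_neg :: "(nat \<Rightarrow> 'g list \<Rightarrow> 'k::field) \<Rightarrow> nat \<Rightarrow> 'g list \<Rightarrow> 'k" where
  "hat_neg u = (\<lambda>n. - u n)"

text \<open>exp(u) = sum_k u^k/k!; on the n-th component terms with k \<ge> n vanish for u \<in> F_1.\<close>
definition hat_exp :: "(nat \<Rightarrow> 'g list \<Rightarrow> 'k::field) \<Rightarrow> nat \<Rightarrow> 'g list \<Rightarrow> 'k" where
  "hat_exp u = (\<lambda>n. \<Sum>k\<le>n. fa_smult (1 / of_nat (fact k)) (fa_pow (u n) k))"

definition hat_log :: "(nat \<Rightarrow> 'g list \<Rightarrow> 'k::field) \<Rightarrow> nat \<Rightarrow> 'g list \<Rightarrow> 'k" where
  "hat_log v = (\<lambda>n. \<Sum>k\<in>{1..n}. fa_smult ((-1) ^ (k + 1) / of_nat k) (fa_pow (v n - fa_one) k))"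

definition hat_star :: "(nat \<Rightarrow> 'g list \<Rightarrow> 'k::field) \<Rightarrow> (nat \<Rightarrow> 'g list \<Rightarrow> 'k) \<Rightarrow> nat \<Rightarrow> 'g list \<Rightarrow> 'k" where
  "hat_star u v = hat_log (hat_mult (hat_exp u) (hat_exp v))"

definition hat_R :: "('g \<Rightarrow> 'g) \<Rightarrow> ('g \<Rightarrow> 'g \<Rightarrow> 'g) \<Rightarrow> (nat \<Rightarrow> 'g list \<Rightarrow> 'k::field) \<Rightarrow> nat \<Rightarrow> 'g list \<Rightarrow> 'k" where
  "hat_R R br u = (\<lambda>n. rb_U R br (u n))"

definition RB_group_op :: "('g \<Rightarrow> 'g) \<Rightarrow> ('g \<Rightarrow> 'g \<Rightarrow> 'g) \<Rightarrow> (nat \<Rightarrow> 'g list \<Rightarrow> 'k::field) \<Rightarrow> nat \<Rightarrow> 'g list \<Rightarrow> 'k" where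
  "RB_group_op R br u = hat_log (hat_R R br (hat_exp u))"

definition ghat_emb :: "(nat \<Rightarrow> 'g) \<Rightarrow> nat \<Rightarrow> 'g list \<Rightarrow> 'k::field" where
  "ghat_emb x = (\<lambda>n. fa_gen (x n))"

definition in_ghat :: "('k::field \<Rightarrow> 'g::ab_group_add \<Rightarrow> 'g) \<Rightarrow> ('g \<Rightarrow> 'g \<Rightarrow> 'g) \<Rightarrow> (nat \<Rightarrow> 'g set) \<Rightarrow>
     (nat \<Rightarrow> 'g list \<Rightarrow> 'k) \<Rightarrow> bool" where
  "in_ghat scale br F u \<longleftrightarrow> (\<exists>x. compat_seq F x \<and> hat_eq scale br F u (ghat_emb x))"

definition g_star :: "('k::field \<Rightarrow> 'g::ab_group_add \<Rightarrow> 'g) \<Rightarrow> ('g \<Rightarrow> 'g \<Rightarrow> 'g) \<Rightarrow> (nat \<Rightarrow> 'g set) \<Rightarrow> 'g \<Rightarrow> 'g \<Rightarrow> 'g" where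
  "g_star scale br F x y =
     (THE z. hat_eq scale br F (ghat_emb (\<lambda>_. z))
               (hat_star (ghat_emb (\<lambda>_. x) :: nat \<Rightarrow> 'g list \<Rightarrow> 'k) (ghat_emb (\<lambda>_. y))))"

definition g_RB :: "('k::field \<Rightarrow> 'g::ab_group_add \<Rightarrow> 'g) \<Rightarrow> ('g \<Rightarrow> 'g \<Rightarrow> 'g) \<Rightarrow> (nat \<Rightarrow> 'g set) \<Rightarrow> ('g \<Rightarrow> 'g) \<Rightarrow> 'g \<Rightarrow> 'g" where
  "g_RB scale br F R x =
     (THE z. hat_eq scale br F (ghat_emb (\<lambda>_. z))
               (RB_group_op R br (ghat_emb (\<lambda>_. x) :: nat \<Rightarrow> 'g list \<Rightarrow> 'k)))"

definition rota_baxter_group :: "('a, 'b) monoid_scheme \<Rightarrow> ('a \<Rightarrow> 'a) \<Rightarrow> bool" where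
  "rota_baxter_group G RR \<longleftrightarrow>
     group G \<and> RR \<in> carrier G \<rightarrow> carrier G \<and>
     (\<forall>g\<in>carrier G. \<forall>h\<in>carrier G.
        RR g \<otimes>\<^bsub>G\<^esub> RR h = RR (g \<otimes>\<^bsub>G\<^esub> RR g \<otimes>\<^bsub>G\<^esub> h \<otimes>\<^bsub>G\<^esub> inv\<^bsub>G\<^esub> (RR g)))"

end

(* For w in the completed Lie algebra let L_w h = w h + [R w, h]. By definition of the extended
   operator, RR (L_w h) = R(w) RR(h), so RR (exp(L_w) h) = exp(R w) RR(h). On the other hand L_w is
   left multiplication by w + R w minus right multiplication by R w, and these commute, whence
   exp(L_w) h = exp(w + R w) h exp(- R w). If exp(x) = exp(w + R w) exp(- R w), it follows that
   RR (exp x) = exp(R w) and RR (g RR(g) h RR(g)^-1) = RR(g) RR(h) for g = exp x. Such a w is found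
   by successive approximation, using the Baker-Campbell-Hausdorff theorem.

   To come back from the completed enveloping algebra to the Lie algebra, one needs in addition that
   an element of g lying in F_n U(g) lies in F_n g. This is proved by letting g act on Lie polynomial
   maps g -> g through left invariant vector fields, modulo F_n g. *)

theory Submission
  imports Defs "HOL-Computational_Algebra.Formal_Power_Series"
begin

subsection \<open>The free algebra as a ring\<close>

text \<open>All computations are congruences between elements of the free algebra modulo the ideals
  \<open>J n\<close>; exponentials and logarithms are truncated sums, so each argument keeps track
  of the degree up to which it is valid. Words are over the underlying set of g, hence even
  additivity of \<open>gen\<close> is a relation, and the operator must be shown to respect all
  relations before equations of U(g) can be fed into it. Two facts about U(g) carry the rest. The
  Baker-Campbell-Hausdorff theorem is proved in the free algebra on the set g: word length is a
  grading there, and the Euler derivation turns a product of exponentials into an equation that is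
  solved degree by degree. Recovering F_n g from F_n U(g) calls for a linear map from U(g) to g
  modulo F_n g that is the identity on g and respects the filtrations. Left invariant vector fields
  in exponential coordinates provide it: since ad y raises the filtration degree, their coefficients
  can be truncated to Lie polynomials in y.\<close>

lemma fa_word_mult: "fa_mult (fa_word u) (fa_word v) = (fa_word (u @ v) :: 'g list \<Rightarrow> 'k::field)"
proof
  fix w :: "'g list"
  have "(\<Sum>i\<le>length w. fa_word u (take i w) * fa_word v (drop i w) :: 'k) =
        (\<Sum>i\<le>length w. if i = length u then (if w = u @ v then 1 else 0) else 0)"
  proof (rule sum.cong)
    fix i assume "i \<in> {..length w}"
    then have "take i w = u \<and> drop i w = v \<longleftrightarrow> i = length u \<and> w = u @ v"
      by (metis append_eq_conv_conj append_take_drop_id atMost_iff length_take min_absorb2)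
    moreover have "fa_word u (take i w) * fa_word v (drop i w) =
        (if take i w = u \<and> drop i w = v then 1 else (0::'k))"
      by (simp add: fa_word_def)
    ultimately show "fa_word u (take i w) * fa_word v (drop i w) =
        (if i = length u then (if w = u @ v then 1 else 0) else (0::'k))"
      by simp
  qed simp
  also have "\<dots> = fa_word (u @ v) w"
    by (auto simp: fa_word_def sum.delta)
  finally show "fa_mult (fa_word u) (fa_word v) w = (fa_word (u @ v) w :: 'k)"
    by (simp add: fa_mult_def)
qed

lemma fa_mult_assoc: "fa_mult (fa_mult f g) h = fa_mult f (fa_mult g h)"
proof
  fix w :: "'a list"
  let ?n = "length w"
  have "fa_mult (fa_mult f g) h w =
      (\<Sum>i\<le>?n. \<Sum>j\<le>i. f (take j w) * (g (drop j (take i w)) * h (drop i w)))"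
    unfolding fa_mult_def sum_distrib_right
    by (intro sum.cong refl) (auto simp: min_def mult.assoc)
  also have "\<dots> = (\<Sum>(i,j)\<in>(SIGMA i:{..?n}. {..i}). f (take j w) * (g (drop j (take i w)) * h (drop i w)))"
    by (simp add: sum.Sigma)
  also have "\<dots> = (\<Sum>(j,l)\<in>(SIGMA j:{..?n}. {..?n-j}).
      f (take j w) * (g (take l (drop j w)) * h (drop l (drop j w))))"
    by (rule sum.reindex_bij_witness[where i = "\<lambda>(j,l). (j+l,j)" and j = "\<lambda>(i,j). (j,i-j)"])
       (auto simp: drop_take)
  also have "\<dots> = (\<Sum>j\<le>?n. \<Sum>l\<le>?n-j. f (take j w) * (g (take l (drop j w)) * h (drop l (drop j w))))"
    by (simp add: sum.Sigma)
  also have "\<dots> = fa_mult f (fa_mult g h) w"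
    unfolding fa_mult_def sum_distrib_left by simp
  finally show "fa_mult (fa_mult f g) h w = fa_mult f (fa_mult g h) w" .
qed

lemma fa_one_mult [simp]: "fa_mult fa_one f = f"
proof
  fix w
  have "fa_mult fa_one f w = (\<Sum>i\<le>length w. if i = 0 then f w else 0)"
    unfolding fa_mult_def fa_one_def fa_word_def by (intro sum.cong) auto
  then show "fa_mult fa_one f w = f w" by simp
qed

lemma fa_mult_one [simp]: "fa_mult f fa_one = f"
proof
  fix w
  have "fa_mult f fa_one w = (\<Sum>i\<le>length w. if i = length w then f w else 0)"
    unfolding fa_mult_def fa_one_def fa_word_def by (intro sum.cong) auto
  then show "fa_mult f fa_one w = f w" by simp
qed

lemma fa_memI: "finite S \<Longrightarrow> (\<And>w. w \<notin> S \<Longrightarrow> f w = 0) \<Longrightarrow> f \<in> fa"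
  unfolding fa_def by (auto intro: finite_subset)

lemma fa_zero: "0 \<in> fa" and fa_word_mem: "fa_word u \<in> fa"
  by (auto simp: fa_def fa_word_def)

lemma fa_add: "f \<in> fa \<Longrightarrow> h \<in> fa \<Longrightarrow> f + h \<in> fa"
  by (rule fa_memI[of "{w. f w \<noteq> 0} \<union> {w. h w \<noteq> 0}"]) (auto simp: fa_def)

lemma fa_uminus: "f \<in> fa \<Longrightarrow> - f \<in> fa"
  by (auto simp: fa_def)

lemma fa_diff: "f \<in> fa \<Longrightarrow> h \<in> fa \<Longrightarrow> f - h \<in> fa"
  by (rule fa_memI[of "{w. f w \<noteq> 0} \<union> {w. h w \<noteq> 0}"]) (auto simp: fa_def)

lemma fa_smult_mem: "f \<in> fa \<Longrightarrow> fa_smult c f \<in> fa"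
  by (rule fa_memI[of "{w. f w \<noteq> 0}"]) (auto simp: fa_def fa_smult_def)

lemma fa_mult_mem:
  assumes "f \<in> fa" "h \<in> fa" shows "fa_mult f h \<in> fa"
proof (rule fa_memI)
  show "finite ((\<lambda>(u,v). u @ v) ` ({w. f w \<noteq> 0} \<times> {w. h w \<noteq> 0}))"
    using assms by (auto simp: fa_def)
  fix w assume *: "w \<notin> (\<lambda>(u,v). u @ v) ` ({w. f w \<noteq> 0} \<times> {w. h w \<noteq> 0})"
  have "f (take i w) * h (drop i w) = 0" for i
    using * by (force simp: image_iff)
  then show "fa_mult f h w = 0" unfolding fa_mult_def by (intro sum.neutral) blast
qed

text \<open>With a type of its own the free algebra becomes an instance of \<open>ring_1\<close>, so
  that powers, sums and \<open>algebra_simps\<close> are available; \<open>Rep_falg\<close> leads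
  back to the functions of the statement.\<close>

typedef (overloaded) ('g, 'k) falg = "fa :: ('g list \<Rightarrow> 'k::field) set"
  using fa_zero by blast

setup_lifting type_definition_falg

instantiation falg :: (type, field) ring_1
begin
lift_definition zero_falg :: "('a,'b) falg" is 0 by (rule fa_zero)
lift_definition one_falg :: "('a,'b) falg" is fa_one by (simp add: fa_one_def fa_word_mem)
lift_definition plus_falg :: "('a,'b) falg \<Rightarrow> ('a,'b) falg \<Rightarrow> ('a,'b) falg" is "(+)" by (rule fa_add)
lift_definition minus_falg :: "('a,'b) falg \<Rightarrow> ('a,'b) falg \<Rightarrow> ('a,'b) falg" is "(-)" by (rule fa_diff)
lift_definition uminus_falg :: "('a,'b) falg \<Rightarrow> ('a,'b) falg" is uminus by (rule fa_uminus)
lift_definition times_falg :: "('a,'b) falg \<Rightarrow> ('a,'b) falg \<Rightarrow> ('a,'b) falg" is fa_mult by (rule fa_mult_mem)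
instance
proof
  show "(0::('a,'b) falg) \<noteq> 1"
    by transfer (auto simp: fa_one_def fa_word_def fun_eq_iff)
qed (transfer; simp add: fa_mult_assoc; simp add: fa_mult_def fun_eq_iff algebra_simps sum.distrib)+
end

lift_definition sc :: "'k::field \<Rightarrow> ('g,'k) falg \<Rightarrow> ('g,'k) falg" is fa_smult by (rule fa_smult_mem)
lift_definition W :: "'g list \<Rightarrow> ('g,'k::field) falg" is fa_word by (rule fa_word_mem)
lift_definition cf :: "('g,'k::field) falg \<Rightarrow> 'g list \<Rightarrow> 'k" is "\<lambda>f. f" .

definition gen :: "'g \<Rightarrow> ('g,'k::field) falg" where "gen x = W [x]"

lemma W_append: "W (u @ v) = W u * W v"
  by transfer (simp add: fa_word_mult)
lemma W_Nil: "W [] = 1"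
  by transfer (simp add: fa_one_def)
lemma W_Cons: "W (x # w) = gen x * W w"
  by (simp add: gen_def flip: W_append)

lemma vector_space_sc: "vector_space (sc :: 'k::field \<Rightarrow> ('g,'k) falg \<Rightarrow> _)"
  by unfold_locales (transfer; auto simp: fa_smult_def algebra_simps)+

interpretation A: vector_space sc
  by (rule vector_space_sc)

lemma sc_mult_left: "sc c a * b = sc c (a * b)"
  by transfer (auto simp: fa_smult_def fa_mult_def sum_distrib_left algebra_simps)
lemma sc_mult_right: "a * sc c b = sc c (a * b)"
  by transfer (auto simp: fa_smult_def fa_mult_def sum_distrib_left algebra_simps)

lemma finite_cf: "finite {w. cf a w \<noteq> 0}"
  by transfer (simp add: fa_def)

lemma cf_add [simp]: "cf (a + b) w = cf a w + cf b w"
  and cf_zero [simp]: "cf 0 w = 0"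
  and cf_sc [simp]: "cf (sc c a) w = c * cf a w"
  and cf_W: "cf (W u) w = (if w = u then 1 else 0)"
  by (transfer; simp add: fa_smult_def fa_word_def)+

lemma cf_sum: "cf (sum f S) w = (\<Sum>i\<in>S. cf (f i) w)"
  by (induction S rule: infinite_finite_induct) auto

lemma falg_eqI: "(\<And>w. cf a w = cf b w) \<Longrightarrow> a = b"
  by transfer auto

lemma falg_expand: "a = (\<Sum>w\<in>{w. cf a w \<noteq> 0}. sc (cf a w) (W w))"
  by (rule falg_eqI) (auto simp: cf_sum cf_W if_distrib finite_cf cong: if_cong)

lemma falg_induct [case_names zero add word]:
  assumes "P 0" "\<And>a b. P a \<Longrightarrow> P b \<Longrightarrow> P (a + b)" "\<And>c w. P (sc c (W w))"
  shows "P a"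
proof -
  have "P (sum f S)" if "\<And>i. P (f i)" for f :: "'a list \<Rightarrow> ('a,'b) falg" and S
    using that assms(1,2) by (induction S rule: infinite_finite_induct) auto
  then show ?thesis
    using assms(3) falg_expand[of a] by (metis (no_types, lifting))
qed

text \<open>Words form a basis of the free algebra, so this is linear extension from a basis. The
  operators \<open>der\<close>, \<open>RR\<close>, \<open>Lam\<close> and \<open>euler\<close> are
  all obtained from it.\<close>

definition lext :: "('k::field \<Rightarrow> 'v::ab_group_add \<Rightarrow> 'v) \<Rightarrow> ('g list \<Rightarrow> 'v) \<Rightarrow> ('g,'k) falg \<Rightarrow> 'v" where
  "lext s f a = (\<Sum>w\<in>{w. cf a w \<noteq> 0}. s (cf a w) (f w))"

context vector_space
begin

lemma lext_superset:
  assumes "finite S" "{w. cf a w \<noteq> 0} \<subseteq> S"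
  shows "lext scale f a = (\<Sum>w\<in>S. scale (cf a w) (f w))"
  unfolding lext_def by (rule sum.mono_neutral_left) (use assms in auto)

lemma lext_zero [simp]: "lext scale f 0 = 0"
  by (simp add: lext_def)

lemma lext_add: "lext scale f (a + b) = lext scale f a + lext scale f b"
proof -
  let ?S = "{w. cf a w \<noteq> 0} \<union> {w. cf b w \<noteq> 0}"
  have S: "finite ?S" using finite_cf by blast
  have "lext scale f (a + b) = (\<Sum>w\<in>?S. scale (cf (a + b) w) (f w))"
    by (rule lext_superset[OF S]) auto
  moreover have "lext scale f a = (\<Sum>w\<in>?S. scale (cf a w) (f w))"
    by (rule lext_superset[OF S]) auto
  moreover have "lext scale f b = (\<Sum>w\<in>?S. scale (cf b w) (f w))"
    by (rule lext_superset[OF S]) auto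
  ultimately show ?thesis by (simp add: scale_left_distrib sum.distrib)
qed

lemma lext_sc: "lext scale f (sc c a) = scale c (lext scale f a)"
proof -
  have "lext scale f (sc c a) = (\<Sum>w\<in>{w. cf a w \<noteq> 0}. scale (cf (sc c a) w) (f w))"
    by (rule lext_superset[OF finite_cf]) auto
  then show ?thesis by (simp add: lext_def scale_sum_right)
qed

lemma lext_W: "lext scale f (W u) = f u"
proof -
  have "lext scale f (W u) = (\<Sum>w\<in>{u}. scale (cf (W u) w) (f w))"
    by (rule lext_superset) (auto simp: cf_W)
  then show ?thesis by (simp add: cf_W)
qed

lemma lext_uminus: "lext scale f (- a) = - lext scale f a"
  using lext_add[of f a "- a"] by (simp add: eq_neg_iff_add_eq_0 add.commute)

lemma lext_diff: "lext scale f (a - b) = lext scale f a - lext scale f b"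
  using lext_add[of f a "- b"] by (simp add: lext_uminus)

lemma lext_sum: "lext scale f (sum g S) = (\<Sum>i\<in>S. lext scale f (g i))"
  by (induction S rule: infinite_finite_induct) (auto simp: lext_add)

end

lemma span_mult:
  fixes S T X :: "('a, 'b::field) falg set"
  assumes "a \<in> A.span S" "b \<in> A.span T" "\<And>x y. x \<in> S \<Longrightarrow> y \<in> T \<Longrightarrow> x * y \<in> A.span X"
  shows "a * b \<in> A.span X"
  using assms(1)
proof (induction rule: A.span_induct_alt)
  case base then show ?case by (simp add: A.span_zero)
next
  case (step c x y)
  have "x * b \<in> A.span X"
    using assms(2)
  proof (induction rule: A.span_induct_alt)
    case base then show ?case by (simp add: A.span_zero)
  next
    case (step c' x' y')
    then show ?case
      using assms(3)[OF \<open>x \<in> S\<close>] by (simp add: distrib_left sc_mult_right A.span_add A.span_scale)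
  qed
  then show ?case using step by (simp add: distrib_right sc_mult_left A.span_add A.span_scale)
qed

lemma span_words: "a \<in> A.span (range W)"
  by (induction a rule: falg_induct) (auto intro: A.span_zero A.span_add A.span_scale A.span_base)

subsection \<open>Exponential and logarithm in filtered algebras\<close>

unbundle fps_syntax

text \<open>Since \<open>Suc m\<close> is i + (\<open>Suc m\<close> - i), this is the product rule
  for the derivative of a product of two power series, read off at one coefficient. It turns
  identities between convolutions with factorials into recursions.\<close>

lemma (in vector_space) scale_conv_Suc:
  fixes f :: "nat \<Rightarrow> nat \<Rightarrow> 'b"
  shows "scale (of_nat (Suc m)) (\<Sum>i\<le>Suc m. f i (Suc m - i)) =
    (\<Sum>i\<le>m. scale (of_nat (Suc i)) (f (Suc i) (m - i))) +
    (\<Sum>i\<le>m. scale (of_nat (Suc (m - i))) (f i (Suc (m - i))))"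
proof -
  have "scale (of_nat (Suc m)) (\<Sum>i\<le>Suc m. f i (Suc m - i)) =
      (\<Sum>i\<le>Suc m. scale (of_nat i) (f i (Suc m - i)) + scale (of_nat (Suc m - i)) (f i (Suc m - i)))"
    unfolding scale_sum_right scale_left_distrib[symmetric] of_nat_add[symmetric]
    by (intro sum.cong refl) simp
  also have "\<dots> = (\<Sum>i\<le>Suc m. scale (of_nat i) (f i (Suc m - i))) +
      (\<Sum>i\<le>Suc m. scale (of_nat (Suc m - i)) (f i (Suc m - i)))"
    by (simp only: sum.distrib)
  also have "(\<Sum>i\<le>Suc m. scale (of_nat i) (f i (Suc m - i))) =
      (\<Sum>i\<le>m. scale (of_nat (Suc i)) (f (Suc i) (m - i)))"
    by (subst sum.atMost_Suc_shift) simp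
  also have "(\<Sum>i\<le>Suc m. scale (of_nat (Suc m - i)) (f i (Suc m - i))) =
      (\<Sum>i\<le>m. scale (of_nat (Suc (m - i))) (f i (Suc (m - i))))"
    by (subst sum.atMost_Suc) (simp add: Suc_diff_le)
  finally show ?thesis .
qed

text \<open>The square and the triangle differ by terms with i + j at least \<open>M\<close>. It
  serves modulo \<open>J n\<close>, modulo \<open>F n\<close>, and with the zero subspace for exact
  identities.\<close>

lemma (in vector_space) triangle_subspace:
  fixes c :: "nat \<Rightarrow> nat \<Rightarrow> 'b"
  assumes S: "subspace S" and c: "\<And>i j. M \<le> i + j \<Longrightarrow> c i j \<in> S" and "M \<le> N"
  shows "(\<Sum>k<M. \<Sum>i\<le>k. c i (k - i)) - (\<Sum>i<N. \<Sum>j<N. c i j) \<in> S"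
proof -
  let ?A = "{(i,j). i + j < M}" and ?B = "{..<N} \<times> {..<N}"
  have "(\<Sum>i<N. \<Sum>j<N. c i j) = (\<Sum>(i,j)\<in>?B. c i j)"
    by (simp add: sum.cartesian_product)
  also have "\<dots> = (\<Sum>(i,j)\<in>?B - ?A. c i j) + (\<Sum>(i,j)\<in>?A. c i j)"
    using \<open>M \<le> N\<close> by (intro sum.subset_diff) auto
  also have "(\<Sum>(i,j)\<in>?A. c i j) = (\<Sum>k<M. \<Sum>i\<le>k. c i (k - i))"
    by (rule sum.triangle_reindex)
  finally have "(\<Sum>k<M. \<Sum>i\<le>k. c i (k - i)) - (\<Sum>i<N. \<Sum>j<N. c i j) = - (\<Sum>(i,j)\<in>?B - ?A. c i j)"
    by simp
  moreover have "(\<Sum>(i,j)\<in>?B - ?A. c i j) \<in> S"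
    by (rule subspace_sum[OF S]) (use c in \<open>auto simp: not_less\<close>)
  ultimately show ?thesis by (simp add: S subspace_neg)
qed

text \<open>Abstract because the free algebra carries two filtrations of this kind:
  \<open>J\<close>, which defines the completion, and word length, used for
  Baker-Campbell-Hausdorff. Together \<open>J_0\<close> and \<open>J_mult\<close> make every
  \<open>J n\<close> a two-sided ideal.\<close>

locale filtered_algebra = vector_space s for s :: "'k::field_char_0 \<Rightarrow> 'a::ring_1 \<Rightarrow> 'a" +
  fixes J :: "nat \<Rightarrow> 'a set"
  assumes s_mult_left: "s c a * b = s c (a * b)"
    and s_mult_right: "a * s c b = s c (a * b)"
    and J_0: "J 0 = UNIV"
    and J_Suc: "J (Suc n) \<subseteq> J n"
    and J_subspace: "subspace (J n)"
    and J_mult: "a \<in> J m \<Longrightarrow> b \<in> J n \<Longrightarrow> a * b \<in> J (m + n)"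
begin

lemma cancel_Suc: "s (of_nat (Suc n)) x = s (of_nat (Suc n)) y \<Longrightarrow> x = y"
  by (simp del: of_nat_Suc)

lemma J_zero [simp]: "0 \<in> J n"
  using J_subspace subspace_0 by blast
lemma J_add: "a \<in> J n \<Longrightarrow> b \<in> J n \<Longrightarrow> a + b \<in> J n"
  using J_subspace subspace_add by blast
lemma J_diff: "a \<in> J n \<Longrightarrow> b \<in> J n \<Longrightarrow> a - b \<in> J n"
  using J_subspace subspace_diff by blast
lemma J_uminus: "a \<in> J n \<Longrightarrow> - a \<in> J n"
  using J_subspace subspace_neg by blast
lemma J_scale: "a \<in> J n \<Longrightarrow> s c a \<in> J n"
  using J_subspace subspace_scale by blast
lemma J_sum: "(\<And>i. i \<in> S \<Longrightarrow> f i \<in> J n) \<Longrightarrow> sum f S \<in> J n"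
  using J_subspace subspace_sum by blast

lemma J_mono: "m \<le> n \<Longrightarrow> a \<in> J n \<Longrightarrow> a \<in> J m"
  using lift_Suc_antimono_le[of J] J_Suc by blast

lemma J_mult_left: "b \<in> J n \<Longrightarrow> a * b \<in> J n"
  using J_mult[of a 0 b n] by (simp add: J_0)
lemma J_mult_right: "a \<in> J n \<Longrightarrow> a * b \<in> J n"
  using J_mult[of a n b 0] by (simp add: J_0)

definition eqv :: "nat \<Rightarrow> 'a \<Rightarrow> 'a \<Rightarrow> bool" where "eqv n a b \<longleftrightarrow> a - b \<in> J n"

lemma eqv_refl [simp]: "eqv n a a"
  by (simp add: eqv_def)
lemma eqv_0 [simp]: "eqv 0 a b"
  by (simp add: eqv_def J_0)
lemma eqv_sym: "eqv n a b \<Longrightarrow> eqv n b a"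
  unfolding eqv_def using J_uminus[of "a - b" n] by simp
lemma eqv_trans [trans]: "eqv n a b \<Longrightarrow> eqv n b c \<Longrightarrow> eqv n a c"
  unfolding eqv_def using J_add[of "a - b" n "b - c"] by simp
lemma eqv_add: "eqv n a b \<Longrightarrow> eqv n c d \<Longrightarrow> eqv n (a + c) (b + d)"
  unfolding eqv_def using J_add[of "a - b" n "c - d"] by (simp add: algebra_simps)
lemma eqv_diff: "eqv n a b \<Longrightarrow> eqv n c d \<Longrightarrow> eqv n (a - c) (b - d)"
  unfolding eqv_def using J_diff[of "a - b" n "c - d"] by (simp add: algebra_simps)
lemma eqv_uminus: "eqv n a b \<Longrightarrow> eqv n (- a) (- b)"
  using eqv_diff[of n 0 0 a b] by simp
lemma eqv_scale: "eqv n a b \<Longrightarrow> eqv n (s c a) (s c b)"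
  unfolding eqv_def using J_scale[of "a - b" n c] by (simp add: scale_right_diff_distrib)
lemma eqv_mult:
  assumes "eqv n a b" "eqv n c d" shows "eqv n (a * c) (b * d)"
proof -
  have "a * c - b * d = (a - b) * c + b * (c - d)" by (simp add: algebra_simps)
  then show ?thesis
    using assms unfolding eqv_def by (simp add: J_add J_mult_left J_mult_right)
qed
lemma eqv_sum: "(\<And>i. i \<in> S \<Longrightarrow> eqv n (f i) (g i)) \<Longrightarrow> eqv n (sum f S) (sum g S)"
  by (induction S rule: infinite_finite_induct) (auto intro: eqv_add)
lemma eqv_power: "eqv n a b \<Longrightarrow> eqv n (a ^ k) (b ^ k)"
  by (induction k) (auto intro: eqv_mult)
lemma eqv_mono: "m \<le> n \<Longrightarrow> eqv n a b \<Longrightarrow> eqv m a b"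
  unfolding eqv_def by (rule J_mono)
lemma eqv_J: "eqv n a b \<Longrightarrow> m \<le> n \<Longrightarrow> a \<in> J m \<longleftrightarrow> b \<in> J m"
  using J_add[of "a - b" m b] J_diff[of a m "a - b"] J_mono[of m n "a - b"] unfolding eqv_def by auto

lemma power_J: "u \<in> J 1 \<Longrightarrow> u ^ k \<in> J k"
proof (induction k)
  case (Suc k) then show ?case using J_mult[of u 1 "u ^ k" k] by simp
qed (simp add: J_0)

lemma eqv_triangle:
  assumes "\<And>i j. c i j \<in> J (i + j)"
  shows "eqv N (\<Sum>k<N. \<Sum>i\<le>k. c i (k - i)) (\<Sum>i<N. \<Sum>j<N. c i j)"
  unfolding eqv_def using assms J_mono by (intro triangle_subspace J_subspace) blast+

text \<open>For \<open>u\<close> in \<open>J 1\<close> the omitted terms lie in \<open>J N\<close>,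
  so modulo \<open>J N\<close> this is a homomorphism compatible with composition. Identities
  between exponential and logarithm are thereby transported from formal power series.\<close>

definition ev :: "nat \<Rightarrow> 'k fps \<Rightarrow> 'a \<Rightarrow> 'a" where
  "ev N f u = (\<Sum>k<N. s (f $ k) (u ^ k))"

lemma ev_1: "N > 0 \<Longrightarrow> ev N 1 u = 1"
  by (cases N) (simp_all add: ev_def sum.lessThan_Suc_shift del: sum.lessThan_Suc)

lemma ev_diff: "ev N (f - g) u = ev N f u - ev N g u"
  by (simp add: ev_def scale_left_diff_distrib sum_subtractf)

lemma ev_cong: "eqv n u v \<Longrightarrow> eqv n (ev N f u) (ev N f v)"
  unfolding ev_def by (intro eqv_sum eqv_scale eqv_power)

lemma ev_truncate:
  assumes "u \<in> J 1" "N \<le> M" shows "eqv N (ev M f u) (ev N f u)"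
proof -
  have "ev M f u - ev N f u = (\<Sum>k\<in>{..<M} - {..<N}. s (f $ k) (u ^ k))"
    unfolding ev_def using assms(2) by (subst sum_diff) auto
  then show ?thesis
    using J_sum[of "{..<M} - {..<N}" "\<lambda>k. s (f $ k) (u ^ k)" N] power_J[OF assms(1)] J_mono[of N]
    by (auto simp: eqv_def intro!: J_scale)
qed

lemma ev_mult:
  assumes "u \<in> J 1" shows "eqv N (ev N (f * g) u) (ev N f u * ev N g u)"
proof -
  let ?c = "\<lambda>i j. s (f $ i) (u ^ i) * s (g $ j) (u ^ j)"
  have "ev N (f * g) u = (\<Sum>k<N. \<Sum>i\<le>k. ?c i (k - i))"
    unfolding ev_def fps_mult_nth atLeast0AtMost scale_sum_left
    by (intro sum.cong refl) (simp add: s_mult_left s_mult_right mult.commute flip: power_add)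
  moreover have "ev N f u * ev N g u = (\<Sum>i<N. \<Sum>j<N. ?c i j)"
    unfolding ev_def by (rule sum_product)
  moreover have "?c i j \<in> J (i + j)" for i j
    by (intro J_mult J_scale power_J assms)
  ultimately show ?thesis using eqv_triangle[of ?c N] by simp
qed

lemma ev_power:
  assumes "u \<in> J 1" shows "eqv N (ev N (f ^ k) u) (ev N f u ^ k)"
proof (cases "N = 0")
  case False
  then show ?thesis
  proof (induction k)
    case (Suc k)
    have "eqv N (ev N (f * f ^ k) u) (ev N f u * ev N (f ^ k) u)"
      by (rule ev_mult[OF assms])
    also have "eqv N \<dots> (ev N f u * ev N f u ^ k)"
      by (rule eqv_mult[OF eqv_refl Suc.IH[OF False]])
    finally show ?case by simp
  qed (simp add: ev_1)
qed simp

lemma ev_compose: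
  assumes u: "u \<in> J 1" and g: "g $ 0 = 0"
  shows "eqv N (ev N (f oo g) u) (ev N f (ev N g u))"
proof -
  have "ev N (f oo g) u = (\<Sum>n<N. \<Sum>i<N. s (f $ i) (s ((g ^ i) $ n) (u ^ n)))"
    unfolding ev_def
  proof (intro sum.cong refl)
    fix n assume n: "n \<in> {..<N}"
    \<comment> \<open>As \<open>g\<close> has no constant term, the n-th coefficient of
      \<open>g ^ i\<close> vanishes for i > n; the range of i can thus be extended to the same bound
      \<open>N\<close> for all n.\<close>
    have "(f oo g) $ n = (\<Sum>i<N. f $ i * (g ^ i) $ n)"
      unfolding fps_compose_nth
      by (rule sum.mono_neutral_left) (use n g startsby_zero_power_prefix[of g] in auto)
    then show "s ((f oo g) $ n) (u ^ n) = (\<Sum>i<N. s (f $ i) (s ((g ^ i) $ n) (u ^ n)))"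
      by (simp add: scale_sum_left)
  qed
  also have "\<dots> = (\<Sum>i<N. s (f $ i) (ev N (g ^ i) u))"
    unfolding ev_def scale_sum_right by (rule sum.swap)
  also have "eqv N \<dots> (\<Sum>i<N. s (f $ i) (ev N g u ^ i))"
    by (intro eqv_sum eqv_scale ev_power u)
  finally show ?thesis by (simp add: ev_def)
qed

lemma ev_J: "u \<in> J 1 \<Longrightarrow> f $ 0 = 0 \<Longrightarrow> ev N f u \<in> J 1"
  unfolding ev_def by (rule J_sum) (metis J_scale J_zero One_nat_def Suc_leI J_mono neq0_conv power_J scale_zero_left)

lemma ev_X: "u \<in> J 1 \<Longrightarrow> eqv N (ev N fps_X u) u"
proof (cases "N \<le> 1")
  case True
  moreover assume "u \<in> J 1"
  ultimately show ?thesis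
    using J_diff[OF ev_J[of u fps_X N], of u] J_mono[OF True] by (simp add: eqv_def)
next
  case False
  have "ev N fps_X u = (\<Sum>k<N. if k = 1 then u else 0)"
    unfolding ev_def by (intro sum.cong) (auto simp: fps_X_nth)
  then show ?thesis using False by simp
qed

section \<open>Truncated exponential and logarithm\<close>

definition ep :: "'a \<Rightarrow> nat \<Rightarrow> 'a" where "ep z k = s (1 / fact k) (z ^ k)"

lemma ep_0 [simp]: "ep z 0 = 1"
  by (simp add: ep_def)

lemma ep_Suc: "s (of_nat (Suc k)) (ep z (Suc k)) = z * ep z k"
  and ep_Suc': "s (of_nat (Suc k)) (ep z (Suc k)) = ep z k * z"
  unfolding ep_def
  by (simp_all add: s_mult_right s_mult_left power_commutes divide_simps del: of_nat_Suc)

lemma ep_J: "z \<in> J 1 \<Longrightarrow> ep z k \<in> J k"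
  unfolding ep_def by (intro J_scale power_J)

definition ex :: "nat \<Rightarrow> 'a \<Rightarrow> 'a" where "ex N u = (\<Sum>k<N. ep u k)"
text \<open>The series \<open>fps_ln 1\<close> is log(1 + X), hence the shift by 1.\<close>

definition lg :: "nat \<Rightarrow> 'a \<Rightarrow> 'a" where "lg N v = ev N (fps_ln 1) (v - 1)"

lemma ex_ev: "ex N u = ev N (fps_exp 1) u"
  by (simp add: ex_def ev_def ep_def)

lemma ex_cong: "eqv n u v \<Longrightarrow> eqv n (ex N u) (ex N v)"
  unfolding ex_ev by (rule ev_cong)

lemma lg_cong: "eqv n u v \<Longrightarrow> eqv n (lg N u) (lg N v)"
  unfolding lg_def by (intro ev_cong eqv_diff) auto

lemma ex_truncate: "u \<in> J 1 \<Longrightarrow> N \<le> M \<Longrightarrow> eqv N (ex M u) (ex N u)"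
  unfolding ex_ev by (rule ev_truncate)

lemma lg_truncate: "u - 1 \<in> J 1 \<Longrightarrow> N \<le> M \<Longrightarrow> eqv N (lg M u) (lg N u)"
  unfolding lg_def by (rule ev_truncate)

lemma ev_exp_minus_1: "N > 0 \<Longrightarrow> ev N (fps_exp 1 - 1) u = ex N u - 1"
  by (simp add: ev_diff ev_1 ex_ev)

lemma ex_J: "u \<in> J 1 \<Longrightarrow> N > 0 \<Longrightarrow> ex N u - 1 \<in> J 1"
  using ev_J[of u "fps_exp 1 - 1" N] by (simp add: ev_exp_minus_1)

lemma lg_J: "v - 1 \<in> J 1 \<Longrightarrow> lg N v \<in> J 1"
  unfolding lg_def by (rule ev_J) simp_all

text \<open>Both exp(X) - 1 and log(1 + X) have zero constant term and are inverse to each other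
  under composition; \<open>ev_compose\<close> carries this over.\<close>

lemma ex_lg:
  assumes "v - 1 \<in> J 1" shows "eqv N (ex N (lg N v)) v"
proof (cases "N = 0")
  case False
  have "eqv N (ev N ((fps_exp 1 - 1) oo fps_ln 1) (v - 1)) (ev N (fps_exp 1 - 1) (lg N v))"
    unfolding lg_def by (rule ev_compose[OF assms]) simp
  then have "eqv N (ev N fps_X (v - 1)) (ex N (lg N v) - 1)"
    using False by (simp add: fps_ln_fps_exp_inv fps_inv_fps_exp_compose ev_exp_minus_1)
  from eqv_trans[OF eqv_sym[OF this] ev_X[OF assms]] show ?thesis
    by (simp add: eqv_def)
qed simp

lemma lg_ex:
  assumes "u \<in> J 1" shows "eqv N (lg N (ex N u)) u"
proof (cases "N = 0")
  case False
  have "eqv N (ev N (fps_ln 1 oo (fps_exp 1 - 1)) u) (ev N (fps_ln 1) (ev N (fps_exp 1 - 1) u))"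
    by (rule ev_compose[OF assms]) simp
  then have "eqv N (ev N fps_X u) (lg N (ex N u))"
    using False by (simp add: fps_ln_fps_exp_inv fps_inv_fps_exp_compose ev_exp_minus_1 lg_def)
  from eqv_trans[OF eqv_sym[OF this] ev_X[OF assms]] show ?thesis .
qed simp

lemma ex_inj: "u \<in> J 1 \<Longrightarrow> v \<in> J 1 \<Longrightarrow> eqv N (ex N u) (ex N v) \<Longrightarrow> eqv N u v"
  using lg_cong lg_ex eqv_sym eqv_trans by meson

text \<open>The operators of left multiplication by $a$ and right multiplication by $-b$ commute, so the
  exponential of their sum splits.\<close>

lemma two_sided_power:
  "s (1 / fact k) (((\<lambda>h. a * h - h * b) ^^ k) h) = (\<Sum>i\<le>k. ep a i * h * ep (- b) (k - i))"
proof (induction k)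
  case (Suc k)
  let ?T = "\<lambda>h. a * h - h * b"
  let ?S = "\<lambda>k. \<Sum>i\<le>k. ep a i * h * ep (- b) (k - i)"
  have "s (of_nat (Suc k)) (?S (Suc k)) =
      (\<Sum>i\<le>k. s (of_nat (Suc i)) (ep a (Suc i)) * h * ep (- b) (k - i)) +
      (\<Sum>i\<le>k. ep a i * h * s (of_nat (Suc (k - i))) (ep (- b) (Suc (k - i))))"
    using scale_conv_Suc[of k "\<lambda>i j. ep a i * h * ep (- b) j"] by (simp only: s_mult_left s_mult_right)
  also have "\<dots> = a * ?S k - ?S k * b"
    unfolding ep_Suc[of _ a] ep_Suc'[of _ "- b"] sum_distrib_left sum_distrib_right sum_subtractf[symmetric]
      sum.distrib[symmetric]
    by (simp add: algebra_simps)
  also have "\<dots> = s (1 / fact k) (?T ((?T ^^ k) h))"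
    unfolding Suc.IH[symmetric] by (simp add: s_mult_left s_mult_right scale_right_diff_distrib)
  also have "\<dots> = s (of_nat (Suc k)) (s (1 / fact (Suc k)) ((?T ^^ Suc k) h))"
    by (simp add: divide_simps del: of_nat_Suc)
  finally show ?case
    by (rule cancel_Suc[OF sym])
qed simp

lemma ex_two_sided:
  assumes "a \<in> J 1" "b \<in> J 1"
  shows "eqv N (\<Sum>k<N. s (1 / fact k) (((\<lambda>h. a * h - h * b) ^^ k) h)) (ex N a * h * ex N (- b))"
proof -
  let ?c = "\<lambda>i j. ep a i * h * ep (- b) j"
  have "ex N a * h * ex N (- b) = (\<Sum>i<N. \<Sum>j<N. ?c i j)"
    unfolding ex_def sum_distrib_left sum_distrib_right by (rule sum.swap)
  moreover have "?c i j \<in> J (i + j)" for i j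
    using assms by (intro J_mult J_mult_right ep_J J_uminus)
  ultimately show ?thesis
    using eqv_triangle[of ?c N] by (simp add: two_sided_power)
qed

text \<open>This is the two-sided formula with \<open>b = a\<close> and \<open>h = 1\<close>: the
  commutator of \<open>a\<close> with 1 is zero, so only the term k = 0 survives.\<close>

lemma ex_inverse:
  assumes "a \<in> J 1" shows "eqv N (ex N a * ex N (- a)) 1"
proof (cases N)
  case (Suc n)
  let ?T = "\<lambda>h. a * h - h * a"
  have T: "(?T ^^ Suc k) 1 = 0" for k
    by (induction k) auto
  have "(\<Sum>k<N. s (1 / fact k) ((?T ^^ k) 1)) = 1"
    unfolding Suc sum.lessThan_Suc_shift T by simp
  with ex_two_sided[OF assms assms, of N 1] show ?thesis
    by (simp add: eqv_sym)
qed simp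

lemma ex_inverse':
  assumes "a \<in> J 1" shows "eqv N (ex N (- a) * ex N a) 1"
  using ex_inverse[OF J_uminus[OF assms]] by simp

text \<open>In powers of degree at least 2, every term that contains \<open>d\<close> has another
  factor from \<open>J 1\<close>, so only the linear term of the exponential sees \<open>d\<close>
  modulo \<open>J (Suc k)\<close>. The bound on \<open>N\<close> ensures that the linear term is
  present.\<close>

lemma ex_perturb:
  assumes u: "u \<in> J 1" and d: "d \<in> J k" and k: "k \<ge> 1" and N: "N \<ge> 2"
  shows "eqv (Suc k) (ex N (u + d)) (ex N u + d)"
proof -
  have "eqv (Suc k) ((u + d) ^ Suc (Suc n)) (u ^ Suc (Suc n))" for n
  proof (induction n)
    case 0
    have "(u + d) ^ Suc (Suc 0) - u ^ Suc (Suc 0) = u * d + d * u + d * d"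
      by (simp add: algebra_simps)
    moreover have "u * d \<in> J (Suc k)" "d * u \<in> J (Suc k)"
      using J_mult[OF u d] J_mult[OF d u] by auto
    moreover have "d * d \<in> J (Suc k)"
      using J_mult[OF J_mono[OF k d] d] by simp
    ultimately show ?case unfolding eqv_def by (simp add: J_add)
  next
    case (Suc n)
    have "(u + d) ^ Suc (Suc (Suc n)) - u ^ Suc (Suc (Suc n)) =
       (u + d) * ((u + d) ^ Suc (Suc n) - u ^ Suc (Suc n)) + d * u ^ Suc (Suc n)"
      unfolding power_Suc[of _ "Suc (Suc n)"] by (simp add: algebra_simps del: power_Suc)
    moreover have "d * u ^ Suc (Suc n) \<in> J (Suc k)"
      using J_mult[OF d power_J[OF u, of "Suc (Suc n)"]] J_mono by (metis add_Suc_right le_add1 not_less_eq_eq)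
    ultimately show ?case using Suc unfolding eqv_def by (simp only: J_add J_mult_left)
  qed
  then have *: "eqv (Suc k) (\<Sum>n<M. ep (u + d) (Suc (Suc n))) (\<Sum>n<M. ep u (Suc (Suc n)))" for M
    unfolding ep_def by (intro eqv_sum eqv_scale)
  obtain M where M: "N = Suc (Suc M)"
    using N by (metis add_2_eq_Suc le_Suc_ex)
  have "ex N w = 1 + w + (\<Sum>n<M. ep w (Suc (Suc n)))" for w
    unfolding ex_def M by (simp add: sum.lessThan_Suc_shift ep_def del: sum.lessThan_Suc)
  then show ?thesis
    using eqv_add[OF eqv_refl *, of "1 + u + d" M] by (simp add: add_ac)
qed

text \<open>The derivative of the exponential: $e^{-z} D(e^z) = \frac{1 - e^{-\mathrm{ad} z}}{\mathrm{ad} z} (D z)$.\<close>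

definition dex :: "'a \<Rightarrow> 'a \<Rightarrow> nat \<Rightarrow> 'a" where
  "dex z w k = s (1 / fact (Suc k)) (((\<lambda>h. h * z - z * h) ^^ k) w)"

text \<open>Homogeneous part of degree m in z of e^z (e^{-z} w e^z) = w e^z, where conjugation is
  written as the exponential of -ad z.\<close>

lemma sum_ep_ad:
  "(\<Sum>k\<le>m. ep z (m - k) * s (1 / fact k) (((\<lambda>h. h * z - z * h) ^^ k) w)) = w * ep z m"
proof (induction m)
  case (Suc m)
  let ?T = "\<lambda>h. h * z - z * h"
  define A where "A k = s (1 / fact k) ((?T ^^ k) w)" for k
  have a: "s (of_nat (Suc k)) (A (Suc k)) = ?T (A k)" for k
    by (simp add: A_def s_mult_left s_mult_right scale_right_diff_distrib divide_simps del: of_nat_Suc)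
  have "s (of_nat (Suc m)) (\<Sum>k\<le>Suc m. ep z (Suc m - k) * A k) =
     (\<Sum>k\<le>m. ep z (m - k) * s (of_nat (Suc k)) (A (Suc k))) +
     (\<Sum>k\<le>m. s (of_nat (Suc (m - k))) (ep z (Suc (m - k))) * A k)"
    using scale_conv_Suc[of m "\<lambda>k j. ep z j * A k"] by (simp only: s_mult_left s_mult_right)
  also have "\<dots> = (\<Sum>k\<le>m. ep z (m - k) * A k) * z"
    unfolding ep_Suc' a sum_distrib_right sum.distrib[symmetric]
    by (intro sum.cong refl) (simp add: algebra_simps)
  also have "\<dots> = s (of_nat (Suc m)) (w * ep z (Suc m))"
    unfolding Suc.IH[folded A_def] by (simp add: ep_Suc' mult.assoc flip: s_mult_right del: of_nat_Suc)
  finally show ?case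
    unfolding A_def by (rule cancel_Suc)
qed simp

lemma derivation_power:
  assumes D: "\<And>a b. D (a * b) = D a * b + a * D b" and sD: "\<And>c a. D (s c a) = s c (D a)"
  shows "D (ep z (Suc m)) = (\<Sum>k\<le>m. ep z (m - k) * dex z (D z) k)"
proof (induction m)
  case 0 then show ?case by (simp add: ep_def dex_def sD)
next
  case (Suc m)
  let ?T = "\<lambda>h. h * z - z * h"
  have d: "s (of_nat (Suc k)) (dex z w k) = s (1 / fact k) ((?T ^^ k) w)" for k w
    unfolding dex_def by (simp add: divide_simps del: of_nat_Suc)
  \<comment> \<open>One of the \<open>Suc (Suc m)\<close> copies is set aside. Added back later, it
    raises the factor of \<open>dex z (D z) (Suc k)\<close> from \<open>Suc k\<close> to
    \<open>Suc (Suc k)\<close>, which cancels one step of the factorial, so that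
    \<open>sum_ep_ad\<close> evaluates the sum.\<close>
  have "s (of_nat (Suc (Suc m))) (\<Sum>k\<le>Suc m. ep z (Suc m - k) * dex z (D z) k) =
      s (of_nat (Suc m)) (\<Sum>k\<le>Suc m. ep z (Suc m - k) * dex z (D z) k) +
      (\<Sum>k\<le>Suc m. ep z (Suc m - k) * dex z (D z) k)"
    by (simp only: of_nat_Suc[of "Suc m"] scale_left_distrib scale_one add.commute)
  also have "s (of_nat (Suc m)) (\<Sum>k\<le>Suc m. ep z (Suc m - k) * dex z (D z) k) =
      (\<Sum>k\<le>m. ep z (m - k) * s (of_nat (Suc k)) (dex z (D z) (Suc k))) +
      (\<Sum>k\<le>m. s (of_nat (Suc (m - k))) (ep z (Suc (m - k))) * dex z (D z) k)"
    using scale_conv_Suc[of m "\<lambda>k j. ep z j * dex z (D z) k"] by (simp only: s_mult_left s_mult_right)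
  also have "(\<Sum>k\<le>m. s (of_nat (Suc (m - k))) (ep z (Suc (m - k))) * dex z (D z) k) = z * D (ep z (Suc m))"
    unfolding Suc.IH ep_Suc sum_distrib_left by (simp add: mult.assoc)
  also have "(\<Sum>k\<le>Suc m. ep z (Suc m - k) * dex z (D z) k) =
      (\<Sum>k\<le>m. ep z (m - k) * dex z (D z) (Suc k)) + ep z (Suc m) * dex z (D z) 0"
    by (subst sum.atMost_Suc_shift) simp
  also have "(\<Sum>k\<le>m. ep z (m - k) * s (of_nat (Suc k)) (dex z (D z) (Suc k))) + z * D (ep z (Suc m)) +
     ((\<Sum>k\<le>m. ep z (m - k) * dex z (D z) (Suc k)) + ep z (Suc m) * dex z (D z) 0) =
     z * D (ep z (Suc m)) + ((\<Sum>k\<le>m. ep z (m - k) * s (of_nat (Suc (Suc k))) (dex z (D z) (Suc k))) +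
       ep z (Suc m) * dex z (D z) 0)"
    unfolding of_nat_Suc[of "Suc _"] scale_left_distrib
    by (simp add: distrib_left sum.distrib add_ac del: of_nat_Suc)
  also have "(\<Sum>k\<le>m. ep z (m - k) * s (of_nat (Suc (Suc k))) (dex z (D z) (Suc k))) +
       ep z (Suc m) * dex z (D z) 0 = D z * ep z (Suc m)"
    unfolding sum_ep_ad[of z "Suc m" "D z", symmetric] sum.atMost_Suc_shift d
    by (simp add: dex_def)
  also have "z * D (ep z (Suc m)) + D z * ep z (Suc m) = D (z * ep z (Suc m))"
    by (simp add: D)
  also have "\<dots> = s (of_nat (Suc (Suc m))) (D (ep z (Suc (Suc m))))"
    by (simp only: ep_Suc[symmetric] sD)
  finally have "(\<Sum>k\<le>m. ep z (m - k) * dex z (D z) (Suc k)) + ep z (Suc m) * dex z (D z) 0 =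
      D (ep z (Suc (Suc m)))"
    by (rule cancel_Suc)
  then show ?case by (subst sum.atMost_Suc_shift) (simp add: add.commute)
qed

lemma dex_J: "z \<in> J 1 \<Longrightarrow> dex z w k \<in> J k"
proof -
  assume z: "z \<in> J 1"
  have "((\<lambda>h. h * z - z * h) ^^ k) w \<in> J k"
  proof (induction k)
    case (Suc k)
    then show ?case using J_mult[OF Suc z] J_mult[OF z Suc] by (simp add: J_diff)
  qed (simp add: J_0)
  then show ?thesis unfolding dex_def by (rule J_scale)
qed

text \<open>The constant term has derivative zero, which is why \<open>N\<close> terms on the right
  match \<open>Suc N\<close> terms on the left. Term by term the identity is exact; the congruence
  comes from completing the triangle to a square.\<close>

lemma derivation_ex:
  assumes D: "\<And>a b. D (a * b) = D a * b + a * D b" and sD: "\<And>c a. D (s c a) = s c (D a)"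
    and aD: "\<And>a b. D (a + b) = D a + D b" and z: "z \<in> J 1"
  shows "eqv N (D (ex (Suc N) z)) (ex N z * (\<Sum>k<N. dex z (D z) k))"
proof -
  let ?c = "\<lambda>k j. ep z j * dex z (D z) k"
  have D0: "D 0 = 0" using aD[of 0 0] by simp
  have D1: "D 1 = 0" using D[of 1 1] by simp
  have Dsum: "D (sum f S) = (\<Sum>i\<in>S. D (f i))" for f :: "nat \<Rightarrow> 'a" and S
    by (induction S rule: infinite_finite_induct) (auto simp: D0 aD)
  have "D (ex (Suc N) z) = (\<Sum>k<N. D (ep z (Suc k)))"
    unfolding ex_def sum.lessThan_Suc_shift by (simp add: aD D1 Dsum)
  also have "\<dots> = (\<Sum>m<N. \<Sum>k\<le>m. ?c k (m - k))"
    by (simp only: derivation_power[of D, OF D sD])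
  also have "eqv N \<dots> (\<Sum>i<N. \<Sum>j<N. ?c i j)"
    by (rule eqv_triangle) (metis J_mult add.commute dex_J ep_J z)
  also have "(\<Sum>i<N. \<Sum>j<N. ?c i j) = ex N z * (\<Sum>k<N. dex z (D z) k)"
    unfolding ex_def sum_product by (rule sum.swap)
  finally show ?thesis .
qed

end

text \<open>The rules of the inductive sets in \<open>Defs\<close> are stated with eta-expanded sums of functions, which
  the simplifier would otherwise rewrite pointwise.\<close>

declare plus_fun_apply [simp del] zero_fun_apply [simp del] minus_apply [simp del]

subsection \<open>The enveloping ideal and its filtration\<close>

locale lie_alg = vector_space scale
  for scale :: "'k::field_char_0 \<Rightarrow> 'g::ab_group_add \<Rightarrow> 'g" +
  fixes br :: "'g \<Rightarrow> 'g \<Rightarrow> 'g"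
  assumes br_add_left: "br (x + y) z = br x z + br y z"
    and br_add_right: "br x (y + z) = br x y + br x z"
    and br_scale_left: "br (scale c x) y = scale c (br x y)"
    and br_scale_right: "br x (scale c y) = scale c (br x y)"
    and br_self: "br x x = 0"
    and jacobi: "br x (br y z) + br y (br z x) + br z (br x y) = 0"
begin

lemma br_anti: "br y x = - br x y"
proof -
  have "br x x + br x y + (br y x + br y y) = 0"
    using br_self[of "x + y"] unfolding br_add_left br_add_right by (simp add: add_ac)
  then have "br x y + br y x = 0" by (simp add: br_self)
  then show ?thesis by (simp add: eq_neg_iff_add_eq_0 add.commute)
qed

lemma br_zero_left [simp]: "br 0 y = 0" and br_zero_right [simp]: "br y 0 = 0"
  using br_add_left[of 0 0 y] br_add_right[of y 0 0] by simp_all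

lemma br_minus_left: "br (- x) y = - br x y" and br_minus_right: "br x (- y) = - br x y"
  using br_add_left[of x "- x" y] br_add_right[of x y "- y"]
  by (simp_all add: eq_neg_iff_add_eq_0 add.commute)

lemma br_diff_left: "br (x - z) y = br x y - br z y" and br_diff_right: "br x (y - z) = br x y - br x z"
  using br_add_left[of x "- z" y] br_add_right[of x y "- z"] by (simp_all add: br_minus_left br_minus_right)

lemma br_leibniz: "br a (br x y) = br (br a x) y + br x (br a y)"
proof -
  have "br a (br x y) + br x (br y a) + br y (br a x) = 0" by (rule jacobi)
  moreover have "br x (br y a) = - br x (br a y)" by (metis br_anti br_minus_right)
  moreover have "br y (br a x) = - br (br a x) y" by (rule br_anti)
  ultimately show ?thesis by (simp add: algebra_simps)
qed

lemma br_sum_left: "br (sum f S) y = (\<Sum>i\<in>S. br (f i) y)"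
  by (induction S rule: infinite_finite_induct) (auto simp: br_add_left)
lemma br_sum_right: "br y (sum f S) = (\<Sum>i\<in>S. br y (f i))"
  by (induction S rule: infinite_finite_induct) (auto simp: br_add_right)

definition lin_rel :: "('g,'k) falg set" where
  "lin_rel = {gen (x + y) - gen x - gen y |x y. True} \<union> {gen (scale c x) - sc c (gen x) |c x. True}"

definition env_rel :: "('g,'k) falg set" where
  "env_rel = lin_rel \<union> {gen x * gen y - gen y * gen x - gen (br x y) |x y. True}"

text \<open>A linear spanning set of the ideal with explicit words on both sides of the relation.
  The lengths of these words are the induction measure for the operator \<open>RR\<close>.\<close>

definition env_gens :: "('g,'k) falg set" where
  "env_gens = {W u * r * W v |u r v. r \<in> env_rel}"

definition I :: "('g,'k) falg set" where "I = A.span env_gens"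

lemma lin_rel_add: "gen (x + y) - gen x - gen y \<in> lin_rel"
  and lin_rel_scale: "gen (scale c x) - sc c (gen x) \<in> lin_rel"
  and env_rel_br: "gen x * gen y - gen y * gen x - gen (br x y) \<in> env_rel"
  and lin_env_rel: "r \<in> lin_rel \<Longrightarrow> r \<in> env_rel"
  by (auto simp: lin_rel_def env_rel_def)

lemmas I_add = A.span_add[of _ env_gens, folded I_def]
  and I_diff = A.span_diff[of _ env_gens, folded I_def]
  and I_zero [simp] = A.span_zero[of env_gens, folded I_def]
  and I_scale = A.span_scale[of _ env_gens, folded I_def]

lemma I_mult_left: "a \<in> I \<Longrightarrow> b * a \<in> I"
  unfolding I_def
proof (rule span_mult[OF span_words])
  fix x y :: "('g,'k) falg" assume "x \<in> range W" "y \<in> env_gens"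
  then obtain w u r v where "x = W w" "y = W u * r * W v" "r \<in> env_rel"
    unfolding env_gens_def by auto
  then have "x * y = W (w @ u) * r * W v" "r \<in> env_rel" by (simp_all add: W_append mult.assoc)
  then show "x * y \<in> A.span env_gens"
    unfolding env_gens_def by (intro A.span_base) blast
qed

lemma I_mult_right: "a \<in> I \<Longrightarrow> a * b \<in> I"
  unfolding I_def
proof (rule span_mult[OF _ span_words])
  fix x y :: "('g,'k) falg" assume "y \<in> range W" "x \<in> env_gens"
  then obtain w u r v where "y = W w" "x = W u * r * W v" "r \<in> env_rel"
    unfolding env_gens_def by auto
  then have "x * y = W u * r * W (v @ w)" "r \<in> env_rel" by (simp_all add: W_append mult.assoc)
  then show "x * y \<in> A.span env_gens"
    unfolding env_gens_def by (intro A.span_base) blast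
qed

lemma env_rel_I: "r \<in> env_rel \<Longrightarrow> r \<in> I"
proof -
  assume "r \<in> env_rel"
  then have "W [] * r * W [] \<in> env_gens" unfolding env_gens_def by blast
  then show ?thesis unfolding I_def by (simp add: W_Nil A.span_base)
qed

lemma I_gen_add: "gen (x + y) - gen x - gen y \<in> I"
  and I_gen_scale: "gen (scale c x) - sc c (gen x) \<in> I"
  and I_gen_br: "gen x * gen y - gen y * gen x - gen (br x y) \<in> I"
  by (auto intro: env_rel_I lin_env_rel lin_rel_add lin_rel_scale env_rel_br)

lemma fa_ideal_subset: "f \<in> fa_ideal scale br \<Longrightarrow> f \<in> fa"
  by (induction rule: fa_ideal.induct)
     (auto simp: fa_gen_def intro!: fa_diff fa_add fa_mult_mem fa_smult_mem fa_word_mem fa_zero)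

lemma Rep_gen: "Rep_falg (gen x) = fa_gen x"
  by (simp add: fa_gen_def gen_def W.rep_eq)

lemmas Rep_simps = plus_falg.rep_eq minus_falg.rep_eq uminus_falg.rep_eq times_falg.rep_eq
  zero_falg.rep_eq one_falg.rep_eq sc.rep_eq Rep_gen

lemma fa_ideal_I: "f \<in> fa_ideal scale br \<Longrightarrow> Abs_falg f \<in> I"
proof (induction rule: fa_ideal.induct)
  case (gen_add x y)
  then show ?case using I_gen_add[of x y] by (simp flip: Rep_simps add: Rep_falg_inverse)
next
  case (gen_scale c x)
  then show ?case using I_gen_scale[of c x] by (simp flip: Rep_simps add: Rep_falg_inverse)
next
  case (gen_br x y)
  then show ?case using I_gen_br[of x y] by (simp flip: Rep_simps add: Rep_falg_inverse)
next
  case zero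
  then show ?case by (simp flip: Rep_simps add: Rep_falg_inverse)
next
  case (add f h)
  then have "Abs_falg (f + h) = Abs_falg f + Abs_falg h"
    using fa_ideal_subset by (simp add: plus_falg.abs_eq eq_onp_same_args)
  then show ?case using add by (simp add: I_add)
next
  case (smult f c)
  then have "Abs_falg (fa_smult c f) = sc c (Abs_falg f)"
    using fa_ideal_subset by (simp add: sc.abs_eq eq_onp_same_args)
  then show ?case using smult by (simp add: I_scale)
next
  case (lmult a f)
  then have "Abs_falg (fa_mult a f) = Abs_falg a * Abs_falg f"
    using fa_ideal_subset by (simp add: times_falg.abs_eq eq_onp_same_args)
  then show ?case using lmult by (simp add: I_mult_left)
next
  case (rmult a f)
  then have "Abs_falg (fa_mult f a) = Abs_falg f * Abs_falg a"
    using fa_ideal_subset by (simp add: times_falg.abs_eq eq_onp_same_args)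
  then show ?case using rmult by (simp add: I_mult_right)
qed

lemma I_fa_ideal: "a \<in> I \<Longrightarrow> Rep_falg a \<in> fa_ideal scale br"
  unfolding I_def
proof (induction rule: A.span_induct_alt)
  case base then show ?case by (simp add: Rep_simps fa_ideal.zero)
next
  case (step c x y)
  obtain u r v where x: "x = W u * r * W v" and r: "r \<in> env_rel"
    using step(1) unfolding env_gens_def by auto
  have "Rep_falg r \<in> fa_ideal scale br"
    using r unfolding env_rel_def lin_rel_def by (auto simp: Rep_simps intro: fa_ideal.intros)
  then show ?case
    using step(2) by (simp add: x Rep_simps fa_ideal.add fa_ideal.smult fa_ideal.lmult fa_ideal.rmult Rep_falg)
qed

lemma fa_ideal_iff: "Rep_falg a \<in> fa_ideal scale br \<longleftrightarrow> a \<in> I"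
  using fa_ideal_I[of "Rep_falg a"] I_fa_ideal by (auto simp: Rep_falg_inverse)

definition derW :: "'g \<Rightarrow> 'g list \<Rightarrow> ('g,'k) falg" where
  "derW a w = (\<Sum>i<length w. W (w[i := br a (w ! i)]))"

text \<open>The derivation of the free algebra that extends ad a on letters; \<open>derW\<close> is
  the sum occurring in the recursion for \<open>rb_word\<close>. Only modulo \<open>I\<close> is it
  the commutator with \<open>gen a\<close>.\<close>

definition der :: "'g \<Rightarrow> ('g,'k) falg \<Rightarrow> ('g,'k) falg" where
  "der a = lext sc (derW a)"

lemma der_W: "der a (W w) = derW a w"
  by (simp add: der_def A.lext_W)

lemma der_zero [simp]: "der a 0 = 0"
  and der_add: "der a (x + y) = der a x + der a y"
  and der_diff: "der a (x - y) = der a x - der a y"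
  and der_sc: "der a (sc c x) = sc c (der a x)"
  by (simp_all add: der_def A.lext_add A.lext_diff A.lext_sc)

lemma derW_Nil: "derW a [] = 0"
  by (simp add: derW_def)

lemma derW_Cons: "derW a (x # w) = gen (br a x) * W w + gen x * derW a w"
  unfolding derW_def
  by (simp add: sum.lessThan_Suc_shift W_Cons sum_distrib_left del: sum.lessThan_Suc)

lemma der_one [simp]: "der a 1 = 0"
  by (simp add: der_W derW_Nil flip: W_Nil)

lemma der_gen: "der a (gen x) = gen (br a x)"
  by (simp add: gen_def der_W derW_def)

lemma derW_append: "derW a (u @ v) = derW a u * W v + W u * derW a v"
proof (induction u)
  case (Cons x u)
  then show ?case by (simp add: derW_Cons W_Cons W_append algebra_simps)
qed (simp add: derW_Nil W_Nil)

lemma der_mult: "der a (x * y) = der a x * y + x * der a y"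
proof (induction x rule: falg_induct)
  case (word c u)
  show ?case
  proof (induction y rule: falg_induct)
    case (word d v)
    show ?case
      by (simp add: sc_mult_left sc_mult_right der_sc der_W derW_append A.scale_right_distrib
          A.scale_left_commute[of d c] flip: W_append)
  qed (auto simp: der_add algebra_simps)
qed (auto simp: der_add algebra_simps)

lemma der_lin_rel: "r \<in> lin_rel \<Longrightarrow> der a r \<in> lin_rel"
  unfolding lin_rel_def
  by (auto simp: der_diff der_gen der_sc br_add_right br_scale_right; blast)

text \<open>The Leibniz rule for the bracket splits \<open>br a (br x y)\<close> into a sum, and
  \<open>gen\<close> of a sum costs an additivity relation. Therefore the result lies in the span of
  \<open>env_rel\<close> and need not be a single relation.\<close>

lemma der_env_rel: "r \<in> env_rel \<Longrightarrow> der a r \<in> A.span env_rel"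
proof -
  assume "r \<in> env_rel"
  then consider "r \<in> lin_rel" | x y where "r = gen x * gen y - gen y * gen x - gen (br x y)"
    unfolding env_rel_def by auto
  then show ?thesis
  proof cases
    case 1
    then show ?thesis using der_lin_rel lin_env_rel A.span_base by blast
  next
    case 2
    have "der a r = (gen (br a x) * gen y - gen y * gen (br a x) - gen (br (br a x) y)) +
        (gen x * gen (br a y) - gen (br a y) * gen x - gen (br x (br a y))) -
        (gen (br (br a x) y + br x (br a y)) - gen (br (br a x) y) - gen (br x (br a y)))"
      unfolding 2 by (simp add: der_diff der_mult der_gen br_leibniz[of a x y])
    then show ?thesis
      by (simp only:) (intro A.span_add A.span_diff A.span_base env_rel_br lin_env_rel lin_rel_add)
  qed
qed

text \<open>Both maps are derivations, and on letters they differ by a bracket relation.\<close>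

lemma der_commutator: "der a x - (gen a * x - x * gen a) \<in> I"
proof (induction x rule: falg_induct)
  case (add x y)
  have "der a (x + y) - (gen a * (x + y) - (x + y) * gen a) =
      (der a x - (gen a * x - x * gen a)) + (der a y - (gen a * y - y * gen a))"
    by (simp add: der_add algebra_simps)
  then show ?case using add by (simp add: I_add)
next
  case (word c w)
  have "der a (W w) - (gen a * W w - W w * gen a) \<in> I"
  proof (induction w)
    case (Cons x w)
    have "der a (W (x # w)) - (gen a * W (x # w) - W (x # w) * gen a) =
        gen x * (der a (W w) - (gen a * W w - W w * gen a)) -
        (gen a * gen x - gen x * gen a - gen (br a x)) * W w"
      by (simp add: W_Cons der_mult der_gen algebra_simps)
    then show ?case using Cons I_gen_br by (simp add: I_diff I_mult_left I_mult_right)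
  qed (simp add: W_Nil)
  then have "sc c (der a (W w) - (gen a * W w - W w * gen a)) \<in> I"
    by (rule I_scale)
  then show ?case by (simp add: der_sc sc_mult_left sc_mult_right A.scale_right_diff_distrib)
qed simp

end

section \<open>The filtration of the enveloping algebra\<close>

locale filtered_lie_alg = lie_alg scale br
  for scale :: "'k::field_char_0 \<Rightarrow> 'g::ab_group_add \<Rightarrow> 'g" and br +
  fixes F :: "nat \<Rightarrow> 'g set"
  assumes F_subspace: "n \<ge> 1 \<Longrightarrow> subspace (F n)"
    and F_1: "F 1 = UNIV"
    and F_Suc: "n \<ge> 1 \<Longrightarrow> F (Suc n) \<subseteq> F n"
    and F_br: "m \<ge> 1 \<Longrightarrow> n \<ge> 1 \<Longrightarrow> x \<in> F m \<Longrightarrow> y \<in> F n \<Longrightarrow> br x y \<in> F (m + n)"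
begin

lemma F_mono: "1 \<le> m \<Longrightarrow> m \<le> n \<Longrightarrow> x \<in> F n \<Longrightarrow> x \<in> F m"
proof (induction n)
  case (Suc n) then show ?case using F_Suc[of n] by (cases "m = Suc n") auto
qed simp

definition weights :: "'g list \<Rightarrow> nat list \<Rightarrow> bool" where
  "weights xs ns \<longleftrightarrow> list_all2 (\<lambda>x n. 1 \<le> n \<and> x \<in> F n) xs ns"

text \<open>The empty word belongs to \<open>WW 0\<close> and to no other \<open>WW n\<close>. This
  gives \<open>J 0 = UNIV\<close> and agrees with the nonempty words of \<open>fa_filt\<close> for n
  at least 1.\<close>

definition WW :: "nat \<Rightarrow> ('g,'k) falg set" where
  "WW n = {W xs |xs ns. weights xs ns \<and> n \<le> sum_list ns}"

definition J :: "nat \<Rightarrow> ('g,'k) falg set" where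
  "J n = A.span (WW n \<union> env_gens)"

lemma WW_J: "weights xs ns \<Longrightarrow> n \<le> sum_list ns \<Longrightarrow> W xs \<in> J n"
  unfolding J_def WW_def by (rule A.span_base) blast

lemma I_J: "a \<in> I \<Longrightarrow> a \<in> J n"
  unfolding J_def I_def using A.span_mono by blast

lemma gen_J: "n \<ge> 1 \<Longrightarrow> x \<in> F n \<Longrightarrow> gen x \<in> J n"
  unfolding gen_def by (rule WW_J[of "[x]" "[n]"]) (auto simp: weights_def)

lemma gen_J1: "gen x \<in> J 1"
  by (rule gen_J) (simp_all add: F_1[unfolded One_nat_def])

lemma weights_ones: "weights xs (replicate (length xs) 1)"
  unfolding weights_def by (simp add: list_all2_conv_all_nth F_1[unfolded One_nat_def])

lemma W_J: "n \<le> length xs \<Longrightarrow> W xs \<in> J n"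
  by (rule WW_J[OF weights_ones]) (simp add: sum_list_replicate)

lemma weights_append: "weights xs ms \<Longrightarrow> weights ys ns \<Longrightarrow> weights (xs @ ys) (ms @ ns)"
  unfolding weights_def by (rule list_all2_appendI)

lemma J_mult_aux:
  assumes "a \<in> J m" "b \<in> J n" shows "a * b \<in> J (m + n)"
  unfolding J_def
proof (rule span_mult[OF assms[unfolded J_def]])
  fix x y assume "x \<in> WW m \<union> env_gens" "y \<in> WW n \<union> env_gens"
  then consider "x \<in> I" | "y \<in> I" | "x \<in> WW m" "y \<in> WW n"
    unfolding I_def using A.span_base by blast
  then show "x * y \<in> A.span (WW (m + n) \<union> env_gens)"
    unfolding J_def[symmetric]
  proof cases
    case 3
    then obtain xs ms ys ns where *: "x = W xs" "y = W ys" "weights xs ms" "weights ys ns"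
       "m \<le> sum_list ms" "n \<le> sum_list ns"
      unfolding WW_def by auto
    then have "W (xs @ ys) \<in> J (m + n)"
      by (intro WW_J[OF weights_append]) auto
    then show "x * y \<in> J (m + n)" by (simp add: * W_append)
  qed (auto intro: I_J I_mult_left I_mult_right)
qed

sublocale A: filtered_algebra sc J
proof unfold_locales
  show "sc c a * b = sc c (a * b)" "a * sc c b = sc c (a * b)" for c and a b :: "('g,'k) falg"
    by (simp_all add: sc_mult_left sc_mult_right)
  have "range W \<subseteq> J 0"
    using W_J[of 0] by auto
  then have "A.span (range W) \<subseteq> J 0"
    unfolding J_def by (simp add: A.span_minimal)
  then show "J 0 = UNIV" using span_words by blast
  show "J (Suc n) \<subseteq> J n" for n
    unfolding J_def WW_def by (rule A.span_mono) (auto dest: Suc_leD)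
  show "A.subspace (J n)" for n
    unfolding J_def by simp
qed (rule J_mult_aux)

lemma fa_filt_span: "p \<in> fa_filt F n \<Longrightarrow> p \<in> fa \<and> Abs_falg p \<in> A.span (WW n)"
proof (induction rule: fa_filt.induct)
  case (word xs ns)
  then have "weights xs ns"
    by (simp add: weights_def list_all2_conv_all_nth)
  then have "W xs \<in> A.span (WW n)"
    using word(4) by (intro A.span_base) (auto simp: WW_def)
  then show ?case
    by (simp add: fa_word_mem W.abs_eq)
next
  case zero
  then show ?case by (simp add: fa_zero A.span_zero flip: zero_falg.abs_eq)
next
  case (add f h)
  then have "Abs_falg (f + h) = Abs_falg f + Abs_falg h"
    by (simp add: plus_falg.abs_eq eq_onp_same_args)
  then show ?case using add by (simp add: A.span_add fa_add)
next
  case (smult f c)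
  then have "Abs_falg (fa_smult c f) = sc c (Abs_falg f)"
    by (simp add: sc.abs_eq eq_onp_same_args)
  then show ?case using smult by (simp add: A.span_scale fa_smult_mem)
qed

lemma span_fa_filt:
  assumes "n \<ge> 1"
  shows "p \<in> A.span (WW n) \<Longrightarrow> Rep_falg p \<in> fa_filt F n"
proof (induction rule: A.span_induct_alt)
  case base then show ?case by (simp add: zero_falg.rep_eq fa_filt.zero)
next
  case (step c x y)
  obtain xs ns where x: "x = W xs" and ns: "weights xs ns" "n \<le> sum_list ns"
    using step(1) by (auto simp: WW_def)
  have "fa_word xs \<in> fa_filt F n"
    by (rule fa_filt.word[of xs ns])
       (use ns assms in \<open>auto simp: weights_def list_all2_conv_all_nth\<close>)
  then show ?case
    using step(2) by (auto simp: x Rep_simps W.rep_eq intro!: fa_filt.add fa_filt.smult)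
qed

lemma fa_J_iff: "Rep_falg a \<in> fa_J scale br F n \<longleftrightarrow> a \<in> J n"
proof (cases "n = 0")
  case True
  then show ?thesis by (simp add: fa_J_def Rep_falg A.J_0)
next
  case False
  show ?thesis
  proof
    assume "Rep_falg a \<in> fa_J scale br F n"
    then obtain p where p: "p \<in> fa_filt F n" "Rep_falg a - p \<in> fa_ideal scale br"
      using False by (auto simp: fa_J_def)
    note q = fa_filt_span[OF p(1)]
    then have "Rep_falg (a - Abs_falg p) \<in> fa_ideal scale br"
      using p(2) by (simp add: Rep_simps Abs_falg_inverse)
    then have "a - Abs_falg p \<in> J n"
      by (simp add: fa_ideal_iff I_J)
    moreover have "Abs_falg p \<in> J n"
      using q A.span_mono[of "WW n" "WW n \<union> env_gens"] unfolding J_def by blast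
    ultimately show "a \<in> J n"
      using A.J_add by fastforce
  next
    assume "a \<in> J n"
    then obtain p q where pq: "a = p + q" "p \<in> A.span (WW n)" "q \<in> I"
      unfolding J_def I_def A.span_Un by auto
    have "Rep_falg a - Rep_falg p = Rep_falg q"
      by (simp add: pq(1) plus_falg.rep_eq)
    then show "Rep_falg a \<in> fa_J scale br F n"
      using False pq I_fa_ideal[OF pq(3)] span_fa_filt[OF _ pq(2)] unfolding fa_J_def by (auto simp: Rep_falg intro!: bexI[of _ "Rep_falg p"])
  qed
qed

end

subsection \<open>The Rota-Baxter operator on the enveloping algebra\<close>

locale rb_lie_alg = filtered_lie_alg scale br F
  for scale :: "'k::field_char_0 \<Rightarrow> 'g::ab_group_add \<Rightarrow> 'g" and br F +
  fixes R :: "'g \<Rightarrow> 'g"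
  assumes R_add: "R (x + y) = R x + R y"
    and R_scale: "R (scale c x) = scale c (R x)"
    and R_br: "br (R x) (R y) = R (br (R x) y + br x (R y) + br x y)"
    and R_F: "n \<ge> 1 \<Longrightarrow> x \<in> F n \<Longrightarrow> R x \<in> F n"
begin

lemma rb_word_fa: "rb_word R br w \<in> (fa :: ('g list \<Rightarrow> 'k) set)"
proof (induction w rule: length_induct)
  case (1 w)
  show ?case
  proof (cases w)
    case Nil then show ?thesis by (simp add: fa_one_def fa_word_mem)
  next
    case (Cons x v)
    have "(\<Sum>i\<in>S. rb_word R br (v[i := br (R x) (v ! i)])) \<in> (fa :: ('g list \<Rightarrow> 'k) set)" for S
      using 1 Cons by (induction S rule: infinite_finite_induct) (auto simp: fa_zero intro!: fa_add)
    then show ?thesis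
      using 1 Cons by (auto simp: fa_gen_def intro!: fa_diff fa_mult_mem fa_word_mem)
  qed
qed

definition RW :: "'g list \<Rightarrow> ('g,'k) falg" where "RW w = Abs_falg (rb_word R br w)"
definition RR :: "('g,'k) falg \<Rightarrow> ('g,'k) falg" where "RR = lext sc RW"

lemma Rep_RW: "Rep_falg (RW w) = rb_word R br w"
  by (simp add: RW_def Abs_falg_inverse rb_word_fa)

lemma Rep_sum: "Rep_falg (sum f S) = (\<Sum>i\<in>S. Rep_falg (f i))"
  by (induction S rule: infinite_finite_induct) (auto simp: Rep_simps)

lemma Rep_RR: "Rep_falg (RR a) = rb_U R br (Rep_falg a)"
  by (simp add: RR_def lext_def rb_U_def Rep_sum sc.rep_eq Rep_RW cf.rep_eq)

lemma RR_W: "RR (W w) = RW w"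
  by (simp add: RR_def A.lext_W)

lemma RR_zero [simp]: "RR 0 = 0"
  and RR_add: "RR (x + y) = RR x + RR y"
  and RR_diff: "RR (x - y) = RR x - RR y"
  and RR_sc: "RR (sc c x) = sc c (RR x)"
  and RR_sum: "RR (sum f S) = (\<Sum>i\<in>S. RR (f i))"
  by (simp_all add: RR_def A.lext_add A.lext_diff A.lext_sc A.lext_sum)

lemma RR_one: "RR 1 = 1"
proof -
  have "Rep_falg (RW [] :: ('g,'k) falg) = Rep_falg 1"
    by (simp add: Rep_RW one_falg.rep_eq)
  then show ?thesis by (simp add: RR_W Rep_falg_inject flip: W_Nil)
qed

lemma RR_gen_mult: "RR (gen x * a) = gen (R x) * RR a - RR (der (R x) a)"
proof (induction a rule: falg_induct)
  case (word c w)
  have "Rep_falg (RW (x # w)) = Rep_falg (gen (R x) * RW w - RR (derW (R x) w))"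
    by (simp add: Rep_RW Rep_simps derW_def RR_sum RR_W Rep_sum)
  then have "RW (x # w) = gen (R x) * RW w - RR (derW (R x) w)"
    by (simp add: Rep_falg_inject)
  then show ?case
    by (simp add: sc_mult_right RR_sc RR_W der_sc der_W A.scale_right_diff_distrib flip: W_Cons)
qed (simp_all add: der_add distrib_left RR_add)

lemma RR_gen: "RR (gen x) = gen (R x)"
  using RR_gen_mult[of x 1] by (simp add: RR_one)

text \<open>The elements of the ideal supported on relations in short words; they make up the
  induction along which the operator is shown to descend to the enveloping algebra.\<close>

definition IL :: "nat \<Rightarrow> ('g,'k) falg set" where
  "IL n = A.span {W u * r * W v |u r v. r \<in> env_rel \<and> length u + length v < n}"

lemmas IL_add = A.span_add[of _ "{W u * r * W v |u r v. r \<in> env_rel \<and> length u + length v < n}" for n, folded IL_def]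
  and IL_diff = A.span_diff[of _ "{W u * r * W v |u r v. r \<in> env_rel \<and> length u + length v < n}" for n, folded IL_def]
  and IL_zero [simp] = A.span_zero[of "{W u * r * W v |u r v. r \<in> env_rel \<and> length u + length v < n}" for n, folded IL_def]
  and IL_scale = A.span_scale[of _ "{W u * r * W v |u r v. r \<in> env_rel \<and> length u + length v < n}" for n, folded IL_def]

lemma IL_base:
  assumes "r \<in> A.span env_rel" "length u + length v < n" shows "W u * r * W v \<in> IL n"
  using assms(1)
proof (induction rule: A.span_induct_alt)
  case (step c x y)
  have "W u * x * W v \<in> IL n"
    unfolding IL_def by (rule A.span_base) (use step(1) assms(2) in blast)
  then show ?case
    using step by (simp add: algebra_simps sc_mult_left sc_mult_right IL_add IL_scale)
qed simp

lemma IL_base_left: "r \<in> env_rel \<Longrightarrow> length v < n \<Longrightarrow> r * W v \<in> IL n"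
  using IL_base[of r "[]" v n] by (simp add: W_Nil A.span_base)

lemma IL_mult_gen:
  assumes "a \<in> IL n" shows "gen x * a \<in> IL (Suc n)"
  using assms unfolding IL_def
proof (induction rule: A.span_induct_alt)
  case base then show ?case by (simp add: A.span_zero)
next
  case (step c a b)
  then obtain u r v where *: "a = W u * r * W v" "r \<in> env_rel" "length u + length v < n" by auto
  then have "W (x # u) * r * W v \<in> IL (Suc n)"
    by (intro IL_base) (auto intro: A.span_base)
  then have "gen x * a \<in> IL (Suc n)" by (simp add: * W_Cons mult.assoc)
  then show ?case
    using step by (simp add: distrib_left sc_mult_right A.span_add A.span_scale IL_def)
qed

lemma derW_span: "derW a w \<in> A.span {W v |v. length v = length w}"
  unfolding derW_def by (intro A.span_sum A.span_base) auto

lemma span_IL_base: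
  assumes "x \<in> A.span {W u' |u'. length u' = length u}" "y \<in> A.span {W v' |v'. length v' = length v}"
    "r \<in> A.span env_rel" "length u + length v < n"
  shows "x * r * y \<in> IL n"
  unfolding IL_def
proof (rule span_mult[OF span_mult[OF assms(1,3)] assms(2), of "{W u' * r |u' r. r \<in> env_rel \<and> length u' = length u}"])
  fix x y :: "('g,'k) falg" assume "x \<in> {W u' |u'. length u' = length u}" "y \<in> env_rel"
  then show "x * y \<in> A.span {W u' * r |u' r. r \<in> env_rel \<and> length u' = length u}"
    by (intro A.span_base) auto
next
  fix x y :: "('g,'k) falg"
  assume "x \<in> {W u' * r |u' r. r \<in> env_rel \<and> length u' = length u}" "y \<in> {W v' |v'. length v' = length v}"
  then obtain u' r v' where "x * y = W u' * r * W v'" "r \<in> env_rel" "length u' = length u" "length v' = length v"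
    by auto
  then show "x * y \<in> A.span {W u * r * W v |u r v. r \<in> env_rel \<and> length u + length v < n}"
    using assms(4) by (intro A.span_base) fastforce
qed

text \<open>A derivation of this kind keeps word lengths and maps relations to combinations of
  relations, so the length of the surrounding words does not grow.\<close>

lemma der_IL:
  assumes "r \<in> env_rel" "length u + length v < n"
  shows "der a (W u * r * W v) \<in> IL n"
proof -
  have w: "W w \<in> A.span {W v |v. length v = length w}" for w :: "'g list"
    by (rule A.span_base) auto
  have r: "r \<in> A.span env_rel" using assms(1) by (rule A.span_base)
  have "der a (W u * r * W v) = derW a u * r * W v + W u * der a r * W v + W u * r * derW a v"
    by (simp add: der_mult der_W algebra_simps)
  moreover have "derW a u * r * W v \<in> IL n" "W u * der a r * W v \<in> IL n" "W u * r * derW a v \<in> IL n"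
    using span_IL_base[OF derW_span w r assms(2)] span_IL_base[OF w w der_env_rel[OF assms(1)] assms(2)]
      span_IL_base[OF w derW_span r assms(2)] by auto
  ultimately show ?thesis by (simp add: IL_add)
qed

text \<open>Each letter of \<open>w\<close> contributes one additivity relation, surrounded by the
  other letters, which are one fewer than \<open>w\<close> has. This strict drop feeds the induction
  in \<open>RR_IL\<close>.\<close>

lemma derW_add: "derW (a + b) w - derW a w - derW b w \<in> IL (length w)"
proof (induction w)
  case (Cons y w)
  have "derW (a + b) (y # w) - derW a (y # w) - derW b (y # w) =
     (gen (br a y + br b y) - gen (br a y) - gen (br b y)) * W w + gen y * (derW (a + b) w - derW a w - derW b w)"
    by (simp add: derW_Cons br_add_left algebra_simps)
  then show ?case
    using IL_mult_gen[OF Cons] by (simp add: IL_add IL_base_left lin_env_rel lin_rel_add)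
qed (simp add: derW_Nil)

lemma derW_scale: "derW (scale c a) w - sc c (derW a w) \<in> IL (length w)"
proof (induction w)
  case (Cons y w)
  have "derW (scale c a) (y # w) - sc c (derW a (y # w)) =
     (gen (scale c (br a y)) - sc c (gen (br a y))) * W w + gen y * (derW (scale c a) w - sc c (derW a w))"
    by (simp add: derW_Cons br_scale_left A.scale_right_distrib sc_mult_left sc_mult_right algebra_simps)
  then show ?case
    using IL_mult_gen[OF Cons] by (simp add: IL_add IL_base_left lin_env_rel lin_rel_scale)
qed (simp add: derW_Nil)

lemma derW_br: "derW (br a b) w - (der a (derW b w) - der b (derW a w)) \<in> IL (length w)"
proof (induction w)
  case (Cons y w)
  let ?r = "gen (br (br a b) y + br b (br a y)) - gen (br (br a b) y) - gen (br b (br a y))"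
  have "derW (br a b) (y # w) - (der a (derW b (y # w)) - der b (derW a (y # w))) =
     gen y * (derW (br a b) w - (der a (derW b w) - der b (derW a w))) - ?r * W w"
    unfolding br_leibniz[of a b y, symmetric]
    by (simp add: derW_Cons der_add der_mult der_gen der_W algebra_simps)
  then show ?case
    using IL_mult_gen[OF Cons] by (simp add: IL_diff IL_base_left lin_env_rel lin_rel_add)
qed (simp add: derW_Nil)

lemma RR_lin_base:
  assumes IH: "\<And>a. a \<in> IL (length v) \<Longrightarrow> RR a \<in> I"
  shows "RR ((gen (x + y) - gen x - gen y) * W v) \<in> I"
    and "RR ((gen (scale c x) - sc c (gen x)) * W v) \<in> I"
proof -
  have "RR ((gen (x + y) - gen x - gen y) * W v) =
     (gen (R x + R y) - gen (R x) - gen (R y)) * RR (W v) -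
     RR (derW (R x + R y) v - derW (R x) v - derW (R y) v)"
    by (simp add: left_diff_distrib RR_diff RR_gen_mult R_add der_W)
  then show "RR ((gen (x + y) - gen x - gen y) * W v) \<in> I"
    using IH[OF derW_add] by (simp add: I_diff I_mult_right I_gen_add)
  have "RR ((gen (scale c x) - sc c (gen x)) * W v) =
     (gen (scale c (R x)) - sc c (gen (R x))) * RR (W v) - RR (derW (scale c (R x)) v - sc c (derW (R x) v))"
    by (simp add: left_diff_distrib sc_mult_left RR_diff RR_sc RR_gen_mult R_scale der_W A.scale_right_diff_distrib)
  then show "RR ((gen (scale c x) - sc c (gen x)) * W v) \<in> I"
    using IH[OF derW_scale] by (simp add: I_diff I_mult_right I_gen_scale)
qed

text \<open>Expanding both orders of x and y leaves mixed brackets that combine to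
  \<open>RR (gen ?z * W v)\<close>. The Rota-Baxter identity says that \<open>R ?z\<close> is
  \<open>br ?a ?b\<close>, so the remainder is a bracket relation times \<open>?V\<close> plus terms
  covered by the hypothesis and by linearity.\<close>

lemma RR_br_base:
  assumes IH: "\<And>a. a \<in> IL (length v) \<Longrightarrow> RR a \<in> I"
  shows "RR ((gen x * gen y - gen y * gen x - gen (br x y)) * W v) \<in> I"
proof -
  let ?a = "R x" and ?b = "R y"
  let ?z = "br ?a y + br x ?b + br x y"
  let ?V = "RR (W v)"
  have l1: "RR (gen (p + q) * W v) - RR (gen p * W v) - RR (gen q * W v) \<in> I" for p q
    using RR_lin_base(1)[OF IH, where x = p and y = q] by (simp add: left_diff_distrib RR_diff)
  have l2: "RR (gen (scale c p) * W v) - sc c (RR (gen p * W v)) \<in> I" for p c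
    using RR_lin_base(2)[OF IH, where x = p and c = c]
    by (simp add: left_diff_distrib sc_mult_left RR_sc RR_diff)
  have xy: "RR (gen x * (gen y * W v)) = gen (R x) * (gen (R y) * ?V - RR (derW (R y) v)) -
     RR (gen (br (R x) y) * W v) - (gen (R y) * RR (derW (R x) v) - RR (der (R y) (derW (R x) v)))" for x y
    by (simp add: RR_gen_mult[of x] der_mult der_gen der_W RR_add RR_gen_mult[of y] algebra_simps)
  \<comment> \<open>Exchanging x and y in \<open>xy\<close> produces \<open>br ?b x\<close>, whereas
    the Rota-Baxter identity contains \<open>br x ?b\<close>. As \<open>gen\<close> is not linear,
    the sign is paid for by a scalar relation.\<close>
  have m: "br x ?b = scale (- 1) (br ?b x)"
    by (simp add: br_anti[of x])
  have z: "RR (gen ?z * W v) = gen (br ?a ?b) * ?V - RR (derW (br ?a ?b) v)"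
    by (simp add: RR_gen_mult R_br der_W)
  have "RR ((gen x * gen y - gen y * gen x - gen (br x y)) * W v) =
     (gen ?a * gen ?b - gen ?b * gen ?a - gen (br ?a ?b)) * ?V
     + RR (derW (br ?a ?b) v - (der ?a (derW ?b v) - der ?b (derW ?a v)))
     + (RR (gen ?z * W v) - RR (gen (br ?a y + br x ?b) * W v) - RR (gen (br x y) * W v))
     + (RR (gen (br ?a y + br x ?b) * W v) - RR (gen (br ?a y) * W v) - RR (gen (br x ?b) * W v))
     + (RR (gen (scale (- 1) (br ?b x)) * W v) - sc (- 1) (RR (gen (br ?b x) * W v)))"
    unfolding m[symmetric] z
    by (simp add: left_diff_distrib RR_diff mult.assoc xy[of x y] xy[of y x] RR_add algebra_simps)
  also have "\<dots> \<in> I"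
    by (intro I_add I_mult_right I_gen_br IH derW_br l1 l2)
  finally show ?thesis .
qed

text \<open>A letter in front of the relation is stripped by the recursion for \<open>RR\<close>,
  and \<open>der_IL\<close> keeps both resulting terms in \<open>IL n\<close>. With no letter in
  front, the base lemmas apply.\<close>

lemma RR_IL: "a \<in> IL n \<Longrightarrow> RR a \<in> I"
proof (induction n arbitrary: a)
  case 0
  have "IL 0 = {0}" by (simp add: IL_def)
  then show ?case using 0 by simp
next
  case (Suc n)
  have "RR (W u * r * W v) \<in> I" if r: "r \<in> env_rel" and len: "length u + length v < Suc n" for u r v
  proof (cases u)
    case Nil
    have IH: "RR a \<in> I" if "a \<in> IL (length v)" for a
    proof (rule Suc.IH)
      have "{W u * r * W v' |u r v'. r \<in> env_rel \<and> length u + length v' < length v} \<subseteq>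
        {W u * r * W v' |u r v'. r \<in> env_rel \<and> length u + length v' < n}"
        using len Nil by force
      then show "a \<in> IL n" using that A.span_mono unfolding IL_def by blast
    qed
    show ?thesis
      using r RR_lin_base[OF IH] RR_br_base[OF IH] unfolding env_rel_def lin_rel_def Nil
      by (auto simp: W_Nil)
  next
    case (Cons x u')
    have "RR (gen x * (W u' * r * W v)) \<in> I"
      unfolding RR_gen_mult
    proof (intro I_diff I_mult_left Suc.IH)
      show "W u' * r * W v \<in> IL n"
        using r len Cons by (intro IL_base) (auto intro: A.span_base)
      show "der (R x) (W u' * r * W v) \<in> IL n"
        using r len Cons by (intro der_IL) auto
    qed
    then show ?thesis by (simp add: Cons W_Cons mult.assoc)
  qed
  with Suc.prems show ?case
    unfolding IL_def
    by (induction rule: A.span_induct_alt) (auto simp: RR_add RR_sc I_add I_scale)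
qed

lemma RR_I: "a \<in> I \<Longrightarrow> RR a \<in> I"
  unfolding I_def
proof (induction rule: A.span_induct_alt)
  case base then show ?case by (simp add: A.span_zero)
next
  case (step c x y)
  then obtain u r v where "x = W u * r * W v" "r \<in> env_rel" unfolding env_gens_def by auto
  then have "x \<in> IL (Suc (length u + length v))" by (auto intro: IL_base A.span_base)
  then have "RR x \<in> I" by (rule RR_IL)
  then show ?case using step(2) unfolding I_def[symmetric] by (simp add: RR_add RR_sc I_add I_scale)
qed

lemma RR_W_J: "weights w ns \<Longrightarrow> RR (W w) \<in> J (sum_list ns)"
proof (induction w arbitrary: ns rule: length_induct)
  case (1 w)
  show ?case
  proof (cases w)
    case Nil
    then show ?thesis using 1(2) by (simp add: weights_def A.J_0)
  next
    case (Cons x v)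
    then obtain n ms where ns: "ns = n # ms" "1 \<le> n" "x \<in> F n" and v: "weights v ms"
      using 1(2) by (auto simp: weights_def list_all2_Cons1)
    have len: "length ms = length v" using v by (auto simp: weights_def dest: list_all2_lengthD)
    have "RR (W (v[i := br (R x) (v ! i)])) \<in> J (sum_list ns)" if i: "i < length v" for i
    proof -
      \<comment> \<open>The weight \<open>n\<close> of the removed letter x moves to the letter that
        is bracketed with \<open>R x\<close>, so the total weight is unchanged.\<close>
      have "weights (v[i := br (R x) (v ! i)]) (ms[i := n + ms ! i])"
        unfolding weights_def
      proof (rule list_all2_update_cong)
        show "list_all2 (\<lambda>x n. 1 \<le> n \<and> x \<in> F n) v ms" using v by (simp add: weights_def)
        have "1 \<le> ms ! i \<and> v ! i \<in> F (ms ! i)"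
          using v i by (auto simp: weights_def list_all2_conv_all_nth)
        then show "1 \<le> n + ms ! i \<and> br (R x) (v ! i) \<in> F (n + ms ! i)"
          using ns by (intro conjI F_br R_F) auto
      qed
      moreover have "sum_list (ms[i := n + ms ! i]) = sum_list ns"
        using i len by (simp add: sum_list_update ns)
      moreover have "length (v[i := br (R x) (v ! i)]) < length w"
        by (simp add: Cons)
      ultimately show ?thesis using 1(1) by metis
    qed
    moreover have "gen (R x) * RR (W v) \<in> J (n + sum_list ms)"
      by (rule A.J_mult[OF gen_J[OF ns(2) R_F[OF ns(2,3)]]]) (use v 1(1) Cons in auto)
    ultimately show ?thesis
      by (simp add: Cons W_Cons RR_gen_mult der_W derW_def RR_sum ns) (rule A.J_diff, assumption, rule A.J_sum, simp)
  qed
qed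

lemma RR_J: "a \<in> J n \<Longrightarrow> RR a \<in> J n"
  unfolding J_def
proof (induction rule: A.span_induct_alt)
  case base then show ?case by (simp add: A.span_zero)
next
  case (step c x y)
  have "RR x \<in> J n"
  proof (cases "x \<in> env_gens")
    case True
    then have "x \<in> I" unfolding I_def by (rule A.span_base)
    then show ?thesis by (intro I_J RR_I)
  next
    case False
    then obtain w ns where "x = W w" "weights w ns" "n \<le> sum_list ns"
      using step(1) unfolding WW_def by auto
    then show ?thesis using RR_W_J A.J_mono by blast
  qed
  then show ?case using step(2) unfolding J_def[symmetric] by (simp add: RR_add RR_sc A.J_add A.J_scale)
qed

end

subsection \<open>A filtered Poincare-Birkhoff-Witt property\<close>

text \<open>The combination P(2s) - 2^m P(s) kills the top coefficient and multiplies the i-th one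
  by 2^i - 2^m, which is invertible. Induction on the degree then replaces a Vandermonde
  argument.\<close>

lemma (in vector_space) poly_coeffs_subspace:
  fixes c :: "nat \<Rightarrow> 'b"
  assumes S: "subspace S" and char0: "\<And>i m. i < m \<Longrightarrow> (2::'a) ^ i \<noteq> 2 ^ m"
  shows "(\<And>s. (\<Sum>i<m. scale (s ^ i) (c i)) \<in> S) \<Longrightarrow> i < m \<Longrightarrow> c i \<in> S"
proof (induction m arbitrary: c i)
  case (Suc m)
  let ?P = "\<lambda>s. \<Sum>i<Suc m. scale (s ^ i) (c i)"
  have lower: "c i \<in> S" if "i < m" for i
  proof -
    have "(\<Sum>i<m. scale (s ^ i) (scale (2 ^ i - 2 ^ m) (c i))) = ?P (2 * s) - scale (2 ^ m) (?P s)" for s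
    proof -
      have "?P (2 * s) - scale (2 ^ m) (?P s) = (\<Sum>i<Suc m. scale (s ^ i) (scale (2 ^ i - 2 ^ m) (c i)))"
        unfolding scale_sum_right sum_subtractf[symmetric]
        by (intro sum.cong refl) (simp add: power_mult_distrib scale_left_diff_distrib scale_right_diff_distrib right_diff_distrib mult.commute)
      then show ?thesis by simp
    qed
    then have "(\<Sum>i<m. scale (s ^ i) (scale (2 ^ i - 2 ^ m) (c i))) \<in> S" for s
      by (simp only: subspace_diff[OF S] subspace_scale[OF S] Suc.prems(1))
    then have "scale (2 ^ i - 2 ^ m) (c i) \<in> S"
      using that by (rule Suc.IH[of "\<lambda>i. scale (2 ^ i - 2 ^ m) (c i)"])
    then have "scale (inverse (2 ^ i - 2 ^ m)) (scale (2 ^ i - 2 ^ m) (c i)) \<in> S"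
      using S subspace_scale by blast
    then show ?thesis using char0[OF that] by simp
  qed
  show ?case
  proof (cases "i = m")
    case True
    have "(\<Sum>i<m. c i) \<in> S" using S lower by (auto intro: subspace_sum)
    moreover have "c m = ?P 1 - (\<Sum>i<m. c i)" by simp
    ultimately show ?thesis using S Suc.prems(1) True by (simp only: subspace_diff)
  qed (use lower Suc.prems(2) in simp)
qed simp

section \<open>Polynomial expansion along lines and formal directional derivatives\<close>

context lie_alg
begin

lemma two_power_neq: "i < m \<Longrightarrow> (2::'k) ^ i \<noteq> 2 ^ m"
proof
  assume "i < m" "(2::'k) ^ i = 2 ^ m"
  then have "of_nat (2 ^ i) = (of_nat (2 ^ m) :: 'k)" by simp
  then have "(2::nat) ^ i = 2 ^ m" by (simp only: of_nat_eq_iff)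
  then show False using \<open>i < m\<close> by simp
qed

text \<open>The scalar s runs through the whole infinite field, so the coefficients are determined
  by the values of \<open>f\<close> (\<open>taylor_unique\<close>). This gives derivatives over any
  field of characteristic zero and in any dimension.\<close>

definition taylor :: "('g \<Rightarrow> 'g) \<Rightarrow> 'g \<Rightarrow> 'g \<Rightarrow> (nat \<Rightarrow> 'g) \<Rightarrow> bool" where
  "taylor f y v c \<longleftrightarrow> (\<exists>m. (\<forall>i\<ge>m. c i = 0) \<and> (\<forall>s. f (y + scale s v) = (\<Sum>i<m. scale (s ^ i) (c i))))"

lemma sum_extend: "m \<le> M \<Longrightarrow> (\<forall>i\<ge>m. c i = 0) \<Longrightarrow>
   (\<Sum>i<M. scale (s ^ i) (c i)) = (\<Sum>i<m. scale (s ^ i) (c i))"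
  by (rule sum.mono_neutral_right) auto

lemma taylor_large:
  assumes "taylor f y v c"
  obtains m where "\<And>i M. m \<le> M \<Longrightarrow> M \<le> i \<Longrightarrow> c i = 0"
    "\<And>M s. m \<le> M \<Longrightarrow> f (y + scale s v) = (\<Sum>i<M. scale (s ^ i) (c i))"
proof -
  obtain m where m: "\<forall>i\<ge>m. c i = 0" "\<And>s. f (y + scale s v) = (\<Sum>i<m. scale (s ^ i) (c i))"
    using assms unfolding taylor_def by blast
  show thesis
  proof (rule that[of m])
    show "c i = 0" if "m \<le> M" "M \<le> i" for i M
      using m(1) that by simp
    show "f (y + scale s v) = (\<Sum>i<M. scale (s ^ i) (c i))" if "m \<le> M" for M s
      by (simp only: m(2) sum_extend[OF that m(1)])
  qed
qed

lemma taylor_two: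
  assumes "taylor f y v c" "taylor f' y v c'"
  obtains M where "\<And>i. M \<le> i \<Longrightarrow> c i = 0" "\<And>i. M \<le> i \<Longrightarrow> c' i = 0"
    "\<And>s. f (y + scale s v) = (\<Sum>i<M. scale (s ^ i) (c i))"
    "\<And>s. f' (y + scale s v) = (\<Sum>i<M. scale (s ^ i) (c' i))"
proof -
  obtain m where m: "\<And>i M. m \<le> M \<Longrightarrow> M \<le> i \<Longrightarrow> c i = 0"
    "\<And>M s. m \<le> M \<Longrightarrow> f (y + scale s v) = (\<Sum>i<M. scale (s ^ i) (c i))"
    using taylor_large[OF assms(1)] by metis
  obtain m' where m': "\<And>i M. m' \<le> M \<Longrightarrow> M \<le> i \<Longrightarrow> c' i = 0"
    "\<And>M s. m' \<le> M \<Longrightarrow> f' (y + scale s v) = (\<Sum>i<M. scale (s ^ i) (c' i))"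
    using taylor_large[OF assms(2)] by metis
  show thesis
    by (rule that[of "max m m'"]) (auto intro: m(1)[of "max m m'"] m'(1)[of "max m m'"] m(2) m'(2))
qed

lemma taylor_subspace:
  assumes "taylor f y v c" "subspace S" "\<And>x. f x \<in> S" shows "c i \<in> S"
proof -
  obtain m where m: "\<And>i M. m \<le> M \<Longrightarrow> M \<le> i \<Longrightarrow> c i = 0"
    "\<And>M s. m \<le> M \<Longrightarrow> f (y + scale s v) = (\<Sum>i<M. scale (s ^ i) (c i))"
    using taylor_large[OF assms(1)] by metis
  show ?thesis
  proof (cases "i < m")
    case True
    show ?thesis
      by (rule poly_coeffs_subspace[OF assms(2) two_power_neq _ True])
         (assumption, subst m(2)[symmetric], simp, rule assms(3))
  next
    case False then show ?thesis using m(1)[of m i] assms(2) by (simp add: subspace_0)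
  qed
qed

lemma taylor_add:
  assumes "taylor f y v c" "taylor g y v d"
  shows "taylor (\<lambda>x. f x + g x) y v (\<lambda>i. c i + d i)"
proof (rule taylor_two[OF assms])
  fix M
  assume "\<And>i. M \<le> i \<Longrightarrow> c i = 0" "\<And>i. M \<le> i \<Longrightarrow> d i = 0"
    "\<And>s. f (y + scale s v) = (\<Sum>i<M. scale (s ^ i) (c i))"
    "\<And>s. g (y + scale s v) = (\<Sum>i<M. scale (s ^ i) (d i))"
  then show ?thesis
    unfolding taylor_def by (intro exI[of _ M]) (simp add: scale_right_distrib sum.distrib)
qed

lemma taylor_scale:
  assumes "taylor f y v c" shows "taylor (\<lambda>x. scale a (f x)) y v (\<lambda>i. scale a (c i))"
proof -
  obtain m where "\<forall>i\<ge>m. c i = 0" "\<forall>s. f (y + scale s v) = (\<Sum>i<m. scale (s ^ i) (c i))"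
    using assms unfolding taylor_def by blast
  then show ?thesis
    unfolding taylor_def by (intro exI[of _ m]) (simp add: scale_sum_right mult.commute)
qed

lemma taylor_const: "taylor (\<lambda>_. a) y v (\<lambda>i. if i = 0 then a else 0)"
  unfolding taylor_def by (rule exI[of _ 1]) auto

lemma taylor_ident: "taylor (\<lambda>x. x) y v (\<lambda>i. if i = 0 then y else if i = 1 then v else 0)"
  unfolding taylor_def by (rule exI[of _ 2]) (auto simp: numeral_2_eq_2)

lemma taylor_br:
  assumes "taylor f y v c" "taylor g y v d"
  shows "taylor (\<lambda>x. br (f x) (g x)) y v (\<lambda>n. \<Sum>i\<le>n. br (c i) (d (n - i)))"
proof (rule taylor_two[OF assms])
  fix M
  assume c: "\<And>i. M \<le> i \<Longrightarrow> c i = 0" and d: "\<And>i. M \<le> i \<Longrightarrow> d i = 0"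
    and f: "\<And>s. f (y + scale s v) = (\<Sum>i<M. scale (s ^ i) (c i))"
    and g: "\<And>s. g (y + scale s v) = (\<Sum>i<M. scale (s ^ i) (d i))"
  have z: "br (c i) (d j) = 0" if "2 * M \<le> i + j" for i j
    using that c[of i] d[of j] by (cases "M \<le> i") auto
  show ?thesis
    unfolding taylor_def
  proof (intro exI[of _ "2 * M"] conjI allI impI)
    fix n assume "2 * M \<le> n"
    then show "(\<Sum>i\<le>n. br (c i) (d (n - i))) = 0"
      by (intro sum.neutral ballI z) auto
  next
    fix s
    let ?c = "\<lambda>i j. scale (s ^ (i + j)) (br (c i) (d j))"
    have "br (f (y + scale s v)) (g (y + scale s v)) = (\<Sum>i<M. \<Sum>j<M. ?c i j)"
      by (simp only: f g br_sum_left) (simp add: br_sum_right br_scale_left br_scale_right power_add mult.commute)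
    also have "\<dots> = (\<Sum>i<2*M. \<Sum>j<2*M. ?c i j)"
    proof (rule sum.mono_neutral_cong_left)
      show "\<forall>i\<in>{..<2*M} - {..<M}. (\<Sum>j<2*M. ?c i j) = 0"
        using c by auto
      fix i
      show "(\<Sum>j<M. ?c i j) = (\<Sum>j<2*M. ?c i j)"
        by (rule sum.mono_neutral_left) (use d in auto)
    qed auto
    also have "\<dots> = (\<Sum>k<2*M. \<Sum>i\<le>k. ?c i (k - i))"
      using triangle_subspace[OF subspace_single_0, of "2*M" ?c "2*M"] z by simp
    finally show "br (f (y + scale s v)) (g (y + scale s v)) =
        (\<Sum>k<2*M. scale (s ^ k) (\<Sum>i\<le>k. br (c i) (d (k - i))))"
      by (simp add: scale_sum_right)
  qed
qed

lemma taylor_0: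
  assumes "taylor f y v c" shows "c 0 = f y"
proof -
  obtain m where m: "\<And>i M. m \<le> M \<Longrightarrow> M \<le> i \<Longrightarrow> c i = 0"
    "\<And>M s. m \<le> M \<Longrightarrow> f (y + scale s v) = (\<Sum>i<M. scale (s ^ i) (c i))"
    using taylor_large[OF assms] by metis
  have "f (y + scale 0 v) = (\<Sum>i<Suc m. scale (0 ^ i) (c i))"
    by (rule m(2)) simp
  then show ?thesis by (simp add: sum.lessThan_Suc_shift del: sum.lessThan_Suc)
qed

lemma taylor_unique:
  assumes "taylor f y v c" "taylor f y v d" shows "c = d"
proof
  fix i
  have "taylor (\<lambda>x. f x + scale (- 1) (f x)) y v (\<lambda>i. c i + scale (- 1) (d i))"
    by (intro taylor_add taylor_scale assms)
  from taylor_subspace[OF this subspace_single_0, of i] show "c i = d i" by simp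
qed

text \<open>Derivative of \<open>f\<close> along the vector field \<open>h\<close>: the linear
  coefficient on the line through y in direction \<open>h y\<close>.\<close>

definition D :: "('g \<Rightarrow> 'g) \<Rightarrow> ('g \<Rightarrow> 'g) \<Rightarrow> 'g \<Rightarrow> 'g" where
  "D h f y = (THE c. taylor f y (h y) c) 1"

lemma D_eq: "taylor f y v c \<Longrightarrow> v = h y \<Longrightarrow> D h f y = c 1"
  unfolding D_def using taylor_unique by (metis the_equality)

text \<open>With this factor \<open>th k u y\<close> is (-ad y)^k (u y) / (k+1)!, so that summing
  over k gives (1 - e^{-ad y}) / ad y, the left Maurer-Cartan form in exponential
  coordinates.\<close>

definition tc :: "nat \<Rightarrow> 'k" where "tc k = - (1 / of_nat (Suc (Suc k)))"

primrec th :: "nat \<Rightarrow> ('g \<Rightarrow> 'g) \<Rightarrow> 'g \<Rightarrow> 'g" where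
  "th 0 u = u"
| "th (Suc k) u = (\<lambda>y. scale (tc k) (br y (th k u y)))"

lemma th_add: "th k (\<lambda>y. u y + v y) y = th k u y + th k v y"
  and th_scale: "th k (\<lambda>y. scale c (u y)) y = scale c (th k u y)"
  by (induction k) (simp_all add: br_add_right br_scale_right scale_right_distrib mult.commute)

lemma th_diff: "th k (\<lambda>y. u y - v y) y = th k u y - th k v y"
  using th_add[of k u "\<lambda>y. scale (- 1) (v y)" y] th_scale[of k "- 1" v y] by simp

lemma th_Suc: "scale (of_nat (Suc (Suc k))) (th (Suc k) u y) = - br y (th k u y)"
  by (simp add: tc_def del: of_nat_Suc)

lemma th_at_0: "k > 0 \<Longrightarrow> th k u 0 = 0"
  by (cases k) auto

end

context filtered_lie_alg
begin

lemma F_0 [simp]: "n \<ge> 1 \<Longrightarrow> 0 \<in> F n"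
  using F_subspace subspace_0 by blast
lemma F_add: "n \<ge> 1 \<Longrightarrow> x \<in> F n \<Longrightarrow> y \<in> F n \<Longrightarrow> x + y \<in> F n"
  using F_subspace subspace_add by blast
lemma F_diff: "n \<ge> 1 \<Longrightarrow> x \<in> F n \<Longrightarrow> y \<in> F n \<Longrightarrow> x - y \<in> F n"
  using F_subspace subspace_diff by blast
lemma F_uminus: "n \<ge> 1 \<Longrightarrow> x \<in> F n \<Longrightarrow> - x \<in> F n"
  using F_subspace subspace_neg by blast
lemma F_scale: "n \<ge> 1 \<Longrightarrow> x \<in> F n \<Longrightarrow> scale c x \<in> F n"
  using F_subspace subspace_scale by blast
lemma F_sum: "n \<ge> 1 \<Longrightarrow> (\<And>i. i \<in> S \<Longrightarrow> f i \<in> F n) \<Longrightarrow> sum f S \<in> F n"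
  using F_subspace subspace_sum by blast

lemma F_br_left: "n \<ge> 1 \<Longrightarrow> x \<in> F n \<Longrightarrow> br x y \<in> F (Suc n)"
  using F_br[of n 1 x y] F_1 by simp
lemma F_br_right: "n \<ge> 1 \<Longrightarrow> y \<in> F n \<Longrightarrow> br x y \<in> F (Suc n)"
  using F_br[of 1 n x y] F_1 by simp
lemma F_br_ideal: "n \<ge> 1 \<Longrightarrow> x \<in> F n \<Longrightarrow> br x y \<in> F n" "n \<ge> 1 \<Longrightarrow> y \<in> F n \<Longrightarrow> br x y \<in> F n"
  by (meson F_Suc F_br_left subsetD) (meson F_Suc F_br_right subsetD)

text \<open>Lie polynomial maps, graded by the total weight of their constants; the variable has
  weight $0$ here because differentiation may replace it by elements of any weight.\<close>

inductive Pol :: "nat \<Rightarrow> ('g \<Rightarrow> 'g) \<Rightarrow> bool" where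
  const: "n \<ge> 1 \<Longrightarrow> a \<in> F n \<Longrightarrow> Pol n (\<lambda>_. a)"
| ident: "Pol 0 (\<lambda>y. y)"
| bracket: "Pol m f \<Longrightarrow> Pol n g \<Longrightarrow> Pol (m + n) (\<lambda>y. br (f y) (g y))"
| add: "Pol n f \<Longrightarrow> Pol n g \<Longrightarrow> Pol n (\<lambda>y. f y + g y)"
| scale: "Pol n f \<Longrightarrow> Pol n (\<lambda>y. scale c (f y))"
| mono: "Pol n f \<Longrightarrow> m \<le> n \<Longrightarrow> Pol m f"

lemma Pol_const: "Pol 0 (\<lambda>_. a)"
  by (rule Pol.mono[OF Pol.const[of 1]]) (simp_all add: F_1[unfolded One_nat_def])

lemma Pol_zero: "Pol n (\<lambda>_. 0)"
  using Pol.mono[OF Pol.const[of "Suc n" 0]] by simp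

lemma Pol_diff: "Pol n f \<Longrightarrow> Pol n g \<Longrightarrow> Pol n (\<lambda>y. f y - g y)"
  using Pol.add[of n f "\<lambda>y. scale (- 1) (g y)"] Pol.scale[of n g "- 1"] by simp

lemma Pol_sum: "(\<And>i. i \<in> S \<Longrightarrow> Pol n (f i)) \<Longrightarrow> Pol n (\<lambda>y. \<Sum>i\<in>S. f i y)"
  by (induction S rule: infinite_finite_induct) (simp_all add: Pol_zero Pol.add)

lemma Pol_taylor: "Pol n f \<Longrightarrow> \<exists>c. taylor f y v c"
proof (induction rule: Pol.induct)
  case (bracket m f n g)
  then obtain c d where "taylor f y v c" "taylor g y v d" by auto
  then show ?case using taylor_br by blast
next
  case (add n f g)
  then obtain c d where "taylor f y v c" "taylor g y v d" by auto
  then show ?case using taylor_add by blast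
next
  case (scale n f a)
  then obtain c where "taylor f y v c" by auto
  then show ?case using taylor_scale by blast
qed (rule exI, rule taylor_const taylor_ident | assumption)+

lemma D_const: "D h (\<lambda>_. a) = (\<lambda>_. 0)"
  and D_ident: "D h (\<lambda>y. y) = h"
  using D_eq[OF taylor_const refl] D_eq[OF taylor_ident refl] by (auto simp: fun_eq_iff)

lemma D_br: "Pol m f \<Longrightarrow> Pol n g \<Longrightarrow>
   D h (\<lambda>y. br (f y) (g y)) y = br (D h f y) (g y) + br (f y) (D h g y)"
proof -
  assume "Pol m f" "Pol n g"
  then obtain c d where cd: "taylor f y (h y) c" "taylor g y (h y) d"
    using Pol_taylor[of m f y "h y"] Pol_taylor[of n g y "h y"] by auto
  then show ?thesis
    using D_eq[where h = h, OF taylor_br[OF cd] refl] D_eq[where h = h, OF cd(1) refl] D_eq[where h = h, OF cd(2) refl] taylor_0[OF cd(1)] taylor_0[OF cd(2)]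
    by (simp add: add.commute)
qed

lemma D_add: "Pol m f \<Longrightarrow> Pol n g \<Longrightarrow> D h (\<lambda>y. f y + g y) y = D h f y + D h g y"
proof -
  assume "Pol m f" "Pol n g"
  then obtain c d where cd: "taylor f y (h y) c" "taylor g y (h y) d"
    using Pol_taylor[of m f y "h y"] Pol_taylor[of n g y "h y"] by auto
  then show ?thesis
    using D_eq[where h = h, OF taylor_add[OF cd] refl] D_eq[where h = h, OF cd(1) refl] D_eq[where h = h, OF cd(2) refl] by simp
qed

lemma D_scale: "Pol m f \<Longrightarrow> D h (\<lambda>y. scale a (f y)) y = scale a (D h f y)"
proof -
  assume "Pol m f"
  then obtain c where c: "taylor f y (h y) c"
    using Pol_taylor[of m f y "h y"] by auto
  then show ?thesis
    using D_eq[where h = h, OF taylor_scale[OF c] refl] D_eq[where h = h, OF c refl] by simp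
qed

lemma D_diff: "Pol m f \<Longrightarrow> Pol n g \<Longrightarrow> D h (\<lambda>y. f y - g y) y = D h f y - D h g y"
  using D_add[of m f n "\<lambda>y. scale (- 1) (g y)"] D_scale[of n g h "- 1"] Pol.scale[of n g "- 1"] by simp

lemma D_sum: "(\<And>i. i \<in> S \<Longrightarrow> Pol n (f i)) \<Longrightarrow> D h (\<lambda>y. \<Sum>i\<in>S. f i y) y = (\<Sum>i\<in>S. D h (f i) y)"
  by (induction S rule: infinite_finite_induct) (auto simp: D_const D_add[of n _ n] Pol_sum)

text \<open>Differentiation replaces one occurrence of the variable, which has weight 0, by
  \<open>h\<close>; the weight grows by that of \<open>h\<close>.\<close>

lemma Pol_D:
  assumes h: "Pol a h"
  shows "Pol n f \<Longrightarrow> Pol (a + n) (D h f)"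
proof (induction rule: Pol.induct)
  case (const n a)
  then show ?case by (simp add: D_const Pol_zero)
next
  case ident
  show ?case using h by (simp add: D_ident)
next
  case (bracket m f n g)
  have "D h (\<lambda>y. br (f y) (g y)) = (\<lambda>y. br (D h f y) (g y) + br (f y) (D h g y))"
    using bracket D_br by blast
  then show ?case
    using Pol.bracket[OF bracket(3) bracket(2)] Pol.bracket[OF bracket(1) bracket(4)]
    by (simp add: add_ac Pol.add)
next
  case (add n f g)
  have "D h (\<lambda>y. f y + g y) = (\<lambda>y. D h f y + D h g y)"
    using add D_add by blast
  then show ?case using add by (simp add: Pol.add)
next
  case (scale n f c)
  have "D h (\<lambda>y. scale c (f y)) = (\<lambda>y. scale c (D h f y))"
    using scale D_scale by blast
  then show ?case using scale by (simp add: Pol.scale)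
next
  case (mono n f m)
  then show ?case using Pol.mono[of "a + n" "D h f" "a + m"] by simp
qed

lemma D_vector_add: "Pol n f \<Longrightarrow> D (\<lambda>y. h y + k y) f y = D h f y + D k f y"
proof (induction arbitrary: y rule: Pol.induct)
  case (bracket m f n g)
  then show ?case by (simp add: D_br[of m f n g] br_add_left br_add_right algebra_simps)
qed (auto simp: D_const D_ident D_add D_scale scale_right_distrib algebra_simps)

lemma D_vector_scale: "Pol n f \<Longrightarrow> D (\<lambda>y. scale c (h y)) f y = scale c (D h f y)"
proof (induction arbitrary: y rule: Pol.induct)
  case (bracket m f n g)
  then show ?case by (simp add: D_br[of m f n g] br_scale_left br_scale_right algebra_simps)
qed (auto simp: D_const D_ident D_add D_scale scale_right_distrib mult.commute algebra_simps)

lemma D_vector_diff: "Pol n f \<Longrightarrow> D (\<lambda>y. h y - k y) f y = D h f y - D k f y"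
  using D_vector_add[of n f h "\<lambda>y. scale (- 1) (k y)" y] D_vector_scale[of n f "- 1" k y] by simp

text \<open>All coefficients along a line inherit the subspace in which the values lie. Consequently
  \<open>D h\<close> passes to maps taken modulo \<open>F N\<close>.\<close>

lemma D_values: "Pol n f \<Longrightarrow> N \<ge> 1 \<Longrightarrow> (\<And>y. f y \<in> F N) \<Longrightarrow> D h f y \<in> F N"
  using Pol_taylor[of n f y "h y"] taylor_subspace[of f y "h y" _ "F N" 1] F_subspace[of N]
  by (metis D_eq)

lemma D_vector_values: "Pol n f \<Longrightarrow> N \<ge> 1 \<Longrightarrow> (\<And>y. h y \<in> F N) \<Longrightarrow> D h f y \<in> F N"
proof (induction arbitrary: y rule: Pol.induct)
  case (bracket m f n g)
  then show ?case by (simp add: D_br[of m f n g] F_add F_br_ideal)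
qed (auto simp: D_const D_ident D_add D_scale F_add F_scale)

text \<open>Both sides are derivations in \<open>f\<close> that vanish on constants and agree on the
  identity map, where they give the bracket of the vector fields.\<close>

lemma D_commutator:
  assumes hk: "Pol a h" "Pol b k"
  shows "Pol n f \<Longrightarrow> D h (D k f) y - D k (D h f) y = D (\<lambda>y. D h k y - D k h y) f y"
proof (induction arbitrary: y rule: Pol.induct)
  case (const n a)
  then show ?case by (simp add: D_const)
next
  case ident
  then show ?case by (simp add: D_ident)
next
  case (bracket m f n g)
  note Pf = bracket(1) Pol_D[OF hk(1) bracket(1)] Pol_D[OF hk(2) bracket(1)]
  note Pg = bracket(2) Pol_D[OF hk(1) bracket(2)] Pol_D[OF hk(2) bracket(2)]
  have *: "D h' (\<lambda>y. br (f y) (g y)) = (\<lambda>y. br (D h' f y) (g y) + br (f y) (D h' g y))" for h'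
    using bracket D_br by blast
  let ?l = "\<lambda>y. D h k y - D k h y"
  have "D h (D k (\<lambda>y. br (f y) (g y))) y - D k (D h (\<lambda>y. br (f y) (g y))) y =
     br (D h (D k f) y - D k (D h f) y) (g y) + br (f y) (D h (D k g) y - D k (D h g) y)"
    unfolding *
    by (simp add: D_add[OF Pol.bracket Pol.bracket] D_br Pf Pg br_diff_left br_diff_right
        D_add[OF Pol.bracket[OF Pf(3) Pg(1)] Pol.bracket[OF Pf(1) Pg(3)]]
        D_add[OF Pol.bracket[OF Pf(2) Pg(1)] Pol.bracket[OF Pf(1) Pg(2)]]
        D_br[OF Pf(3) Pg(1)] D_br[OF Pf(1) Pg(3)] D_br[OF Pf(2) Pg(1)] D_br[OF Pf(1) Pg(2)])
  then show ?case using bracket(3,4) by (simp add: *)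
next
  case (add n f g)
  have *: "D h' (\<lambda>y. f y + g y) = (\<lambda>y. D h' f y + D h' g y)" for h'
    using add D_add by blast
  show ?case
    unfolding * using add(3,4)
    by (simp add: D_add[OF Pol_D[OF hk(1) add(1)] Pol_D[OF hk(1) add(2)]]
        D_add[OF Pol_D[OF hk(2) add(1)] Pol_D[OF hk(2) add(2)]] flip: add.IH)
next
  case (scale n f c)
  have *: "D h' (\<lambda>y. scale c (f y)) = (\<lambda>y. scale c (D h' f y))" for h'
    using scale D_scale by blast
  show ?case
    unfolding * by (simp add: D_scale[OF Pol_D[OF hk(1) scale(1)]] D_scale[OF Pol_D[OF hk(2) scale(1)]]
        scale_right_diff_distrib[symmetric] scale.IH)
next
  case (mono n f m)
  then show ?case by simp
qed

section \<open>The Maurer-Cartan form in exponential coordinates\<close>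

lemma Pol_th: "Pol n u \<Longrightarrow> Pol n (th k u)"
proof (induction k)
  case (Suc k)
  then show ?case using Pol.bracket[OF Pol.ident, of n "th k u"] by (simp add: Pol.scale)
qed simp

lemma th_values: "n \<ge> 1 \<Longrightarrow> (\<And>y. u y \<in> F n) \<Longrightarrow> th k u y \<in> F (n + k)"
proof (induction k)
  case (Suc k)
  then show ?case using F_br_right[of "n + k" "th k u y" y] by (simp add: F_scale)
qed simp

text \<open>Derivative along \<open>h\<close> of the operator coefficient \<open>th k\<close> alone,
  with \<open>u\<close> held fixed: what remains of the product rule once the derivative of
  \<open>u\<close> is subtracted.\<close>

definition dth :: "nat \<Rightarrow> ('g \<Rightarrow> 'g) \<Rightarrow> ('g \<Rightarrow> 'g) \<Rightarrow> 'g \<Rightarrow> 'g" where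
  "dth k h u y = D h (th k u) y - th k (D h u) y"

lemma dth_Suc: "Pol n u \<Longrightarrow>
  scale (of_nat (Suc (Suc k))) (dth (Suc k) h u y) = - (br (h y) (th k u y) + br y (dth k h u y))"
proof -
  assume u: "Pol n u"
  have "Pol n (\<lambda>y. br y (th k u y))"
    using Pol.bracket[OF Pol.ident Pol_th[OF u, of k]] by simp
  then have "D h (th (Suc k) u) y =
     scale (tc k) (br (h y) (th k u y) + br y (D h (th k u) y))"
    by (simp add: D_scale D_br[OF Pol.ident Pol_th[OF u, of k]] D_ident)
  then show ?thesis
    unfolding dth_def th_Suc scale_right_diff_distrib
    by (simp add: tc_def br_diff_right br_add_right del: of_nat_Suc)
qed

text \<open>The coefficients of the Maurer-Cartan equation for the form
  $\theta_y(v) = \sum_k \frac{(-1)^k}{(k+1)!} (\mathrm{ad}\, y)^k v$ vanish because they satisfy a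
  first order recursion starting at zero.\<close>

lemma maurer_cartan_coeff:
  assumes h: "Pol a h" and u: "Pol b u"
  shows "dth m h u y - dth m u h y + (\<Sum>i<m. br (th i h y) (th (m - Suc i) u y)) = 0"
proof (induction m)
  case 0
  then show ?case by (simp add: dth_def)
next
  case (Suc m)
  let ?S = "\<Sum>i<m. br (th i h y) (th (m - Suc i) u y)"
  have th1: "scale (of_nat (Suc k)) (th k v y) = (case k of 0 \<Rightarrow> v y | Suc k' \<Rightarrow> - br y (th k' v y))" for k v
  proof (cases k)
    case (Suc k')
    then show ?thesis by (simp only: th_Suc nat.case)
  qed simp
  have "scale (of_nat (Suc (Suc m))) (\<Sum>i\<le>m. br (th i h y) (th (m - i) u y)) =
     (\<Sum>i\<le>m. br (scale (of_nat (Suc i)) (th i h y)) (th (m - i) u y)) +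
     (\<Sum>i\<le>m. br (th i h y) (scale (of_nat (Suc (m - i))) (th (m - i) u y)))"
    unfolding scale_sum_right sum.distrib[symmetric] br_scale_left br_scale_right scale_left_distrib[symmetric]
      of_nat_add[symmetric]
    by (intro sum.cong refl) simp
  also have "(\<Sum>i\<le>m. br (scale (of_nat (Suc i)) (th i h y)) (th (m - i) u y)) =
     br (h y) (th m u y) - (\<Sum>i<m. br (br y (th i h y)) (th (m - Suc i) u y))"
    unfolding th1 lessThan_Suc_atMost[symmetric] sum.lessThan_Suc_shift
    by (simp add: br_minus_left sum_negf)
  also have "(\<Sum>i\<le>m. br (th i h y) (scale (of_nat (Suc (m - i))) (th (m - i) u y))) =
     br (th m h y) (u y) - (\<Sum>i<m. br (th i h y) (br y (th (m - Suc i) u y)))"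
  proof -
    have "(\<Sum>i<m. br (th i h y) (scale (of_nat (Suc (m - i))) (th (m - i) u y))) =
       (\<Sum>i<m. - br (th i h y) (br y (th (m - Suc i) u y)))"
    proof (intro sum.cong refl)
      fix i assume "i \<in> {..<m}"
      then have "m - i = Suc (m - Suc i)" by auto
      then show "br (th i h y) (scale (of_nat (Suc (m - i))) (th (m - i) u y)) =
          - br (th i h y) (br y (th (m - Suc i) u y))"
        by (simp only: th_Suc br_minus_right)
    qed
    then show ?thesis
      unfolding lessThan_Suc_atMost[symmetric] sum.lessThan_Suc th1[of "m - m"] by (simp add: sum_negf)
  qed
  \<comment> \<open>The Jacobi identity, in the form \<open>br_leibniz\<close>, merges the two
    shifted sums into \<open>br y\<close> applied to the sum of the preceding degree.\<close>
  finally have S: "scale (of_nat (Suc (Suc m))) (\<Sum>i<Suc m. br (th i h y) (th (Suc m - Suc i) u y)) =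
     br (h y) (th m u y) + br (th m h y) (u y) - br y ?S"
    unfolding br_sum_right br_leibniz[of y] sum.distrib lessThan_Suc_atMost by (simp add: algebra_simps)
  have "scale (of_nat (Suc (Suc m)))
      (dth (Suc m) h u y - dth (Suc m) u h y + (\<Sum>i<Suc m. br (th i h y) (th (Suc m - Suc i) u y))) =
      - br y (dth m h u y - dth m u h y + ?S)"
    unfolding scale_right_distrib scale_right_diff_distrib S dth_Suc[OF u] dth_Suc[OF h]
    by (simp add: br_add_right br_diff_right br_anti[of "u y"])
  also have "\<dots> = 0" unfolding Suc.IH by simp
  finally show ?case by (simp del: of_nat_Suc)
qed

definition Th :: "nat \<Rightarrow> ('g \<Rightarrow> 'g) \<Rightarrow> 'g \<Rightarrow> 'g" where
  "Th N u y = (\<Sum>k<N. th k u y)"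

lemma Th_add: "Th N (\<lambda>y. u y + v y) y = Th N u y + Th N v y"
  and Th_diff: "Th N (\<lambda>y. u y - v y) y = Th N u y - Th N v y"
  and Th_scale: "Th N (\<lambda>y. scale c (u y)) y = scale c (Th N u y)"
  by (simp_all add: Th_def th_add th_diff th_scale sum.distrib sum_subtractf scale_sum_right)

lemma Pol_Th: "Pol n u \<Longrightarrow> Pol n (Th N u)"
  unfolding Th_def[abs_def] by (intro Pol_sum Pol_th)

text \<open>Only the term k = 0 contains no bracket with y; all others go one degree deeper. Thus
  \<open>Th N\<close> is the identity plus a degree-raising operator, which yields
  \<open>Th_inj\<close> and the convergence of \<open>Xit\<close>.\<close>

lemma Th_values:
  assumes "N \<ge> 1" "n \<ge> 1" "\<And>y. u y \<in> F n"
  shows "Th N u y - u y \<in> F (Suc n)"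
proof -
  obtain M where M: "N = Suc M" using assms(1) by (cases N) auto
  have "Th N u y - u y = (\<Sum>k<M. th (Suc k) u y)"
    unfolding Th_def M sum.lessThan_Suc_shift by simp
  moreover have "th (Suc k) u y \<in> F (Suc n)" for k
    using th_values[of n u "Suc k"] assms F_mono[of "Suc n" "n + Suc k"] by simp
  ultimately show ?thesis by (simp add: F_sum)
qed

lemma Th_inj:
  assumes "N \<ge> 1" "\<And>y. Th N u y \<in> F N" shows "u y \<in> F N"
proof -
  have "n < N \<Longrightarrow> u y \<in> F (Suc n)" for n y
  proof (induction n arbitrary: y)
    case 0
    then show ?case using F_1 by simp
  next
    case (Suc n)
    have "Th N u y - u y \<in> F (Suc (Suc n))"
      by (rule Th_values) (use Suc in auto)
    moreover have "Th N u y \<in> F (Suc (Suc n))"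
      using assms(2) Suc.prems F_mono[of "Suc (Suc n)" N] by auto
    ultimately show ?case
      using F_diff[of "Suc (Suc n)" "Th N u y" "Th N u y - u y"] by simp
  qed
  from this[of "N - 1" y] show ?thesis using assms(1) by simp
qed

text \<open>Structure equation of the left invariant form, evaluated on the fields \<open>h\<close>
  and \<open>u\<close>, whose bracket is \<open>D h u - D u h\<close>. Summing the coefficient
  identities gives the bracket term over a triangle, and the truncated form needs the full
  square.\<close>

lemma maurer_cartan:
  assumes h: "Pol a h" and u: "Pol b u" and N: "N \<ge> 1"
  shows "D h (Th N u) y - D u (Th N h) y - Th N (\<lambda>y. D h u y - D u h y) y + br (Th N h y) (Th N u y) \<in> F N"
proof -
  obtain M where M: "N = Suc M" using N by (cases N) auto
  let ?c = "\<lambda>i j. br (th i h y) (th j u y)"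
  have dth: "(\<Sum>m<N. dth m h u y) = D h (Th N u) y - Th N (D h u) y" if "Pol b u" for h u b
    unfolding dth_def Th_def[abs_def] sum_subtractf
    by (subst D_sum[of _ b]) (auto intro: Pol_th that)
  have "(\<Sum>m<N. \<Sum>i<m. ?c i (m - Suc i)) = (\<Sum>k<M. \<Sum>i\<le>k. ?c i (k - i))"
    unfolding M by (subst sum.lessThan_Suc_shift) (simp add: lessThan_Suc_atMost del: sum.lessThan_Suc)
  moreover have "(\<Sum>m<N. dth m h u y - dth m u h y + (\<Sum>i<m. ?c i (m - Suc i))) = 0"
    using maurer_cartan_coeff[OF h u] by simp
  ultimately have 1: "D h (Th N u) y - D u (Th N h) y - Th N (\<lambda>y. D h u y - D u h y) y = - (\<Sum>k<M. \<Sum>i\<le>k. ?c i (k - i))"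
    unfolding sum.distrib sum_subtractf dth[OF u] dth[OF h] Th_diff
    by (simp add: algebra_simps eq_neg_iff_add_eq_0)
  \<comment> \<open>Starting from \<open>F 1\<close>, each bracket with y adds a degree, so the term
    lies in \<open>F (i + j + 2)\<close>, and \<open>N\<close> is \<open>M + 1\<close>.\<close>
  have "?c i j \<in> F N" if "M \<le> i + j" for i j
  proof -
    have "th i h y \<in> F (1 + i)" "th j u y \<in> F (1 + j)"
      using th_values[of 1] F_1 by auto
    then have "?c i j \<in> F (1 + i + (1 + j))"
      by (intro F_br) auto
    then show ?thesis using that F_mono[of N "1 + i + (1 + j)"] M by simp
  qed
  then have "(\<Sum>k<M. \<Sum>i\<le>k. ?c i (k - i)) - (\<Sum>i<N. \<Sum>j<N. ?c i j) \<in> F N"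
    using F_subspace[OF N] M by (intro triangle_subspace) auto
  then have "- ((\<Sum>k<M. \<Sum>i\<le>k. ?c i (k - i)) - (\<Sum>i<N. \<Sum>j<N. ?c i j)) \<in> F N"
    using N by (rule F_uminus[rotated])
  moreover have "br (Th N h y) (Th N u y) = (\<Sum>i<N. \<Sum>j<N. ?c i j)"
    unfolding Th_def br_sum_left br_sum_right by (rule sum.swap)
  ultimately show ?thesis unfolding 1 by (simp add: algebra_simps)
qed

text \<open>Modulo \<open>F N\<close>, the iterates converge to the left invariant vector field with value $z$.\<close>

primrec Xit :: "nat \<Rightarrow> nat \<Rightarrow> 'g \<Rightarrow> 'g \<Rightarrow> 'g" where
  "Xit N 0 z = (\<lambda>_. z)"
| "Xit N (Suc n) z = (\<lambda>y. z + (Xit N n z y - Th N (Xit N n z) y))"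

lemma Pol_Xit: "m \<ge> 1 \<Longrightarrow> z \<in> F m \<Longrightarrow> Pol m (Xit N n z)"
  by (induction n) (auto intro!: Pol.const Pol.add Pol_diff Pol_Th)

lemma Xit_add: "Xit N n (z + w) y = Xit N n z y + Xit N n w y"
proof (induction n arbitrary: y)
  case (Suc n)
  then have "Xit N n (z + w) = (\<lambda>y. Xit N n z y + Xit N n w y)" by blast
  then show ?case by (simp add: Th_add)
qed simp

lemma Xit_scale: "Xit N n (scale c z) y = scale c (Xit N n z y)"
proof (induction n arbitrary: y)
  case (Suc n)
  then have "Xit N n (scale c z) = (\<lambda>y. scale c (Xit N n z y))" by blast
  then show ?case by (simp add: Th_scale scale_right_distrib scale_right_diff_distrib)
qed simp

text \<open>If e is the current defect, adding e to the field leaves the new defect e - Th e, which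
  is one degree deeper by \<open>Th_values\<close>.\<close>

lemma Xit_values: "N \<ge> 1 \<Longrightarrow> z - Th N (Xit N n z) y \<in> F (Suc n)"
proof (induction n arbitrary: y)
  case 0
  then show ?case using F_1 by simp
next
  case (Suc n)
  let ?e = "\<lambda>y. z - Th N (Xit N n z) y"
  have "Xit N (Suc n) z = (\<lambda>y. Xit N n z y + ?e y)" by (simp add: algebra_simps)
  then have "z - Th N (Xit N (Suc n) z) y = - (Th N ?e y - ?e y)"
    by (simp only: Th_add) (simp add: algebra_simps)
  moreover have "Th N ?e y - ?e y \<in> F (Suc (Suc n))"
    by (rule Th_values) (use Suc in auto)
  ultimately show ?case
    by (simp only: F_uminus)
qed

text \<open>At the origin every bracket with y is zero, so the form is the identity there and the
  field keeps its value through all iterations.\<close>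

lemma Xit_at_0: "N \<ge> 1 \<Longrightarrow> Xit N n z 0 = z"
proof (induction n)
  case (Suc n)
  obtain M where "N = Suc M" using Suc.prems by (cases N) auto
  then have "Th N u 0 = u 0" for u
    unfolding Th_def by (simp add: sum.lessThan_Suc_shift th_at_0 del: sum.lessThan_Suc th.simps(2))
  then show ?case using Suc by simp
qed simp

definition X :: "nat \<Rightarrow> 'g \<Rightarrow> 'g \<Rightarrow> 'g" where "X N = Xit N N"

lemma Pol_X: "Pol 0 (X N z)"
  unfolding X_def by (rule Pol.mono[OF Pol_Xit[of 1]]) (simp_all add: F_1[unfolded One_nat_def])

lemma X_Th: "N \<ge> 1 \<Longrightarrow> Th N (X N z) y - z \<in> F N"
  using Xit_values[of N z N y] F_Suc[of N] F_scale[of N "z - Th N (X N z) y" "- 1"] by (auto simp: X_def)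

text \<open>On \<open>X N z\<close> and \<open>X N w\<close> the form is constant modulo
  \<open>F N\<close>, so its derivatives drop out of \<open>maurer_cartan\<close>. What remains says
  that the bracket of the fields has form value \<open>br z w\<close>, which is also that of
  \<open>X N (br z w)\<close>; \<open>Th_inj\<close> concludes.\<close>

lemma X_br:
  assumes N: "N \<ge> 1"
  shows "X N (br z w) y - (D (X N z) (X N w) y - D (X N w) (X N z) y) \<in> F N"
proof (rule Th_inj[OF N, where u = "\<lambda>y. X N (br z w) y - (D (X N z) (X N w) y - D (X N w) (X N z) y)"])
  fix y
  let ?h = "X N z" and ?u = "X N w"
  have *: "D h (Th N (X N z)) y \<in> F N" for h z
  proof -
    have "D h (\<lambda>y. Th N (X N z) y - z) y \<in> F N"
      by (rule D_values[OF Pol_diff[OF Pol_Th[OF Pol_X] Pol_const] N]) (rule X_Th[OF N])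
    then show ?thesis
      by (simp add: D_diff[OF Pol_Th[OF Pol_X] Pol_const] D_const)
  qed
  have b: "br (Th N ?h y) (Th N ?u y) - br z w \<in> F N"
  proof -
    have "br (Th N ?h y) (Th N ?u y) - br z w = br (Th N ?h y - z) (Th N ?u y) + br z (Th N ?u y - w)"
      by (simp add: br_diff_left br_diff_right)
    then show ?thesis using X_Th[OF N] N by (simp add: F_add F_br_ideal)
  qed
  let ?L = "Th N (\<lambda>y. D ?h ?u y - D ?u ?h y) y"
  have mc: "D ?h (Th N ?u) y - D ?u (Th N ?h) y - ?L + br (Th N ?h y) (Th N ?u y) \<in> F N"
    by (rule maurer_cartan[OF Pol_X Pol_X N])
  have "(D ?h (Th N ?u) y - D ?u (Th N ?h) y - ?L + br (Th N ?h y) (Th N ?u y)) -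
     (D ?h (Th N ?u) y - D ?u (Th N ?h) y) - (br (Th N ?h y) (Th N ?u y) - br z w) +
     (Th N (X N (br z w)) y - br z w) \<in> F N"
    by (rule F_add[OF N F_diff[OF N F_diff[OF N mc F_diff[OF N * *]] b] X_Th[OF N]])
  then show "Th N (\<lambda>y. X N (br z w) y - (D ?h ?u y - D ?u ?h y)) y \<in> F N"
    by (simp only: Th_diff) (simp add: algebra_simps)
qed

section \<open>The action of words on Lie polynomial maps\<close>

primrec act :: "nat \<Rightarrow> 'g list \<Rightarrow> ('g \<Rightarrow> 'g) \<Rightarrow> 'g \<Rightarrow> 'g" where
  "act N [] f = f"
| "act N (z # w) f = D (X N z) (act N w f)"

lemma act_append: "act N (u @ v) f = act N u (act N v f)"
  by (induction u) simp_all

lemma Pol_act: "Pol n f \<Longrightarrow> Pol n (act N w f)"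
  by (induction w) (use Pol_D[OF Pol_X] in fastforce)+

lemma act_diff: "Pol m f \<Longrightarrow> Pol n g \<Longrightarrow> act N w (\<lambda>y. f y - g y) y = act N w f y - act N w g y"
proof (induction w arbitrary: y)
  case (Cons z w)
  then have "act N w (\<lambda>y. f y - g y) = (\<lambda>y. act N w f y - act N w g y)" by blast
  then show ?case using Cons by (simp add: D_diff[OF Pol_act Pol_act])
qed simp

lemma act_scale: "Pol m f \<Longrightarrow> act N w (\<lambda>y. scale c (f y)) y = scale c (act N w f y)"
proof (induction w arbitrary: y)
  case (Cons z w)
  then have "act N w (\<lambda>y. scale c (f y)) = (\<lambda>y. scale c (act N w f y))" by blast
  then show ?case using Cons by (simp add: D_scale[OF Pol_act])
qed simp

lemma act_values: "N \<ge> 1 \<Longrightarrow> Pol n f \<Longrightarrow> (\<And>y. f y \<in> F N) \<Longrightarrow> act N w f y \<in> F N"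
proof (induction w arbitrary: y)
  case (Cons z w)
  then show ?case using D_values[OF Pol_act[OF Cons.prems(2)] Cons.prems(1)] by simp
qed simp

text \<open>A word acts by its vector fields on the identity map, and the result is evaluated at the
  origin. On a single letter this returns the letter, because \<open>X N z\<close> has value z
  there.\<close>

definition Lam :: "nat \<Rightarrow> ('g,'k) falg \<Rightarrow> 'g" where
  "Lam N = lext scale (\<lambda>w. act N w (\<lambda>y. y) 0)"

lemma Lam_W: "Lam N (W w) = act N w (\<lambda>y. y) 0"
  by (simp add: Lam_def lext_W)

lemma Lam_diff: "Lam N (a - b) = Lam N a - Lam N b"
  and Lam_add: "Lam N (a + b) = Lam N a + Lam N b"
  and Lam_sc: "Lam N (sc c a) = scale c (Lam N a)"
  by (simp_all add: Lam_def lext_diff lext_add lext_sc)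

text \<open>The letters of \<open>v\<close> act first and only change the polynomial map
  \<open>?f\<close>; the relation annihilates it modulo \<open>F N\<close>; the letters of
  \<open>u\<close> act afterwards and preserve maps with values in \<open>F N\<close>.\<close>

lemma Lam_env_gens:
  assumes N: "N \<ge> 1" and x: "x \<in> env_gens"
  shows "Lam N x \<in> F N"
proof -
  obtain u r v where x: "x = W u * r * W v" and r: "r \<in> env_rel"
    using x unfolding env_gens_def by auto
  let ?f = "act N v (\<lambda>y. y)"
  have f: "Pol 0 ?f" by (rule Pol_act[OF Pol.ident])
  have P: "Pol 0 (D (X N z) ?f)" "Pol 0 (D (X N z) (D (X N w) ?f))" for z w
    using Pol_D[OF Pol_X f] Pol_D[OF Pol_X Pol_D[OF Pol_X f]] by simp_all
  have word1: "Lam N (W u * gen z * W v) = act N u (D (X N z) ?f) 0" for z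
    by (simp add: Lam_W act_append gen_def flip: W_append)
  have word2: "Lam N (W u * gen z * gen w * W v) = act N u (D (X N z) (D (X N w) ?f)) 0" for z w
    by (simp add: Lam_W act_append gen_def flip: W_append)
  consider z w where "r = gen (z + w) - gen z - gen w" | c z where "r = gen (scale c z) - sc c (gen z)"
    | z w where "r = gen z * gen w - gen w * gen z - gen (br z w)"
    using r unfolding env_rel_def lin_rel_def by auto
  then show ?thesis
  proof cases
    case 1
    have "X N (z + w) = (\<lambda>y. X N z y + X N w y)" by (simp add: X_def Xit_add fun_eq_iff)
    then have "D (X N (z + w)) ?f y - D (X N z) ?f y - D (X N w) ?f y = 0" for y
      by (simp add: D_vector_add[OF f])
    then have e: "(\<lambda>y. D (X N (z + w)) ?f y - D (X N z) ?f y - D (X N w) ?f y) = (\<lambda>_. 0)"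
      by blast
    have "act N u (\<lambda>y. D (X N (z + w)) ?f y - D (X N z) ?f y - D (X N w) ?f y) 0 \<in> F N"
      unfolding e by (rule act_values[OF N Pol_zero[of 0]]) (use N in simp)
    then show ?thesis
      unfolding x 1
      by (simp add: left_diff_distrib right_diff_distrib mult.assoc[symmetric] Lam_diff word1 act_diff[OF Pol_diff[OF P(1) P(1)] P(1)] act_diff[OF P(1) P(1)])
  next
    case 2
    have "X N (scale c z) = (\<lambda>y. scale c (X N z y))" by (simp add: X_def Xit_scale fun_eq_iff)
    then have "D (X N (scale c z)) ?f y = scale c (D (X N z) ?f y)" for y
      by (simp add: D_vector_scale[OF f])
    then have "D (X N (scale c z)) ?f = (\<lambda>y. scale c (D (X N z) ?f y))" by blast
    then show ?thesis
      unfolding x 2 using N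
      by (simp add: left_diff_distrib right_diff_distrib mult.assoc[symmetric] sc_mult_left sc_mult_right Lam_diff Lam_sc word1 act_scale[OF P(1)])
  next
    case 3
    let ?c = "\<lambda>y. D (X N z) (X N w) y - D (X N w) (X N z) y"
    let ?g = "\<lambda>y. D (X N z) (D (X N w) ?f) y - D (X N w) (D (X N z) ?f) y - D (X N (br z w)) ?f y"
    have "?g y \<in> F N" for y
    proof -
      have "D (\<lambda>y. X N (br z w) y - ?c y) ?f y \<in> F N"
        by (rule D_vector_values[OF f N X_br[OF N]])
      then have "- (D (\<lambda>y. X N (br z w) y - ?c y) ?f y) \<in> F N"
        using F_subspace[OF N] subspace_neg by blast
      then show ?thesis
        by (simp add: D_commutator[OF Pol_X Pol_X f] D_vector_diff[OF f])
    qed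
    then have "act N u ?g 0 \<in> F N"
      by (intro act_values[OF N Pol_diff[OF Pol_diff[OF P(2) P(2)] P(1)]])
    then show ?thesis
      unfolding x 3
      by (simp add: left_diff_distrib right_diff_distrib mult.assoc[symmetric] Lam_diff word1 word2
          act_diff[OF Pol_diff[OF P(2) P(2)] P(1)] act_diff[OF P(2) P(2)])
  qed
qed

text \<open>A factor of weight 0 may take any value at the origin, but bracketing with it keeps the
  other factor inside the ideal \<open>F n\<close>. The bare variable, of weight 0, is excluded by
  \<open>n \<ge> 1\<close>.\<close>

lemma Pol_at_0: "Pol n f \<Longrightarrow> n \<ge> 1 \<Longrightarrow> f 0 \<in> F n"
proof (induction rule: Pol.induct)
  case (bracket m f n g)
  consider "m \<ge> 1" "n \<ge> 1" | "m = 0" | "n = 0" by linarith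
  then show ?case
  proof cases
    case 1 then show ?thesis using bracket by (intro F_br) auto
  next
    case 2 then show ?thesis using bracket F_br_ideal(2)[of n] by simp
  next
    case 3 then show ?thesis using bracket F_br_ideal(1)[of m] by simp
  qed
next
  case (mono n f m)
  then show ?case using F_mono[of m n] by simp
qed (simp_all add: F_add F_scale)

lemma Pol_act_weights: "weights w ns \<Longrightarrow> Pol (sum_list ns) (act N w (\<lambda>y. y))"
proof (induction w arbitrary: ns)
  case Nil
  then show ?case by (simp add: weights_def Pol.ident)
next
  case (Cons z w)
  then obtain n ms where "ns = n # ms" "1 \<le> n" "z \<in> F n" "weights w ms"
    by (auto simp: weights_def list_all2_Cons1)
  then show ?case using Pol_D[OF Pol_Xit[of n z N N] Cons.IH] by (simp add: X_def)
qed

text \<open>\<open>Lam N\<close> sends both kinds of generators of \<open>J N\<close> into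
  \<open>F N\<close>, the relations by invariance of the fields and the words by their weight, and
  it sends \<open>gen z\<close> to z.\<close>

theorem gen_J_imp_F:
  assumes N: "N \<ge> 1" and z: "gen z \<in> J N" shows "z \<in> F N"
proof -
  have "Lam N a \<in> F N" if "a \<in> J N" for a
    using that unfolding J_def
  proof (induction rule: A.span_induct_alt)
    case base
    then show ?case using N by (simp add: Lam_def)
  next
    case (step c x y)
    have "Lam N x \<in> F N"
    proof (cases "x \<in> env_gens")
      case True then show ?thesis by (rule Lam_env_gens[OF N])
    next
      case False
      then obtain w ns where x: "x = W w" and w: "weights w ns" "N \<le> sum_list ns"
        using step(1) unfolding WW_def by auto
      then have "Pol N (act N w (\<lambda>y. y))"
        using Pol.mono Pol_act_weights by blast
      then show ?thesis unfolding x Lam_W using N by (rule Pol_at_0)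
    qed
    then show ?case using step(2) N by (simp add: Lam_add Lam_sc F_add F_scale)
  qed
  moreover have "Lam N (gen z) = z"
    using Xit_at_0[OF N] by (simp add: gen_def Lam_W D_ident X_def)
  ultimately show ?thesis using z by metis
qed

end

subsection \<open>The Baker-Campbell-Hausdorff theorem\<close>

text \<open>Filtration by word length. Every letter has weight at least 1, so \<open>tail n\<close>
  lies in \<open>J n\<close> and a congruence found in the free algebra transfers to U(g).\<close>

definition tail :: "nat \<Rightarrow> ('g,'k::field) falg set" where
  "tail n = A.span {W w |w. n \<le> length w}"

interpretation T: filtered_algebra "sc :: 'k::field_char_0 \<Rightarrow> ('g,'k) falg \<Rightarrow> ('g,'k) falg" tail
proof unfold_locales
  show "sc c a * b = sc c (a * b)" "a * sc c b = sc c (a * b)" for c and a b :: "('g,'k) falg"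
    by (simp_all add: sc_mult_left sc_mult_right)
  have "a \<in> tail 0" for a :: "('g,'k) falg"
    unfolding tail_def by (induction a rule: falg_induct) (auto intro: A.span_zero A.span_add A.span_scale A.span_base)
  then show "(tail 0 :: ('g,'k) falg set) = UNIV" by blast
  show "tail (Suc n) \<subseteq> (tail n :: ('g,'k) falg set)" for n
    unfolding tail_def by (rule A.span_mono) auto
  show "A.subspace (tail n :: ('g,'k) falg set)" for n
    unfolding tail_def by simp
  fix a b :: "('g,'k) falg" and m n assume "a \<in> tail m" "b \<in> tail n"
  then show "a * b \<in> tail (m + n)"
    unfolding tail_def
  proof (rule span_mult)
    fix x y :: "('g,'k) falg" assume "x \<in> {W w |w. m \<le> length w}" "y \<in> {W w |w. n \<le> length w}"
    then obtain u v where "x * y = W (u @ v)" "m + n \<le> length (u @ v)"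
      by (auto simp: W_append)
    then show "x * y \<in> A.span {W w |w. m + n \<le> length w}"
      by (intro A.span_base) blast
  qed
qed

lemma gen_tail: "gen x \<in> tail 1"
  unfolding tail_def gen_def by (rule A.span_base) auto

text \<open>Derivation that multiplies a word by its length; it plays the part of differentiating in
  t after rescaling each letter x to t x.\<close>

definition euler :: "('g,'k::field) falg \<Rightarrow> ('g,'k) falg" where
  "euler = lext sc (\<lambda>w. sc (of_nat (length w)) (W w))"

lemma euler_W: "euler (W w) = sc (of_nat (length w)) (W w)"
  and euler_zero [simp]: "euler 0 = 0"
  and euler_add: "euler (a + b) = euler a + euler b"
  and euler_diff: "euler (a - b) = euler a - euler b"
  and euler_sc: "euler (sc c a) = sc c (euler a)"
  by (simp_all add: euler_def A.lext_W A.lext_add A.lext_diff A.lext_sc)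

lemma euler_gen: "euler (gen x) = gen x"
  by (simp add: gen_def euler_W)

lemma euler_mult: "euler (a * b) = euler a * b + a * euler b"
proof (induction a rule: falg_induct)
  case (word c u)
  show ?case
  proof (induction b rule: falg_induct)
    case (word d v)
    show ?case
      by (simp add: sc_mult_left sc_mult_right euler_sc euler_W A.scale_left_distrib algebra_simps flip: W_append)
  qed (auto simp: euler_add algebra_simps)
qed (auto simp: euler_add algebra_simps)

lemma euler_tail_diff:
  assumes "a \<in> tail n" shows "euler a - sc (of_nat n) a \<in> tail (Suc n)"
  using assms unfolding tail_def
proof (induction rule: A.span_induct_alt)
  case base
  then show ?case by (simp add: A.span_zero)
next
  case (step c x y)
  then obtain w where x: "x = W w" "n \<le> length w" by auto
  have "euler x - sc (of_nat n) x \<in> A.span {W w |w. Suc n \<le> length w}"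
  proof (cases "n = length w")
    case True
    then show ?thesis by (simp add: x euler_W A.span_zero)
  next
    case False
    then show ?thesis
      unfolding x(1) euler_W by (intro A.span_diff A.span_scale A.span_base) (use x(2) in auto)
  qed
  then have "sc c (euler x - sc (of_nat n) x) + (euler y - sc (of_nat n) y) \<in> A.span {W w |w. Suc n \<le> length w}"
    using step(2) by (intro A.span_add A.span_scale)
  then show ?case by (simp add: euler_add euler_sc algebra_simps)
qed

lemma euler_tail:
  fixes a :: "('g,'k::field_char_0) falg"
  assumes a: "a \<in> tail n" shows "euler a \<in> tail n"
  using T.J_add[OF subsetD[OF T.J_Suc euler_tail_diff[OF a]] T.J_scale[OF a, of "of_nat n"]] by simp

section \<open>Lie elements and the recursion for the logarithm\<close>

inductive_set lie_elems :: "('g,'k::field) falg set" where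
  gen: "gen x \<in> lie_elems"
| add: "a \<in> lie_elems \<Longrightarrow> b \<in> lie_elems \<Longrightarrow> a + b \<in> lie_elems"
| sc: "a \<in> lie_elems \<Longrightarrow> sc c a \<in> lie_elems"
| commutator: "a \<in> lie_elems \<Longrightarrow> b \<in> lie_elems \<Longrightarrow> a * b - b * a \<in> lie_elems"

lemma lie_elems_zero: "0 \<in> lie_elems"
  using lie_elems.sc[OF lie_elems.gen, of 0] by simp

lemma lie_elems_diff: "a \<in> lie_elems \<Longrightarrow> b \<in> lie_elems \<Longrightarrow> a - b \<in> lie_elems"
  using lie_elems.add[OF _ lie_elems.sc[of b "- 1"], of a] by simp

lemma lie_elems_sum: "(\<And>i. i \<in> S \<Longrightarrow> f i \<in> lie_elems) \<Longrightarrow> sum f S \<in> lie_elems"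
  by (induction S rule: infinite_finite_induct) (auto intro: lie_elems.add lie_elems_zero)

lemma lie_elems_euler: "a \<in> lie_elems \<Longrightarrow> euler a \<in> lie_elems"
proof (induction rule: lie_elems.induct)
  case (commutator a b)
  have "euler (a * b - b * a) = (euler a * b - b * euler a) + (a * euler b - euler b * a)"
    by (simp add: euler_diff euler_mult algebra_simps)
  then show ?case
    using commutator lie_elems.add lie_elems.commutator by metis
qed (auto simp: euler_gen euler_add euler_sc intro: lie_elems.intros)

abbreviation rad :: "'a::ring_1 \<Rightarrow> 'a \<Rightarrow> 'a" where "rad z h \<equiv> h * z - z * h"

lemma lie_elems_rad: "s \<in> lie_elems \<Longrightarrow> w \<in> lie_elems \<Longrightarrow> (rad s ^^ k) w \<in> lie_elems"
  by (induction k) (auto intro: lie_elems.commutator)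

lemma rad_tail:
  fixes z w :: "('g,'k::field_char_0) falg"
  shows "z \<in> tail 1 \<Longrightarrow> w \<in> tail 1 \<Longrightarrow> (rad z ^^ k) w \<in> tail 1"
  by (induction k) (auto intro: T.J_diff T.J_mult_left T.J_mult_right)

text \<open>Each application of \<open>rad\<close> multiplies the current difference by z, or a
  factor from \<open>tail 1\<close> by \<open>z - s\<close>. Hence one application already gains a
  degree.\<close>

lemma rad_cong:
  fixes z s w w' :: "('g,'k::field_char_0) falg"
  assumes "z \<in> tail 1" "s \<in> tail 1" "w \<in> tail 1" "w' \<in> tail 1" "z - s \<in> tail n" "w - w' \<in> tail n"
  shows "(rad z ^^ k) w - (rad s ^^ k) w' \<in> tail n"
    and "(rad z ^^ Suc k) w - (rad s ^^ Suc k) w' \<in> tail (Suc n)"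
proof -
  have step: "(rad z ^^ Suc k) w - (rad s ^^ Suc k) w' \<in> tail (Suc n)"
    if "(rad z ^^ k) w - (rad s ^^ k) w' \<in> tail n" for k
  proof -
    let ?u = "(rad z ^^ k) w" and ?v = "(rad s ^^ k) w'"
    have v: "?v \<in> tail 1" by (rule rad_tail[OF assms(2,4)])
    have "(?u - ?v) * z - z * (?u - ?v) + (?v * (z - s) - (z - s) * ?v) \<in> tail (Suc n)"
      using T.J_mult[OF that assms(1)] T.J_mult[OF assms(1) that] T.J_mult[OF v assms(5)] T.J_mult[OF assms(5) v]
      by (intro T.J_add T.J_diff) simp_all
    then show ?thesis by (simp add: algebra_simps)
  qed
  show 1: "(rad z ^^ k) w - (rad s ^^ k) w' \<in> tail n" for k
  proof (induction k)
    case (Suc k)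
    then show ?case using step T.J_Suc[of n] by blast
  qed (use assms in simp)
  show "(rad z ^^ Suc k) w - (rad s ^^ Suc k) w' \<in> tail (Suc n)"
    by (rule step[OF 1])
qed

lemma ex_commute:
  fixes z :: "('g,'k::field_char_0) falg"
  shows "z * T.ex N z = T.ex N z * z"
  unfolding T.ex_def sum_distrib_left sum_distrib_right
  by (intro sum.cong refl) (simp add: T.ep_def sc_mult_left sc_mult_right power_commutes)

lemma euler_ex_gen:
  "T.eqv N (euler (T.ex (Suc N) (gen x))) (gen x * T.ex N (gen x :: ('g,'k::field_char_0) falg))"
proof (cases N)
  case (Suc M)
  let ?x = "gen x :: ('g,'k) falg"
  have z: "(rad ?x ^^ Suc k) ?x = 0" for k
    by (induction k) simp_all
  have "(\<Sum>k<N. T.dex ?x ?x k) = ?x"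
    unfolding Suc sum.lessThan_Suc_shift T.dex_def z by simp
  then show ?thesis
    using T.derivation_ex[of euler ?x N, OF euler_mult euler_sc euler_add gen_tail]
    by (simp add: euler_gen ex_commute)
qed simp

text \<open>The logarithm $z$ of $e^x e^y$ satisfies
  $\frac{1 - e^{-\mathrm{ad} z}}{\mathrm{ad} z} (D z) = e^{-z} x e^z + y$ for the Euler derivation $D$.
  This determines the homogeneous components of $z$ recursively by iterated commutators.\<close>

lemma bch_equation:
  fixes x y :: 'g and z :: "('g,'k::field_char_0) falg"
  assumes z: "z \<in> tail 1"
    and ez: "T.eqv (Suc N) (T.ex (Suc N) z) (T.ex (Suc N) (gen x) * T.ex (Suc N) (gen y))"
  shows "T.eqv N (\<Sum>k<N. T.dex z (euler z) k) ((\<Sum>k<N. sc (1 / fact k) ((rad z ^^ k) (gen x))) + gen y)"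
proof -
  let ?x = "gen x :: ('g,'k) falg" and ?y = "gen y :: ('g,'k) falg"
  let ?th = "\<Sum>k<N. T.dex z (euler z) k"
  have trunc: "T.eqv N (T.ex (Suc N) u) (T.ex N u)" if "u \<in> tail 1" for u :: "('g,'k) falg"
    by (rule T.ex_truncate[OF that]) simp
  have e: "T.eqv N (T.ex N z) (T.ex N ?x * T.ex N ?y)"
  proof -
    have "T.eqv N (T.ex N z) (T.ex (Suc N) z)"
      by (rule T.eqv_sym[OF trunc[OF z]])
    also have "T.eqv N \<dots> (T.ex (Suc N) ?x * T.ex (Suc N) ?y)"
      by (rule T.eqv_mono[OF _ ez]) simp
    also have "T.eqv N \<dots> (T.ex N ?x * T.ex N ?y)"
      by (intro T.eqv_mult trunc gen_tail)
    finally show ?thesis .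
  qed
  have "T.eqv N (T.ex N z * ?th) (euler (T.ex (Suc N) z))"
    by (rule T.eqv_sym[OF T.derivation_ex[of euler z N, OF euler_mult euler_sc euler_add z]])
  also have "T.eqv N \<dots> (euler (T.ex (Suc N) ?x * T.ex (Suc N) ?y))"
    using euler_tail[OF ez[unfolded T.eqv_def]] T.J_Suc[of N] by (auto simp: T.eqv_def euler_diff)
  also have "euler (T.ex (Suc N) ?x * T.ex (Suc N) ?y) =
     euler (T.ex (Suc N) ?x) * T.ex (Suc N) ?y + T.ex (Suc N) ?x * euler (T.ex (Suc N) ?y)"
    by (rule euler_mult)
  also have "T.eqv N \<dots> (?x * T.ex N ?x * T.ex N ?y + T.ex N ?x * (?y * T.ex N ?y))"
    by (intro T.eqv_add T.eqv_mult euler_ex_gen trunc gen_tail)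
  also have "\<dots> = ?x * (T.ex N ?x * T.ex N ?y) + (T.ex N ?x * T.ex N ?y) * ?y"
    by (simp only: ex_commute[of ?y N] mult.assoc)
  also have "T.eqv N \<dots> (?x * T.ex N z + T.ex N z * ?y)"
    by (intro T.eqv_add T.eqv_mult T.eqv_refl T.eqv_sym[OF e])
  finally have "T.eqv N (T.ex N (- z) * (T.ex N z * ?th)) (T.ex N (- z) * (?x * T.ex N z + T.ex N z * ?y))"
    by (intro T.eqv_mult T.eqv_refl)
  then have 1: "T.eqv N (T.ex N (- z) * T.ex N z * ?th)
      (T.ex N (- z) * ?x * T.ex N z + T.ex N (- z) * T.ex N z * ?y)"
    by (simp add: algebra_simps)
  have inv: "T.eqv N (T.ex N (- z) * T.ex N z * u) u" for u
    using T.eqv_mult[OF T.ex_inverse'[OF z, of N] T.eqv_refl[of N u]] by simp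
  have "T.eqv N ?th (T.ex N (- z) * T.ex N z * ?th)"
    by (rule T.eqv_sym[OF inv])
  also note 1
  also have "T.eqv N (T.ex N (- z) * ?x * T.ex N z + T.ex N (- z) * T.ex N z * ?y)
     ((\<Sum>k<N. sc (1 / fact k) ((rad z ^^ k) ?x)) + ?y)"
  proof (rule T.eqv_add[OF _ inv])
    have "(\<lambda>h. - z * h - h * - z) = rad z" by (auto simp: fun_eq_iff)
    then show "T.eqv N (T.ex N (- z) * ?x * T.ex N z) (\<Sum>k<N. sc (1 / fact k) ((rad z ^^ k) ?x))"
      using T.ex_two_sided[OF T.J_uminus[OF z] T.J_uminus[OF z], of N ?x] by (simp add: T.eqv_sym)
  qed
  finally show ?thesis .
qed

lemma bch_lie:
  fixes x y :: 'g and z :: "('g,'k::field_char_0) falg"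
  assumes z: "z \<in> tail 1"
    and ez: "T.eqv (Suc N) (T.ex (Suc N) z) (T.ex (Suc N) (gen x) * T.ex (Suc N) (gen y))"
  shows "n < N \<Longrightarrow> \<exists>s\<in>lie_elems. z - s \<in> tail (Suc n)"
proof (induction n)
  case 0
  then show ?case using z by (intro bexI[OF _ lie_elems_zero]) simp
next
  case (Suc n')
  define n where "n = Suc n'"
  obtain s where s: "s \<in> lie_elems" and r: "z - s \<in> tail n"
    using Suc unfolding n_def by auto
  have n: "n \<ge> 1" "Suc n \<le> N" using Suc.prems by (auto simp: n_def)
  obtain M where M: "N = Suc M" using n by (cases N) auto
  let ?x = "gen x :: ('g,'k) falg"
  have s1: "s \<in> tail 1"
    using T.J_diff[OF z T.J_mono[OF n(1) r]] by simp
  let ?L = "\<lambda>z k. T.dex z (euler z) (Suc k)" and ?M = "\<lambda>z k. sc (1 / fact (Suc k)) ((rad z ^^ Suc k) ?x)"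
  \<comment> \<open>The equation is solved for its k = 0 term, which is \<open>euler z\<close>, and
    z is then replaced by s. All terms that change contain at least one \<open>rad\<close>, so by
    \<open>rad_cong\<close> the replacement is invisible modulo \<open>tail (Suc n)\<close>.\<close>
  define S where "S = ?x + (\<Sum>k<M. ?M s k) + gen y - (\<Sum>k<M. ?L s k)"
  have S: "S \<in> lie_elems"
    unfolding S_def T.dex_def
    by (intro lie_elems_diff lie_elems.add lie_elems_sum lie_elems.sc lie_elems_rad lie_elems.gen lie_elems_euler s)
  have "T.eqv (Suc n) (euler z + (\<Sum>k<M. ?L z k)) (?x + (\<Sum>k<M. ?M z k) + gen y)"
    using T.eqv_mono[OF n(2) bch_equation[OF z ez]]
    unfolding M sum.lessThan_Suc_shift by (simp add: T.dex_def)
  from T.eqv_diff[OF this T.eqv_refl[of "Suc n" "\<Sum>k<M. ?L z k"]]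
  have "T.eqv (Suc n) (euler z) (?x + (\<Sum>k<M. ?M z k) + gen y - (\<Sum>k<M. ?L z k))" by simp
  also have "T.eqv (Suc n) \<dots> S"
    unfolding S_def
  proof (intro T.eqv_diff T.eqv_add T.eqv_sum T.eqv_refl)
    show "T.eqv (Suc n) (?M z k) (?M s k)" for k
      by (intro T.eqv_scale) (unfold T.eqv_def, rule rad_cong(2)[OF z s1 gen_tail gen_tail r], simp)
    show "T.eqv (Suc n) (?L z k) (?L s k)" for k
      unfolding T.dex_def
      by (intro T.eqv_scale, unfold T.eqv_def, rule rad_cong(2)[OF z s1 euler_tail[OF z] euler_tail[OF s1] r])
         (use euler_tail[OF r] in \<open>simp add: euler_diff\<close>)
  qed
  finally have Dz: "euler z - S \<in> tail (Suc n)" unfolding T.eqv_def .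
  let ?q = "S - euler s"
  \<comment> \<open>On \<open>z - s\<close>, which lies in \<open>tail n\<close>, the Euler
    derivation is multiplication by n up to longer words. So n (z - s) agrees with
    \<open>?q\<close>, and division by n gives the next Lie correction of s.\<close>
  have "(euler z - S) - (euler (z - s) - sc (of_nat n) (z - s)) \<in> tail (Suc n)"
    by (rule T.J_diff[OF Dz euler_tail_diff[OF r]])
  then have "sc (of_nat n) (z - s) - ?q \<in> tail (Suc n)"
    by (simp add: euler_diff algebra_simps)
  then have "sc (1 / of_nat n) (sc (of_nat n) (z - s) - ?q) \<in> tail (Suc n)"
    by (rule T.J_scale)
  moreover have "sc (1 / of_nat n) (sc (of_nat n) (z - s) - ?q) = z - (s + sc (1 / of_nat n) ?q)"
    using n by (simp add: A.scale_right_diff_distrib)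
  moreover have "s + sc (1 / of_nat n) ?q \<in> lie_elems"
    by (intro lie_elems.add lie_elems.sc lie_elems_diff lie_elems_euler s S)
  ultimately show ?case unfolding n_def by metis
qed

text \<open>The three kinds of relations in \<open>I\<close> collapse sums, multiples and
  commutators of single letters into one letter.\<close>

lemma (in lie_alg) lie_elems_gen: "a \<in> lie_elems \<Longrightarrow> \<exists>c. a - gen c \<in> I"
proof (induction rule: lie_elems.induct)
  case (gen x)
  show ?case by (rule exI[of _ x]) simp
next
  case (add a b)
  then obtain c d where cd: "a - gen c \<in> I" "b - gen d \<in> I" by auto
  have "(a - gen c) + (b - gen d) - (gen (c + d) - gen c - gen d) \<in> I"
    by (intro I_diff I_add cd I_gen_add)
  then show ?case by (intro exI[of _ "c + d"]) (simp add: algebra_simps)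
next
  case (sc a k)
  then obtain c where c: "a - gen c \<in> I" by auto
  have "sc k (a - gen c) - (gen (scale k c) - sc k (gen c)) \<in> I"
    by (intro I_diff I_scale c I_gen_scale)
  then show ?case by (intro exI[of _ "scale k c"]) (simp add: algebra_simps)
next
  case (commutator a b)
  then obtain c d where cd: "a - gen c \<in> I" "b - gen d \<in> I" by auto
  have "(a - gen c) * b + gen c * (b - gen d) - (b - gen d) * a - gen d * (a - gen c) +
      (gen c * gen d - gen d * gen c - gen (br c d)) \<in> I"
    by (intro I_diff I_add I_mult_left I_mult_right cd I_gen_br)
  then show ?case by (intro exI[of _ "br c d"]) (simp add: algebra_simps)
qed

context filtered_lie_alg
begin

lemma tail_J: "a \<in> tail n \<Longrightarrow> a \<in> J n"
proof -
  have "A.span {W w |w. n \<le> length w} \<subseteq> J n"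
    by (rule A.span_minimal) (use W_J A.J_subspace in auto)
  then show "a \<in> tail n \<Longrightarrow> a \<in> J n" unfolding tail_def by blast
qed

theorem bch: "\<exists>c. A.eqv N (A.ex N (gen x) * A.ex N (gen y)) (A.ex N (gen c))"
proof (cases N)
  case (Suc n)
  \<comment> \<open>One degree more than in the conclusion: \<open>bch_equation\<close> starts from
    a congruence modulo \<open>tail (Suc N)\<close> and returns one modulo
    \<open>tail N\<close>.\<close>
  let ?E = "T.ex (Suc N) (gen x) * T.ex (Suc N) (gen y) :: ('g,'k) falg"
  have E1: "?E - 1 \<in> tail 1"
  proof -
    have "(T.ex (Suc N) (gen x) - 1) * T.ex (Suc N) (gen y) + (T.ex (Suc N) (gen y) - 1) \<in> (tail 1 :: ('g,'k) falg set)"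
      by (intro T.J_add T.J_mult_right T.ex_J gen_tail) simp_all
    then show ?thesis by (simp add: algebra_simps)
  qed
  define z where "z = T.lg (Suc N) ?E"
  have z: "z \<in> tail 1" unfolding z_def by (rule T.lg_J[OF E1])
  have ez: "T.eqv (Suc N) (T.ex (Suc N) z) ?E" unfolding z_def by (rule T.ex_lg[OF E1])
  obtain s where s: "s \<in> lie_elems" "z - s \<in> tail N"
    using bch_lie[OF z ez, of n] Suc by auto
  obtain c where "s - gen c \<in> I" using lie_elems_gen[OF s(1)] by blast
  then have "(z - s) + (s - gen c) \<in> J N"
    by (intro A.J_add tail_J s(2) I_J)
  then have c: "A.eqv N z (gen c)" by (simp add: A.eqv_def)
  have "A.eqv N (A.ex N (gen x) * A.ex N (gen y)) ?E"
    by (intro A.eqv_mult A.eqv_sym[OF A.ex_truncate] gen_J1) simp_all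
  also have "A.eqv N ?E (A.ex (Suc N) z)"
    using tail_J[OF T.eqv_mono[OF _ T.eqv_sym[OF ez], of N, unfolded T.eqv_def]] by (simp add: A.eqv_def)
  also have "A.eqv N (A.ex (Suc N) z) (A.ex N z)"
    using tail_J[OF z] by (intro A.ex_truncate) simp_all
  also have "A.eqv N (A.ex N z) (A.ex N (gen c))"
    by (rule A.ex_cong[OF c])
  finally show ?thesis by blast
qed simp

end

hide_const (open) Multiset.mult

subsection \<open>The Rota-Baxter operator on group-like elements\<close>

text \<open>Allows the truncation \<open>N\<close> to exceed the degree n of the congruence, as
  happens in component n of a sequence, where the exponential has n + 1 terms.\<close>

lemma (in filtered_algebra) ex_inj_truncated:
  assumes "u \<in> J 1" "v \<in> J 1" "n \<le> N" "eqv n (ex N u) (ex N v)" shows "eqv n u v"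
proof -
  have "eqv n (ex n u) (ex n v)"
    using assms ex_truncate eqv_sym eqv_trans by meson
  then show ?thesis by (rule ex_inj[OF assms(1,2)])
qed

context rb_lie_alg
begin

lemma RR_eqv: "A.eqv n a b \<Longrightarrow> A.eqv n (RR a) (RR b)"
  unfolding A.eqv_def RR_diff[symmetric] by (rule RR_J)

lemma I_eqv: "a - b \<in> I \<Longrightarrow> A.eqv n a b"
  unfolding A.eqv_def by (rule I_J)

lemma gen_add_eqv: "A.eqv n (gen (x + y)) (gen x + gen y)"
  using I_gen_add[of x y] by (intro I_eqv) (simp add: algebra_simps)

lemma gen_uminus_eqv: "A.eqv n (gen (- x)) (- gen x)"
  using I_gen_scale[of "- 1" x] by (intro I_eqv) simp

lemma gen_zero_eqv: "A.eqv n (gen 0) 0"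
  using I_gen_scale[of 0 0] by (intro I_eqv) simp

lemma gen_diff_eqv: "A.eqv n (gen (x - y)) (gen x - gen y)"
  using A.eqv_trans[OF gen_add_eqv[of n x "- y"] A.eqv_add[OF A.eqv_refl gen_uminus_eqv[of n y]]] by simp

lemma RR_twist:
  "A.eqv N (RR (A.ex N (gen w + gen (R w)) * h * A.ex N (- gen (R w)))) (A.ex N (gen (R w)) * RR h)"
proof -
  let ?a = "gen w + gen (R w) :: ('g,'k) falg" and ?b = "gen (R w) :: ('g,'k) falg"
  let ?T = "\<lambda>h. ?a * h - h * ?b" and ?L = "\<lambda>h. gen w * h + der (R w) h"
  \<comment> \<open>The recursion for \<open>RR\<close> involves the derivation
    \<open>der (R w)\<close>, the exponential formula the commutator. They agree only modulo
    \<open>I\<close>, and the error is carried along the powers.\<close>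
  have L: "(?L ^^ k) h - (?T ^^ k) h \<in> I" for k
  proof (induction k)
    case (Suc k)
    let ?u = "(?L ^^ k) h" and ?v = "(?T ^^ k) h"
    have "(der (R w) ?u - (gen (R w) * ?u - ?u * gen (R w))) + (?a * (?u - ?v) - (?u - ?v) * ?b) \<in> I"
      by (intro I_add I_diff I_mult_left I_mult_right der_commutator Suc)
    then show ?case by (simp add: algebra_simps)
  qed simp
  have RL: "RR ((?L ^^ k) h) = ?b ^ k * RR h" for k
    by (induction k) (simp_all add: RR_add RR_gen_mult mult.assoc)
  have "A.eqv N (RR (A.ex N ?a * h * A.ex N (- ?b))) (RR (\<Sum>k<N. sc (1 / fact k) ((?T ^^ k) h)))"
    by (intro RR_eqv A.eqv_sym[OF A.ex_two_sided] A.J_add gen_J1)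
  also have "A.eqv N \<dots> (RR (\<Sum>k<N. sc (1 / fact k) ((?L ^^ k) h)))"
    by (intro RR_eqv A.eqv_sum A.eqv_scale A.eqv_sym[OF I_eqv] L)
  also have "RR (\<Sum>k<N. sc (1 / fact k) ((?L ^^ k) h)) = A.ex N ?b * RR h"
    by (simp add: RR_sum RR_sc RL A.ex_def A.ep_def sum_distrib_right sc_mult_left)
  finally show ?thesis .
qed

text \<open>Writing $e^x = e^{w + R w} e^{- R w}$ amounts to inverting the post-Lie Magnus expansion;
  each step of the iteration below improves the approximation by one filtration degree.\<close>

lemma ex_factor:
  "\<exists>w. A.eqv N (A.ex N (gen w + gen (R w)) * A.ex N (- gen (R w))) (A.ex N (gen x))"
proof (cases "N = 0")
  case False
  have one: "A.eqv 1 (A.ex N u) 1" if "u \<in> J 1" for u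
    using A.ex_J[OF that, of N] False by (simp add: A.eqv_def)
  have "1 \<le> k \<Longrightarrow> k \<le> N \<Longrightarrow>
      \<exists>w. A.eqv k (A.ex N (gen w + gen (R w)) * A.ex N (- gen (R w))) (A.ex N (gen x))" for k
  proof (induction k)
    case (Suc k)
    show ?case
    proof (cases "k = 0")
      case True
      \<comment> \<open>Modulo \<open>J 1\<close> all these exponentials are 1, so
        \<open>w = 0\<close> starts the iteration.\<close>
      have "A.eqv 1 (A.ex N (gen 0 + gen (R 0)) * A.ex N (- gen (R 0))) (1 * 1)"
        by (intro A.eqv_mult one A.J_add A.J_uminus gen_J1)
      also have "A.eqv 1 (1 * 1) (A.ex N (gen x))"
        using A.eqv_sym[OF one[OF gen_J1]] by simp
      finally show ?thesis using True by auto
    next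
      case k0: False
      then have N2: "N \<ge> 2" and k: "k \<ge> 1" using Suc.prems by auto
      obtain w where w: "A.eqv k (A.ex N (gen w + gen (R w)) * A.ex N (- gen (R w))) (A.ex N (gen x))"
        using Suc k0 by auto
      let ?a = "gen w + gen (R w) :: ('g,'k) falg" and ?b = "gen (R w) :: ('g,'k) falg"
      have a1: "?a \<in> J 1" and b1: "- ?b \<in> J 1"
        by (intro A.J_add A.J_uminus gen_J1)+
      \<comment> \<open>Baker-Campbell-Hausdorff writes the current product as e^c with c in g. The
        error is then an element d = x - c of g, to which \<open>R\<close> can be applied.\<close>
      obtain c where "A.eqv N (A.ex N (gen (w + R w)) * A.ex N (gen (- R w))) (A.ex N (gen c))"
        using bch by blast
      moreover have "A.eqv N (A.ex N ?a * A.ex N (- ?b)) (A.ex N (gen (w + R w)) * A.ex N (gen (- R w)))"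
        by (intro A.eqv_mult A.ex_cong A.eqv_sym[OF gen_add_eqv] A.eqv_sym[OF gen_uminus_eqv])
      ultimately have c: "A.eqv N (A.ex N ?a * A.ex N (- ?b)) (A.ex N (gen c))"
        using A.eqv_trans by blast
      have kN: "k \<le> N" using Suc.prems by simp
      have "A.eqv k (A.ex N (gen x)) (A.ex N (gen c))"
        using A.eqv_trans[OF A.eqv_sym[OF w] A.eqv_mono[OF kN c]] .
      then have xc: "A.eqv k (gen x) (gen c)"
        by (rule A.ex_inj_truncated[OF gen_J1 gen_J1 kN])
      define d where "d = x - c"
      have d: "gen d \<in> J k"
        using A.eqv_J[OF gen_diff_eqv[of k x c] order_refl] xc by (simp add: d_def A.eqv_def)
      have Rd: "gen (R d) \<in> J k" using RR_J[OF d] by (simp add: RR_gen)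
      let ?p = "gen d + gen (R d) :: ('g,'k) falg" and ?q = "- gen (R d) :: ('g,'k) falg"
      have p: "?p \<in> J k" and q: "?q \<in> J k"
        using d Rd by (auto intro: A.J_add A.J_uminus)
      have g: "A.eqv m (gen (w + d) + gen (R (w + d))) (?a + ?p)" for m
        using A.eqv_add[OF gen_add_eqv[of m w d] gen_add_eqv[of m "R w" "R d"]] by (simp add: R_add add_ac)
      have g': "A.eqv m (- gen (R (w + d))) (- ?b + ?q)" for m
        using A.eqv_uminus[OF gen_add_eqv[of m "R w" "R d"]] by (simp add: R_add)
      have 1: "A.eqv (Suc k) (A.ex N (gen (w + d) + gen (R (w + d)))) (A.ex N ?a + ?p)"
        using A.eqv_trans[OF A.ex_cong[OF g] A.ex_perturb[OF a1 p k N2]] .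
      have 2: "A.eqv (Suc k) (A.ex N (- gen (R (w + d)))) (A.ex N (- ?b) + ?q)"
        using A.eqv_trans[OF A.ex_cong[OF g'] A.ex_perturb[OF b1 q k N2]] .
      let ?A = "A.ex N ?a" and ?B = "A.ex N (- ?b)"
      \<comment> \<open>To first order the corrections \<open>?p\<close> and \<open>?q\<close> of
        the two factors add up, and the \<open>R d\<close> parts cancel to leave d. Every cross term
        has a further factor in \<open>J 1\<close>.\<close>
      have "(?A - 1) * ?q + ?p * (?B - 1) + ?p * ?q \<in> J (Suc k)"
      proof (intro A.J_add)
        show "(?A - 1) * ?q \<in> J (Suc k)"
          using A.J_mult[OF one[OF a1, unfolded A.eqv_def] q] by (simp only: plus_1_eq_Suc)
        show "?p * (?B - 1) \<in> J (Suc k)"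
          using A.J_mult[OF p one[OF b1, unfolded A.eqv_def]] by (simp only: Suc_eq_plus1)
        show "?p * ?q \<in> J (Suc k)"
          by (rule A.J_mono[OF _ A.J_mult[OF p q]]) (use k in simp)
      qed
      then have 3: "A.eqv (Suc k) ((?A + ?p) * (?B + ?q)) (?A * ?B + gen d)"
        unfolding A.eqv_def by (simp add: algebra_simps)
      have "A.eqv (Suc k) (A.ex N (gen (w + d) + gen (R (w + d))) * A.ex N (- gen (R (w + d)))) (?A * ?B + gen d)"
        by (rule A.eqv_trans[OF A.eqv_mult[OF 1 2] 3])
      also have "A.eqv (Suc k) \<dots> (A.ex N (gen c) + gen d)"
        by (intro A.eqv_add A.eqv_refl A.eqv_mono[OF Suc.prems(2) c])
      also have "A.eqv (Suc k) \<dots> (A.ex N (gen c + gen d))"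
        by (rule A.eqv_sym[OF A.ex_perturb[OF gen_J1 d k N2]])
      also have "A.eqv (Suc k) \<dots> (A.ex N (gen x))"
        using A.ex_cong[OF A.eqv_sym[OF gen_add_eqv[of "Suc k" c d]], of N] by (simp add: d_def)
      finally show ?thesis by blast
    qed
  qed simp
  from this[of N] False show ?thesis by simp
qed simp

lemma RR_ex:
  "\<exists>w. A.eqv N (A.ex N (gen w + gen (R w)) * A.ex N (- gen (R w))) (A.ex N (gen x)) \<and>
    A.eqv N (RR (A.ex N (gen x))) (A.ex N (gen (R w)))"
proof -
  obtain w where w: "A.eqv N (A.ex N (gen w + gen (R w)) * A.ex N (- gen (R w))) (A.ex N (gen x))"
    using ex_factor by blast
  have "A.eqv N (RR (A.ex N (gen x))) (A.ex N (gen (R w)))"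
    using A.eqv_trans[OF A.eqv_sym[OF RR_eqv[OF w]], of "A.ex N (gen (R w))"] RR_twist[of N w 1] by (simp add: RR_one)
  with w show ?thesis by blast
qed

lemma RR_ex_J1: "N > 0 \<Longrightarrow> RR (A.ex N (gen x)) - 1 \<in> J 1"
  using RR_J[OF A.ex_J[OF gen_J1[of x], of N]] by (simp add: RR_diff RR_one)

text \<open>With e^x = e^{w + R w} e^{-R w} and e^u = e^{R w}, the product e^x e^u collapses to e^{w
  + R w}, which is the input of \<open>RR_twist\<close>. The exponent \<open>u\<close> stays general
  to cover both the truncated logarithm \<open>rb N (gen x)\<close> and a generator.\<close>

lemma RR_rota_baxter:
  assumes n: "n \<le> N" and u: "u \<in> J 1" and e: "A.eqv n (A.ex N u) (RR (A.ex N (gen x)))"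
  shows "A.eqv n (RR (A.ex N (gen x) * A.ex N u * h * A.ex N (- u))) (A.ex N u * RR h)"
proof -
  obtain w where w: "A.eqv N (A.ex N (gen w + gen (R w)) * A.ex N (- gen (R w))) (A.ex N (gen x))"
    and w': "A.eqv N (RR (A.ex N (gen x))) (A.ex N (gen (R w)))"
    using RR_ex by blast
  let ?b = "gen (R w) :: ('g,'k) falg" and ?a = "gen w + gen (R w) :: ('g,'k) falg"
  have eb: "A.eqv n (A.ex N u) (A.ex N ?b)"
    by (rule A.eqv_trans[OF e A.eqv_mono[OF n w']])
  have ub: "A.eqv n u ?b"
    by (rule A.ex_inj_truncated[OF u gen_J1 n eb])
  have "A.eqv n (A.ex N (gen x) * A.ex N u) (A.ex N ?a * A.ex N (- ?b) * A.ex N ?b)"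
    by (intro A.eqv_mult eb A.eqv_mono[OF n A.eqv_sym[OF w]])
  also have "A.eqv n \<dots> (A.ex N ?a)"
    using A.eqv_mult[OF A.eqv_refl A.eqv_mono[OF n A.ex_inverse'[OF gen_J1]], of "A.ex N ?a"]
    by (simp add: mult.assoc)
  finally have "A.eqv n (A.ex N (gen x) * A.ex N u * h * A.ex N (- u)) (A.ex N ?a * h * A.ex N (- ?b))"
    by (intro A.eqv_mult A.eqv_refl A.ex_cong A.eqv_uminus ub)
  then have "A.eqv n (RR (A.ex N (gen x) * A.ex N u * h * A.ex N (- u))) (RR (A.ex N ?a * h * A.ex N (- ?b)))"
    by (rule RR_eqv)
  also have "A.eqv n \<dots> (A.ex N ?b * RR h)"
    by (rule A.eqv_mono[OF n RR_twist])
  also have "A.eqv n \<dots> (A.ex N u * RR h)"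
    by (intro A.eqv_mult A.eqv_sym[OF eb] A.eqv_refl)
  finally show ?thesis .
qed

subsection \<open>Completed sequences\<close>

lemma Rep_power: "fa_pow (Rep_falg u) k = Rep_falg (u ^ k)"
  by (induction k) (simp_all add: one_falg.rep_eq times_falg.rep_eq)

definition star :: "nat \<Rightarrow> ('g,'k) falg \<Rightarrow> ('g,'k) falg \<Rightarrow> ('g,'k) falg" where
  "star N u v = A.lg N (A.ex N u * A.ex N v)"

definition rb :: "nat \<Rightarrow> ('g,'k) falg \<Rightarrow> ('g,'k) falg" where
  "rb N u = A.lg N (RR (A.ex N u))"

text \<open>Passage from sequences in the ring to sequences of functions. Component n of
  \<open>hat_exp\<close> sums over k up to n, so it corresponds to truncation at
  \<open>Suc n\<close>.\<close>

definition Sq :: "(nat \<Rightarrow> ('g,'k) falg) \<Rightarrow> nat \<Rightarrow> 'g list \<Rightarrow> 'k" where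
  "Sq u = (\<lambda>n. Rep_falg (u n))"

lemma hat_exp_Sq: "hat_exp (Sq u) = Sq (\<lambda>n. A.ex (Suc n) (u n))"
  by (simp add: hat_exp_def Sq_def fun_eq_iff Rep_sum A.ex_def A.ep_def sc.rep_eq Rep_power lessThan_Suc_atMost)

lemma hat_log_Sq: "hat_log (Sq u) = Sq (\<lambda>n. A.lg (Suc n) (u n))"
proof
  fix n
  have "hat_log (Sq u) n = (\<Sum>k\<in>{1..n}. Rep_falg (sc ((- 1) ^ (k + 1) / of_nat k) ((u n - 1) ^ k)))"
    by (simp only: hat_log_def Sq_def sc.rep_eq Rep_power[symmetric] minus_falg.rep_eq one_falg.rep_eq)
  also have "\<dots> = Rep_falg (\<Sum>k\<in>{1..n}. sc (fps_nth (fps_ln 1) k) ((u n - 1) ^ k))"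
    unfolding Rep_sum
  proof (intro sum.cong refl)
    fix k assume "k \<in> {1..n}"
    then have "(- 1) ^ (k + 1) / of_nat k = (fps_nth (fps_ln 1) k :: 'k)"
      by (cases k) (simp_all add: fps_ln_nth)
    then show "Rep_falg (sc ((- 1) ^ (k + 1) / of_nat k) ((u n - 1) ^ k)) =
        Rep_falg (sc (fps_nth (fps_ln 1) k) ((u n - 1) ^ k))" by simp
  qed
  also have "(\<Sum>k\<in>{1..n}. sc (fps_nth (fps_ln 1) k) ((u n - 1) ^ k)) = A.lg (Suc n) (u n)"
    unfolding A.lg_def A.ev_def by (rule sum.mono_neutral_left) (auto simp: fps_ln_nth)
  finally show "hat_log (Sq u) n = Sq (\<lambda>n. A.lg (Suc n) (u n)) n" by (simp add: Sq_def)
qed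

lemma hat_star_Sq: "hat_star (Sq u) (Sq v) = Sq (\<lambda>n. star (Suc n) (u n) (v n))"
proof -
  have "hat_mult (Sq u) (Sq v) = Sq (\<lambda>n. u n * v n)" for u v
    by (simp add: hat_mult_def Sq_def times_falg.rep_eq)
  then show ?thesis by (simp add: hat_star_def hat_exp_Sq hat_log_Sq star_def)
qed

lemma RB_group_op_Sq: "RB_group_op R br (Sq u) = Sq (\<lambda>n. rb (Suc n) (u n))"
proof -
  have "hat_R R br (Sq u) = Sq (\<lambda>n. RR (u n))" for u
    by (simp add: hat_R_def Sq_def Rep_RR)
  then show ?thesis by (simp add: RB_group_op_def hat_exp_Sq hat_log_Sq rb_def)
qed

lemma hat_neg_Sq: "hat_neg (Sq u) = Sq (\<lambda>n. - u n)"
  by (simp add: hat_neg_def Sq_def uminus_falg.rep_eq)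

lemma ghat_emb_Sq: "ghat_emb x = Sq (\<lambda>n. gen (x n))"
  by (simp add: ghat_emb_def Sq_def Rep_gen)

lemma hat_eq_Sq: "hat_eq scale br F (Sq u) (Sq v) \<longleftrightarrow> (\<forall>n. A.eqv n (u n) (v n))"
  by (simp add: hat_eq_def Sq_def A.eqv_def fa_J_iff flip: minus_falg.rep_eq)

lemma ex_mult_J1: "N > 0 \<Longrightarrow> u \<in> J 1 \<Longrightarrow> v \<in> J 1 \<Longrightarrow> A.ex N u * A.ex N v - 1 \<in> J 1"
proof -
  assume "N > 0" "u \<in> J 1" "v \<in> J 1"
  then have "(A.ex N u - 1) * A.ex N v + (A.ex N v - 1) \<in> J 1"
    by (intro A.J_add A.J_mult_right A.ex_J)
  then show ?thesis by (simp add: algebra_simps)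
qed

lemma star_J1: "N > 0 \<Longrightarrow> u \<in> J 1 \<Longrightarrow> v \<in> J 1 \<Longrightarrow> star N u v \<in> J 1"
  unfolding star_def by (intro A.lg_J ex_mult_J1)

lemma ex_star: "N > 0 \<Longrightarrow> u \<in> J 1 \<Longrightarrow> v \<in> J 1 \<Longrightarrow> A.eqv N (A.ex N (star N u v)) (A.ex N u * A.ex N v)"
  unfolding star_def by (intro A.ex_lg ex_mult_J1)

lemma rb_J1: "N > 0 \<Longrightarrow> rb N (gen x) \<in> J 1"
  unfolding rb_def by (intro A.lg_J RR_ex_J1)

lemma ex_rb: "N > 0 \<Longrightarrow> A.eqv N (A.ex N (rb N (gen x))) (RR (A.ex N (gen x)))"
  unfolding rb_def by (intro A.ex_lg RR_ex_J1)

text \<open>After exponentiation \<open>star\<close> becomes the product and the claim is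
  \<open>RR_rota_baxter\<close>. All intermediate elements lie in \<open>J 1\<close>, where
  exponential and logarithm are inverse to each other.\<close>

lemma rb_star:
  fixes x y :: 'g
  assumes N: "N > 0"
  defines "gx \<equiv> gen x" and "gy \<equiv> gen y"
  shows "A.eqv N (star N (rb N gx) (rb N gy)) (rb N (star N (star N (star N gx (rb N gx)) gy) (- rb N gx)))"
proof -
  let ?u = "rb N gx"
  have J1: "gx \<in> J 1" "gy \<in> J 1" "?u \<in> J 1" "- ?u \<in> J 1"
    unfolding gx_def gy_def by (auto intro: gen_J1[unfolded One_nat_def] rb_J1[OF N, unfolded One_nat_def] A.J_uminus)
  note J2 = star_J1[OF N J1(1,3)] and J3 = star_J1[OF N star_J1[OF N J1(1,3)] J1(2)]
  have "A.eqv N (A.ex N (star N (star N (star N gx ?u) gy) (- ?u))) (A.ex N (star N (star N gx ?u) gy) * A.ex N (- ?u))"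
    by (rule ex_star[OF N J3 J1(4)])
  also have "A.eqv N \<dots> (A.ex N (star N gx ?u) * A.ex N gy * A.ex N (- ?u))"
    by (intro A.eqv_mult A.eqv_refl ex_star[OF N J2 J1(2)])
  also have "A.eqv N \<dots> (A.ex N gx * A.ex N ?u * A.ex N gy * A.ex N (- ?u))"
    by (intro A.eqv_mult A.eqv_refl ex_star[OF N J1(1,3)])
  finally have "A.eqv N (RR (A.ex N (star N (star N (star N gx ?u) gy) (- ?u))))
     (RR (A.ex N gx * A.ex N ?u * A.ex N gy * A.ex N (- ?u)))"
    by (rule RR_eqv)
  also have "A.eqv N \<dots> (A.ex N ?u * RR (A.ex N gy))"
    using RR_rota_baxter[OF order_refl J1(3), of N x] ex_rb[OF N, of x] by (simp add: gx_def)
  also have "A.eqv N \<dots> (A.ex N ?u * A.ex N (rb N gy))"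
    using A.eqv_sym[OF ex_rb[OF N, of y]] by (intro A.eqv_mult A.eqv_refl) (simp add: gy_def)
  finally have "A.eqv N (A.ex N ?u * A.ex N (rb N gy)) (RR (A.ex N (star N (star N (star N gx ?u) gy) (- ?u))))"
    by (rule A.eqv_sym)
  then have "A.eqv N (A.lg N (A.ex N ?u * A.ex N (rb N gy)))
      (A.lg N (RR (A.ex N (star N (star N (star N gx ?u) gy) (- ?u)))))"
    by (rule A.lg_cong)
  then show ?thesis by (simp only: star_def[of N ?u "rb N gy"] rb_def[of N "star N (star N (star N gx ?u) gy) (- ?u)"])
qed

lemma eqv_gen_F: "n \<ge> 1 \<Longrightarrow> A.eqv n (gen x) (gen y) \<Longrightarrow> x - y \<in> F n"
  using gen_J_imp_F[of n "x - y"] A.eqv_J[OF gen_diff_eqv[of n x y] order_refl] by (simp add: A.eqv_def)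

lemma F_gen_eqv: "n \<ge> 1 \<Longrightarrow> x - y \<in> F n \<Longrightarrow> A.eqv n (gen x) (gen y)"
  using gen_J[of n "x - y"] A.eqv_J[OF gen_diff_eqv[of n x y] order_refl] by (simp add: A.eqv_def)

text \<open>The elements of g are chosen independently for each n. Congruence of consecutive terms
  in U(g) makes the choices compatible in g, because \<open>eqv_gen_F\<close> turns membership in
  \<open>J n\<close> into membership in \<open>F n\<close>.\<close>

lemma compat_limit:
  assumes g: "\<And>n. \<exists>r. A.eqv (Suc n) (u n) (gen r)" and c: "\<And>n. A.eqv (Suc n) (u (Suc n)) (u n)"
  shows "\<exists>r. compat_seq F r \<and> (\<forall>n. A.eqv (Suc n) (u n) (gen (r n)))"
proof -
  obtain r where r: "\<And>n. A.eqv (Suc n) (u n) (gen (r n))" using g by metis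
  have "A.eqv (Suc n) (gen (r (Suc n))) (gen (r n))" for n
  proof -
    have "A.eqv (Suc n) (gen (r (Suc n))) (u (Suc n))"
      by (rule A.eqv_mono[OF _ A.eqv_sym[OF r]]) simp
    then show ?thesis using c r A.eqv_trans by blast
  qed
  then have "compat_seq F r" unfolding compat_seq_def by (simp add: eqv_gen_F)
  with r show ?thesis by blast
qed

lemma rb_limit:
  assumes x: "compat_seq F x"
  shows "\<exists>r. compat_seq F r \<and> (\<forall>n. A.eqv (Suc n) (rb (Suc n) (gen (x n))) (gen (r n)))"
proof (rule compat_limit)
  fix n
  obtain w where "A.eqv (Suc n) (RR (A.ex (Suc n) (gen (x n)))) (A.ex (Suc n) (gen (R w)))"
    using RR_ex by blast
  then have "A.eqv (Suc n) (rb (Suc n) (gen (x n))) (gen (R w))"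
    unfolding rb_def using A.lg_cong A.lg_ex[OF gen_J1] A.eqv_trans by blast
  then show "\<exists>r. A.eqv (Suc n) (rb (Suc n) (gen (x n))) (gen r)" by blast
  have "A.eqv (Suc n) (A.ex (Suc (Suc n)) (gen (x (Suc n)))) (A.ex (Suc n) (gen (x (Suc n))))"
    by (rule A.ex_truncate[OF gen_J1]) simp
  also have "A.eqv (Suc n) \<dots> (A.ex (Suc n) (gen (x n)))"
    using x by (intro A.ex_cong F_gen_eqv) (simp_all add: compat_seq_def)
  finally have "A.eqv (Suc n) (RR (A.ex (Suc (Suc n)) (gen (x (Suc n))))) (RR (A.ex (Suc n) (gen (x n))))"
    by (rule RR_eqv)
  moreover have "A.eqv (Suc n) (rb (Suc (Suc n)) (gen (x (Suc n)))) (A.lg (Suc n) (RR (A.ex (Suc (Suc n)) (gen (x (Suc n))))))"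
    unfolding rb_def by (rule A.lg_truncate[OF RR_ex_J1]) simp_all
  ultimately show "A.eqv (Suc n) (rb (Suc (Suc n)) (gen (x (Suc n)))) (rb (Suc n) (gen (x n)))"
    unfolding rb_def using A.lg_cong A.eqv_trans by blast
qed

lemma star_limit:
  "\<exists>r. compat_seq F r \<and> (\<forall>n. A.eqv (Suc n) (star (Suc n) (gen x) (gen y)) (gen (r n)))"
proof (rule compat_limit)
  fix n
  obtain c where "A.eqv (Suc n) (A.ex (Suc n) (gen x) * A.ex (Suc n) (gen y)) (A.ex (Suc n) (gen c))"
    using bch by blast
  then have "A.eqv (Suc n) (star (Suc n) (gen x) (gen y)) (gen c)"
    unfolding star_def using A.lg_cong A.lg_ex[OF gen_J1] A.eqv_trans by blast
  then show "\<exists>r. A.eqv (Suc n) (star (Suc n) (gen x) (gen y)) (gen r)" by blast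
  let ?E = "\<lambda>n. A.ex (Suc n) (gen x) * A.ex (Suc n) (gen y)"
  have "A.eqv (Suc n) (A.lg (Suc (Suc n)) (?E (Suc n))) (A.lg (Suc n) (?E (Suc n)))"
    by (rule A.lg_truncate[OF ex_mult_J1]) (simp_all add: gen_J1[unfolded One_nat_def])
  also have "A.eqv (Suc n) \<dots> (A.lg (Suc n) (?E n))"
    by (intro A.lg_cong A.eqv_mult A.ex_truncate gen_J1) simp_all
  finally show "A.eqv (Suc n) (star (Suc (Suc n)) (gen x) (gen y)) (star (Suc n) (gen x) (gen y))"
    unfolding star_def .
qed

lemma completed_rota_baxter:
  assumes "compat_seq F x" "compat_seq F y"
  shows "in_ghat scale br F (RB_group_op R br (ghat_emb x :: nat \<Rightarrow> 'g list \<Rightarrow> 'k))"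
    and "hat_eq scale br F
       (hat_star (RB_group_op R br (ghat_emb x :: nat \<Rightarrow> 'g list \<Rightarrow> 'k)) (RB_group_op R br (ghat_emb y)))
       (RB_group_op R br (hat_star (hat_star (hat_star (ghat_emb x) (RB_group_op R br (ghat_emb x))) (ghat_emb y))
         (hat_neg (RB_group_op R br (ghat_emb x)))))"
proof -
  obtain r where r: "compat_seq F r" "\<And>n. A.eqv (Suc n) (rb (Suc n) (gen (x n))) (gen (r n))"
    using rb_limit[OF assms(1)] by blast
  \<comment> \<open>Component n of the completion is read modulo \<open>J n\<close>, while its
    truncation is valid modulo \<open>J (Suc n)\<close>. The extra degree was spent on the
    compatibility of r, which demands \<open>F (Suc n)\<close>.\<close>
  have "A.eqv n (rb (Suc n) (gen (x n))) (gen (r n))" for n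
    by (rule A.eqv_mono[OF _ r(2)]) simp
  then show "in_ghat scale br F (RB_group_op R br (ghat_emb x :: nat \<Rightarrow> 'g list \<Rightarrow> 'k))"
    unfolding in_ghat_def using r(1) by (auto simp: ghat_emb_Sq RB_group_op_Sq hat_eq_Sq)
  show "hat_eq scale br F
       (hat_star (RB_group_op R br (ghat_emb x :: nat \<Rightarrow> 'g list \<Rightarrow> 'k)) (RB_group_op R br (ghat_emb y)))
       (RB_group_op R br (hat_star (hat_star (hat_star (ghat_emb x) (RB_group_op R br (ghat_emb x))) (ghat_emb y))
         (hat_neg (RB_group_op R br (ghat_emb x)))))"
    unfolding ghat_emb_Sq RB_group_op_Sq hat_star_Sq hat_neg_Sq hat_eq_Sq
    by (intro allI A.eqv_mono[OF _ rb_star]) simp_all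
qed

section \<open>The group on a complete Lie algebra\<close>

context
  assumes complete: "complete_filtration F"
begin

lemma gen_separated:
  assumes "\<And>n. A.eqv n (gen x) (gen y)" shows "x = y"
  using complete eqv_gen_F[OF _ assms] unfolding complete_filtration_def by simp

text \<open>Surjectivity onto the inverse limit supplies an element, injectivity makes it unique, so
  the definite description in \<open>g_star\<close> and \<open>g_RB\<close> denotes it.\<close>

lemma the_limit:
  fixes u :: "nat \<Rightarrow> ('g,'k) falg"
  assumes "\<exists>r. compat_seq F r \<and> (\<forall>n. A.eqv (Suc n) (u n) (gen (r n)))"
  shows "A.eqv n (gen (THE z. hat_eq scale br F (ghat_emb (\<lambda>_. z)) (Sq u))) (u n)"
proof -
  obtain r where r: "compat_seq F r" "\<And>n. A.eqv (Suc n) (u n) (gen (r n))" using assms by blast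
  obtain z where z: "\<And>n. z - r n \<in> F (Suc n)"
    using complete r(1) unfolding complete_filtration_def by blast
  have gz: "A.eqv n (gen z) (u n)" for n
  proof -
    have "A.eqv (Suc n) (gen z) (gen (r n))" by (rule F_gen_eqv[OF _ z]) simp
    from A.eqv_trans[OF this A.eqv_sym[OF r(2)]] have "A.eqv (Suc n) (gen z) (u n)" .
    then show ?thesis by (rule A.eqv_mono[rotated]) simp
  qed
  have "(THE z. hat_eq scale br F (ghat_emb (\<lambda>_. z)) (Sq u)) = z"
  proof (rule the_equality)
    show "hat_eq scale br F (ghat_emb (\<lambda>_. z)) (Sq u)" using gz by (simp add: ghat_emb_Sq hat_eq_Sq)
    fix z' assume "hat_eq scale br F (ghat_emb (\<lambda>_. z')) (Sq u)"
    then have z': "A.eqv n (gen z') (u n)" for n by (simp add: ghat_emb_Sq hat_eq_Sq)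
    show "z' = z" by (rule gen_separated) (rule A.eqv_trans[OF z' A.eqv_sym[OF gz]])
  qed
  with gz show ?thesis by simp
qed

abbreviation ee :: "nat \<Rightarrow> 'g \<Rightarrow> ('g,'k) falg" where "ee n x \<equiv> A.ex (Suc n) (gen x)"

text \<open>Reduces equations in g to congruences between exponentials in all components, where the
  group law is plain multiplication.\<close>

lemma ee_inj:
  assumes "\<And>n. A.eqv n (ee n x) (ee n y)" shows "x = y"
  by (rule gen_separated) (rule A.ex_inj_truncated[OF gen_J1 gen_J1 _ assms], simp)

lemma ee_star: "A.eqv n (ee n (g_star scale br F x y)) (ee n x * ee n y)"
proof -
  have "A.eqv n (gen (g_star scale br F x y)) (star (Suc n) (gen x) (gen y))"
    unfolding g_star_def ghat_emb_Sq[of "\<lambda>_. x"] ghat_emb_Sq[of "\<lambda>_. y"] hat_star_Sq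
    by (rule the_limit[OF star_limit])
  then have "A.eqv n (ee n (g_star scale br F x y)) (A.ex (Suc n) (star (Suc n) (gen x) (gen y)))"
    by (rule A.ex_cong)
  also have "A.eqv n \<dots> (ee n x * ee n y)"
    by (rule A.eqv_mono[OF _ ex_star[OF _ gen_J1 gen_J1]]) simp_all
  finally show ?thesis .
qed

lemma ee_RB: "A.eqv n (ee n (g_RB scale br F R x)) (RR (ee n x))"
proof -
  have x: "compat_seq F (\<lambda>_. x)" by (simp add: compat_seq_def)
  have "A.eqv n (gen (g_RB scale br F R x)) (rb (Suc n) (gen x))"
    unfolding g_RB_def ghat_emb_Sq[of "\<lambda>_. x"] RB_group_op_Sq
    by (rule the_limit[OF rb_limit[OF x]])
  then have "A.eqv n (ee n (g_RB scale br F R x)) (A.ex (Suc n) (rb (Suc n) (gen x)))"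
    by (rule A.ex_cong)
  also have "A.eqv n \<dots> (RR (ee n x))"
    by (rule A.eqv_mono[OF _ ex_rb]) simp_all
  finally show ?thesis .
qed

lemma ee_zero: "A.eqv n (ee n 0) 1"
proof -
  have "A.ex (Suc n) 0 = (1 :: ('g,'k) falg)"
    by (simp add: A.ex_def sum.lessThan_Suc_shift A.ep_def del: sum.lessThan_Suc)
  then show ?thesis using A.ex_cong[OF gen_zero_eqv[of n], of "Suc n"] by simp
qed

lemma ee_uminus: "A.eqv n (ee n (- x)) (A.ex (Suc n) (- gen x))"
  by (rule A.ex_cong[OF gen_uminus_eqv])

abbreviation gstar (infixl "\<star>" 70) where "x \<star> y \<equiv> g_star scale br F x y"

lemma star_assoc: "x \<star> y \<star> z = x \<star> (y \<star> z)"
proof (rule ee_inj)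
  fix n
  have 1: "A.eqv n (ee n (x \<star> y \<star> z)) (ee n x * ee n y * ee n z)"
    by (rule A.eqv_trans[OF ee_star A.eqv_mult[OF ee_star A.eqv_refl]])
  have 2: "A.eqv n (ee n (x \<star> (y \<star> z))) (ee n x * ee n y * ee n z)"
    unfolding mult.assoc by (rule A.eqv_trans[OF ee_star A.eqv_mult[OF A.eqv_refl ee_star]])
  show "A.eqv n (ee n (x \<star> y \<star> z)) (ee n (x \<star> (y \<star> z)))"
    by (rule A.eqv_trans[OF 1 A.eqv_sym[OF 2]])
qed

lemma star_zero_left: "0 \<star> x = x"
proof (rule ee_inj)
  fix n
  show "A.eqv n (ee n (0 \<star> x)) (ee n x)"
    using A.eqv_trans[OF ee_star A.eqv_mult[OF ee_zero A.eqv_refl]] by simp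
qed

lemma star_uminus_left: "- x \<star> x = 0"
proof (rule ee_inj)
  fix n
  have "A.eqv n (ee n (- x \<star> x)) (A.ex (Suc n) (- gen x) * ee n x)"
    by (rule A.eqv_trans[OF ee_star A.eqv_mult[OF ee_uminus A.eqv_refl]])
  also have "A.eqv n \<dots> 1"
    by (rule A.eqv_mono[OF _ A.ex_inverse'[OF gen_J1]]) simp
  also have "A.eqv n 1 (ee n 0)" by (rule A.eqv_sym[OF ee_zero])
  finally show "A.eqv n (ee n (- x \<star> x)) (ee n 0)" .
qed

lemma star_rota_baxter:
  defines "B \<equiv> g_RB scale br F R"
  shows "B x \<star> B y = B (x \<star> B x \<star> y \<star> - B x)"
proof (rule ee_inj)
  fix n
  have "A.eqv n (ee n (x \<star> B x \<star> y \<star> - B x)) (ee n x * ee n (B x) * ee n y * A.ex (Suc n) (- gen (B x)))"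
    by (rule A.eqv_trans[OF ee_star A.eqv_mult[OF A.eqv_trans[OF ee_star A.eqv_mult[OF ee_star A.eqv_refl]] ee_uminus]])
  then have "A.eqv n (RR (ee n (x \<star> B x \<star> y \<star> - B x)))
     (RR (ee n x * ee n (B x) * ee n y * A.ex (Suc n) (- gen (B x))))"
    by (rule RR_eqv)
  also have "A.eqv n \<dots> (ee n (B x) * RR (ee n y))"
    unfolding B_def by (rule RR_rota_baxter[OF _ gen_J1 ee_RB]) simp
  also have "A.eqv n \<dots> (ee n (B x) * ee n (B y))"
    unfolding B_def by (rule A.eqv_mult[OF A.eqv_refl A.eqv_sym[OF ee_RB]])
  also have "A.eqv n \<dots> (ee n (B x \<star> B y))"
    by (rule A.eqv_sym[OF ee_star])
  finally have 1: "A.eqv n (RR (ee n (x \<star> B x \<star> y \<star> - B x))) (ee n (B x \<star> B y))" .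
  have 2: "A.eqv n (ee n (B (x \<star> B x \<star> y \<star> - B x))) (RR (ee n (x \<star> B x \<star> y \<star> - B x)))"
    unfolding B_def by (rule ee_RB)
  show "A.eqv n (ee n (B x \<star> B y)) (ee n (B (x \<star> B x \<star> y \<star> - B x)))"
    by (rule A.eqv_sym[OF A.eqv_trans[OF 2 1]])
qed

lemma complete_rota_baxter_group:
  "rota_baxter_group \<lparr>carrier = UNIV, mult = g_star scale br F, one = 0\<rparr> (g_RB scale br F R)"
proof -
  let ?G = "\<lparr>carrier = UNIV, mult = g_star scale br F, one = 0\<rparr>"
  have G: "group ?G"
    by (rule groupI) (auto simp: star_assoc star_zero_left intro: star_uminus_left)
  have inv: "inv\<^bsub>?G\<^esub> x = - x" for x
    by (rule group.inv_equality[OF G]) (simp_all add: star_uminus_left)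
  show ?thesis
    unfolding rota_baxter_group_def using G star_rota_baxter by (simp add: inv)
qed

end

end

lemma rb_lie_algI:
  assumes "filtered_rb_lie_algebra scale br F R"
  shows "rb_lie_alg scale br F R"
proof -
  have f: "filtered_lie_algebra scale br F" and rb: "rota_baxter_lie scale br R"
    and RF: "\<And>n x. n \<ge> 1 \<Longrightarrow> x \<in> F n \<Longrightarrow> R x \<in> F n"
    using assms unfolding filtered_rb_lie_algebra_def by auto
  have l: "lie_algebra scale br" using f unfolding filtered_lie_algebra_def by auto
  interpret vector_space scale using l unfolding lie_algebra_def by auto
  interpret lie_alg scale br
    using l unfolding lie_algebra_def by unfold_locales auto
  interpret filtered_lie_alg scale br F
    using f unfolding filtered_lie_algebra_def by unfold_locales auto
  have lin: "Vector_Spaces.linear scale scale R"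
    and R: "\<And>x y. br (R x) (R y) = R (br (R x) y + br x (R y) + br x y)"
    using rb unfolding rota_baxter_lie_def by auto
  interpret L: Vector_Spaces.linear scale scale R by (rule lin)
  show ?thesis
    by unfold_locales (use R RF L.add L.scale in auto)
qed

theorem theorem4p12:
  fixes scale :: "'k::field_char_0 \<Rightarrow> 'g::ab_group_add \<Rightarrow> 'g"
    and br :: "'g \<Rightarrow> 'g \<Rightarrow> 'g" and F :: "nat \<Rightarrow> 'g set" and R :: "'g \<Rightarrow> 'g"
  assumes "filtered_rb_lie_algebra scale br F R"
  shows "(\<forall>x y. compat_seq F x \<longrightarrow> compat_seq F y \<longrightarrow>
            (let X = (ghat_emb x :: nat \<Rightarrow> 'g list \<Rightarrow> 'k); Y = ghat_emb y;
                 RX = RB_group_op R br X; RY = RB_group_op R br Y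
             in in_ghat scale br F RX \<and>
                hat_eq scale br F (hat_star RX RY)
                  (RB_group_op R br (hat_star (hat_star (hat_star X RX) Y) (hat_neg RX)))))
       \<and> (complete_filtration F \<longrightarrow>
            rota_baxter_group \<lparr>carrier = UNIV, mult = g_star scale br F, one = 0\<rparr> (g_RB scale br F R))"
proof -
  interpret rb_lie_alg scale br F R by (rule rb_lie_algI[OF assms])
  show ?thesis
    unfolding Let_def using completed_rota_baxter complete_rota_baxter_group by blast
qed

end
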